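(* (1) The family $\mathcal{A}^{\mathbf{\Sigma}^0_2}$ has exactly 34 elements and is both a $\sqsubseteq_c$-antichain basis and a $\leq_c$-antichain basis for the class of non-$\mathbf{\Sigma}^0_2$ s-acyclic locally countable Borel relations on an analytic space. (2) $(\mathbb{D},\mathbb{G}^{\mathbf{\Sigma}^0_2}_m)$ is $\sqsubseteq_c$-minimum among non-$\mathbf{\Sigma}^0_2$ acyclic locally countable Borel graphs on an analytic space.
   Context: A relation on $X$ is a subset of $X^2$. For topological spaces $X,Y$ and $A\subseteq X^2$, $B\subseteq Y^2$: $(X,A)\leq_c(Y,B)$ means there is a continuous $f:X\to Y$ with $A=(f\times f)^{-1}(B)$; $(X,A)\sqsubseteq_c(Y,B)$ means such an $f$ can be chosen injective. An analytic space is a separable metrizable space homeomorphic to an analytic subset of a Polish space. A relation is locally countable if all its horizontal and vertical sections are countable. A graph is a symmetric relation disjoint from the diagonal. A relation $R$ on $X$ is non-$\mathbf{\Sigma}^0_2$ if it is not a $\mathbf{\Sigma}^0_2$ subset of $X^2$. For a relation $A$ on $X$, $s(A)=A\cup A^{-1}$ is its symmetrization. An $A$-path is a finite sequence $(x_i)_{i\leq n}$ of points of $X$ with $(x_i,x_{i+1})\in A$ for $i<n$. $A$ is acyclic if there is no injective $A$-path $(x_i)_{i\leq n}$ with $n\geq 2$ and $(x_n,x_0)\in A$; $A$ is s-acyclic if $s(A)$ is acyclic. For a class $\mathcal Q$ of pairs $(X,R)$ and a quasi-order $\leq$, an antichain is a subclass of pairwise $\leq$-incomparable elements; a basis for $\mathcal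 Q$ is a subclass $B$ of $\mathcal Q$ such that every element of $\mathcal Q$ is $\leq$-above an element of $B$; an antichain basis is a basis which is an antichain. An element of $\mathcal Q$ is $\leq$-minimum if it is $\leq$-below every element of $\mathcal Q$. Let $2=\{0,1\}$, $4=\{0,1,2,3\}$, $\mathbb{D}=2\times 2^\omega$, $\mathbb{C}=\mathbb{P}_\infty:=\{\alpha\in 2^\omega\mid\alpha(n)=1\text{ for infinitely many }n\}$, $S_0=\mathbb{C}$, $S_1=\emptyset$, $S_2=2^\omega\setminus\mathbb{C}$, $S_3=2^\omega$, and $\Delta(E)=\{(x,x)\mid x\in E\}$. Let $P$ be the set of functions $t:2\times 2\to 4$ such that $t(0,0)\neq 0$, $t(1,1)\neq 0$, $t(0,1)=0$, and ($t(1,0)=0\Rightarrow t(0,0)\leq t(1,1)$). For $t\in P$, $\mathbb{R}^{\mathbf{\Sigma}^0_2}_t=\{((\varepsilon,x),(\eta,x))\in\mathbb{D}^2\mid x\in S_{t(\varepsilon,\eta)}\}$. Finally $\mathcal{A}^{\mathbf{\Sigma}^0_2}=\{(2^\omega,\Delta(\mathbb{C}))\}\cup\{(\mathbb{D},\mathbb{R}^{\mathbf{\Sigma}^0_2}_t)\mid t\in P\}$ and $\mathbb{G}^{\mathbf{\Sigma}^0_2}_m=\{((\varepsilon,x),(1-\varepsilon,x))\mid\varepsilon\in 2,\ x\in\mathbb{C}\}$. *)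

theory Defs
  imports "HOL-Analysis.Analysis"
begin

subsection \<open>Analytic spaces\<close>

definition polish_space :: "'a topology \<Rightarrow> bool" where
  "polish_space X \<longleftrightarrow> separable_space X \<and> completely_metrizable_space X"

text \<open>
  A Polish space has at most continuum many points, hence is homeomorphic to one whose
  points are of type \<^typ>\<open>nat \<Rightarrow> nat\<close>.  So restricting the two existential quantifiers over
  Polish spaces below to topologies on (subsets of) this type loses nothing; the topology
  itself is arbitrary and need not be related to that of the Baire space.
\<close>

definition analytic_in :: "'a topology \<Rightarrow> 'a set \<Rightarrow> bool" where
  "analytic_in X A \<longleftrightarrow> A \<subseteq> topspace X \<and>
     (\<exists>(Y :: (nat \<Rightarrow> nat) topology) f.
        polish_space Y \<and> continuous_map Y X f \<and> f ` topspace Y = A)"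

definition analytic_space :: "'a topology \<Rightarrow> bool" where
  "analytic_space X \<longleftrightarrow> separable_space X \<and> metrizable_space X \<and>
     (\<exists>(Y :: (nat \<Rightarrow> nat) topology) A.
        polish_space Y \<and> analytic_in Y A \<and> X homeomorphic_space (subtopology Y A))"

definition borel_in :: "'a topology \<Rightarrow> 'a set \<Rightarrow> bool" where
  "borel_in X A \<longleftrightarrow> A \<in> sigma_sets (topspace X) {U. openin X U}"

subsection \<open>Spaces with a relation, and the two quasi-orders\<close>

type_synonym 'a relspace = "'a topology \<times> ('a \<times> 'a) set"

definition reduces_via :: "('a \<Rightarrow> 'b) \<Rightarrow> 'a relspace \<Rightarrow> 'b relspace \<Rightarrow> bool" where
  "reduces_via f = (\<lambda>(X, A) (Y, B). continuous_map X Y f \<and>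
     A = {(x, y) \<in> topspace X \<times> topspace X. (f x, f y) \<in> B})"

definition le_c :: "'a relspace \<Rightarrow> 'b relspace \<Rightarrow> bool" (infix \<open>\<le>\<^sub>c\<close> 50) where
  "XA \<le>\<^sub>c YB \<longleftrightarrow> (\<exists>f. reduces_via f XA YB)"

definition emb_c :: "'a relspace \<Rightarrow> 'b relspace \<Rightarrow> bool" (infix \<open>\<sqsubseteq>\<^sub>c\<close> 50) where
  "XA \<sqsubseteq>\<^sub>c YB \<longleftrightarrow> (\<exists>f. inj_on f (topspace (fst XA)) \<and> reduces_via f XA YB)"

subsection \<open>Classes of relations\<close>

definition symmetrization :: "('a \<times> 'a) set \<Rightarrow> ('a \<times> 'a) set" where
  "symmetrization A = A \<union> A\<inverse>"

definition rel_path :: "('a \<times> 'a) set \<Rightarrow> nat \<Rightarrow> (nat \<Rightarrow> 'a) \<Rightarrow> bool" where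
  "rel_path A n x \<longleftrightarrow> (\<forall>i<n. (x i, x (Suc i)) \<in> A)"

text \<open>Unrelated to \<^const>\<open>acyclic\<close>, which forbids all directed cycles, including those of length 1 and 2.\<close>

definition acyclic_rel :: "('a \<times> 'a) set \<Rightarrow> bool" where
  "acyclic_rel A \<longleftrightarrow>
     \<not> (\<exists>n x. n \<ge> 2 \<and> rel_path A n x \<and> inj_on x {..n} \<and> (x n, x 0) \<in> A)"

definition s_acyclic :: "('a \<times> 'a) set \<Rightarrow> bool" where
  "s_acyclic A \<longleftrightarrow> acyclic_rel (symmetrization A)"

definition locally_countable :: "'a relspace \<Rightarrow> bool" where
  "locally_countable = (\<lambda>(X, R). \<forall>x \<in> topspace X. countable (R `` {x}) \<and> countable (R\<inverse> `` {x}))"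

definition is_graph :: "('a \<times> 'a) set \<Rightarrow> bool" where
  "is_graph R \<longleftrightarrow> sym R \<and> R \<inter> Id = {}"

text \<open>On the metrizable space \<open>X\<^sup>2\<close>, the boldface class \<open>\<Sigma>\<^sup>0\<^sub>2\<close> consists of the F-sigma sets.\<close>

definition non_Sigma02_lc_borel :: "'a relspace set" where
  "non_Sigma02_lc_borel = {(X, R). analytic_space X \<and>
     R \<subseteq> topspace X \<times> topspace X \<and>
     borel_in (prod_topology X X) R \<and> \<not> fsigma_in (prod_topology X X) R \<and>
     locally_countable (X, R)}"

definition s_acyclic_relations :: "'a relspace set" where
  "s_acyclic_relations = {(X, R) \<in> non_Sigma02_lc_borel. s_acyclic R}"

definition acyclic_graphs :: "'a relspace set" where
  "acyclic_graphs = {(X, R) \<in> non_Sigma02_lc_borel. is_graph R \<and> acyclic_rel R}"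

subsection \<open>Antichains, bases, minimum elements\<close>

definition antichain :: "('b \<Rightarrow> 'b \<Rightarrow> bool) \<Rightarrow> 'b set \<Rightarrow> bool" where
  "antichain le B \<longleftrightarrow> pairwise (\<lambda>x y. \<not> le x y \<and> \<not> le y x) B"

text \<open>
  The classes of interest range over spaces with points of any type, so they are polymorphic
  sets.  In the next two definitions \<open>Q'\<close> is the instance of the class at the type of the
  candidate, used only to say that the candidate lies in the class, and \<open>Q\<close> is the instance
  at the type of the elements to be bounded from below.
\<close>

definition basis_for :: "('b \<Rightarrow> 'a \<Rightarrow> bool) \<Rightarrow> 'b set \<Rightarrow> 'a set \<Rightarrow> 'b set \<Rightarrow> bool" where
  "basis_for le Q' Q B \<longleftrightarrow> B \<subseteq> Q' \<and> (\<forall>q \<in> Q. \<exists>b \<in> B. le b q)"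

definition minimum_for :: "('b \<Rightarrow> 'a \<Rightarrow> bool) \<Rightarrow> 'b set \<Rightarrow> 'a set \<Rightarrow> 'b \<Rightarrow> bool" where
  "minimum_for le Q' Q b \<longleftrightarrow> b \<in> Q' \<and> (\<forall>q \<in> Q. le b q)"

subsection \<open>The concrete examples\<close>

text \<open>The set \<open>2 = {0, 1}\<close> is \<^typ>\<open>bool\<close>, with \<^const>\<open>False\<close> for 0 and \<^const>\<open>True\<close> for 1.\<close>

type_synonym cantor = "nat \<Rightarrow> bool"

definition cantor_top :: "cantor topology" where
  "cantor_top = product_topology (\<lambda>_. discrete_topology UNIV) UNIV"

definition D_top :: "(bool \<times> cantor) topology" where
  "D_top = prod_topology (discrete_topology UNIV) cantor_top"

definition P_infinity :: "cantor set" where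
  "P_infinity = {\<alpha>. infinite {n. \<alpha> n}}"

text \<open>Only the indices 0, 1, 2, 3 are used.\<close>

definition S_sec :: "nat \<Rightarrow> cantor set" where
  "S_sec i = (if i = 0 then P_infinity else if i = 1 then {}
          else if i = 2 then UNIV - P_infinity else UNIV)"

definition P_codes :: "(bool \<times> bool \<Rightarrow> nat) set" where
  "P_codes = {t. range t \<subseteq> {0, 1, 2, 3} \<and>
           t (False, False) \<noteq> 0 \<and> t (True, True) \<noteq> 0 \<and> t (False, True) = 0 \<and>
           (t (True, False) = 0 \<longrightarrow> t (False, False) \<le> t (True, True))}"

definition R_rel :: "(bool \<times> bool \<Rightarrow> nat) \<Rightarrow> ((bool \<times> cantor) \<times> (bool \<times> cantor)) set" where
  "R_rel t = {((\<epsilon>, x), (\<eta>, x)) | \<epsilon> \<eta> x. x \<in> S_sec (t (\<epsilon>, \<eta>))}"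

definition G_m :: "((bool \<times> cantor) \<times> (bool \<times> cantor)) set" where
  "G_m = {((\<epsilon>, x), (\<not> \<epsilon>, x)) | \<epsilon> x. x \<in> P_infinity}"

text \<open>
  To put spaces on \<open>2\<^sup>\<omega>\<close> and on \<open>2 \<times> 2\<^sup>\<omega>\<close> into one set, they are transported to a disjoint
  sum type along the injections.
\<close>

definition copy_along :: "('a \<Rightarrow> 'b) \<Rightarrow> 'a relspace \<Rightarrow> 'b relspace" where
  "copy_along h = (\<lambda>(X, R).
     (pullback_topology (h ` topspace X) (inv_into (topspace X) h) X, map_prod h h ` R))"

lemma homeomorphic_map_copy_along:
  assumes "inj_on h (topspace X)"
  shows "homeomorphic_map X (fst (copy_along h (X, R))) h"
proof -
  let ?g = "inv_into (topspace X) h"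
  let ?Y = "pullback_topology (h ` topspace X) ?g X"
  have inv: "?g (h x) = x" if "x \<in> topspace X" for x
    using assms that by simp
  have "continuous_map ?Y X ?g"
    using continuous_map_pullback [where g = id and f = ?g and ?T1.0 = X and ?T2.0 = X] by simp
  moreover have "continuous_map X ?Y h"
    by (rule continuous_map_pullback')
       (auto intro: continuous_map_eq [OF continuous_map_id] simp: inv)
  moreover have "topspace ?Y = h ` topspace X"
    using inv by (auto simp: topspace_pullback_topology)
  ultimately have "homeomorphic_maps X ?Y h ?g"
    using inv by (auto simp: homeomorphic_maps_def)
  then show ?thesis
    by (auto simp: copy_along_def homeomorphic_map_maps)
qed

definition family_A :: "(cantor + bool \<times> cantor) relspace set" where
  "family_A = {copy_along Inl (cantor_top, Id_on P_infinity)} \<union>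
              {copy_along Inr (D_top, R_rel t) | t. t \<in> P_codes}"

end

theory Submission
  imports Defs
begin

text \<open>
  Let \<open>R\<close> be an s-acyclic locally countable Borel relation on an analytic space \<open>X\<close> which is not
  F-sigma.  The heart of the matter is to find one of the examples inside \<open>R\<close>.

  As in Hurewicz's theorem, \<open>R\<close> contains the image of a Polish space \<open>Y\<close> under a continuous
  \<open>f : Y \<rightarrow> X\<^sup>2\<close> such that no nonempty open subset of \<open>Y\<close> is mapped into an F-sigma subset of \<open>R\<close>
  (\<open>presentation_exists\<close>).  In particular the closure of \<open>f U\<close> leaves \<open>R\<close> for every nonempty open \<open>U\<close>, so
  one can choose a countable set \<open>Q\<close> outside \<open>R\<close> which meets all these closures, and then build a
  continuous \<open>\<phi> : 2\<^sup>\<omega> \<rightarrow> X\<^sup>2\<close> which sends the sequences with infinitely many ones to \<open>f Y\<close> and the others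
  to \<open>Q\<close>.  The coordinates of \<open>\<phi>\<close> form a continuous map \<open>2 \<times> 2\<^sup>\<omega> \<rightarrow> X\<close>.  The preimage of \<open>R\<close> under it
  is one of the relations \<open>R_rel t\<close> as soon as (a) points of \<open>X\<close> which come from different elements of
  \<open>2\<^sup>\<omega>\<close> are different and unrelated, and (b) whether two points which come from the same element \<open>\<alpha>\<close> are
  related depends only on whether \<open>\<alpha>\<close> has infinitely many ones.

  Condition (b) is obtained by passing to smaller sets: Borel sets have the Baire property, and if \<open>Q\<close> is
  split into finitely many pieces, one of them still meets the closures of \<open>f U\<close> for all small \<open>U\<close>.

  Condition (a) for two points of \<open>Q\<close> comes from acyclicity.  There is no cycle of length four, so two
  vertices have at most one common neighbour, and therefore the neighbours of at most one vertex can be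
  dense in the relevant sense; if there is such a vertex, one restricts to its neighbours
  (\<open>accumulates_sparse\<close>).  Afterwards each point excludes only a negligible set of further points, and
  \<open>Q\<close> can be chosen one point after the other.

  Condition (a) for the other points comes from local countability.  Mutual genericity cannot be
  arranged, because a node of the construction must keep its accumulation point in \<open>Q\<close> while infinitely many
  branches through it and through other nodes are still to be separated.  Instead, over a dense
  G-delta set of \<open>y \<in> Y\<close>, the neighbours of the coordinates of \<open>f y\<close> are the values at \<open>y\<close> of countably many
  continuous functions (\<open>generic_countable_uniformization\<close>, a generic form of the Lusin-Novikov
  theorem).  A single function \<open>h\<close> can be handled: a small target can be avoided by \<open>h\<close> on a smaller set which
  has the same accumulation point (\<open>avoid_on_smaller_sets\<close>).  This drives the construction in
  \<open>fusion_scheme\<close> and \<open>cantor_copy\<close>.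

  If \<open>R\<close> restricted to the diagonal looks like \<open>P_infinity\<close> along one of the coordinates, then already the
  diagonal of \<open>P_infinity\<close> embeds; otherwise one gets \<open>R_rel t\<close>, after an exchange of the coordinates if
  necessary, with \<open>t\<close> in \<open>P_codes\<close> (\<open>basis_embeds\<close>).

  The examples are incomparable because no trace of \<open>P_infinity\<close> on a nonempty open set is F-sigma, by the
  Baire category theorem, whereas the other three sections are F-sigma: a reduction must locally
  map the two points of a fibre to the two points of a fibre, and it must respect the type of each section
  (\<open>R_rel_le_c_imp_eq\<close>).  Finally, \<open>G_m\<close> is one of the relations \<open>R_rel t\<close>, and it is the only example which is
  symmetric and irreflexive, so it is the one which embeds when \<open>R\<close> is a graph.
\<close>

section \<open>Polish spaces and Baire category\<close>

lemma second_countable_prod_topology: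
  assumes "second_countable X" "second_countable Y"
  shows "second_countable (prod_topology X Y)"
proof -
  obtain A B where A: "countable A" "\<And>V. V \<in> A \<Longrightarrow> openin X V"
      "\<And>U x. openin X U \<Longrightarrow> x \<in> U \<Longrightarrow> \<exists>V\<in>A. x \<in> V \<and> V \<subseteq> U"
    and B: "countable B" "\<And>V. V \<in> B \<Longrightarrow> openin Y V"
      "\<And>U x. openin Y U \<Longrightarrow> x \<in> U \<Longrightarrow> \<exists>V\<in>B. x \<in> V \<and> V \<subseteq> U"
    using assms unfolding second_countable_def by metis
  show ?thesis unfolding second_countable_def
  proof (intro exI conjI ballI allI impI)
    show "countable ((\<lambda>(U,V). U \<times> V) ` (A \<times> B))" using A(1) B(1) by simp
    show "openin (prod_topology X Y) W" if "W \<in> (\<lambda>(U,V). U \<times> V) ` (A \<times> B)" for W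
      using that A(2) B(2) by (auto simp: openin_prod_Times_iff)
    fix W z assume "openin (prod_topology X Y) W \<and> z \<in> W"
    then obtain U V where "openin X U" "openin Y V" "z \<in> U \<times> V" "U \<times> V \<subseteq> W"
      unfolding openin_prod_topology_alt by (metis mem_Sigma_iff surj_pair)
    moreover then obtain U' V' where "U' \<in> A" "V' \<in> B" "fst z \<in> U'" "U' \<subseteq> U" "snd z \<in> V'" "V' \<subseteq> V"
      using A(3)[of U "fst z"] B(3)[of V "snd z"] by auto
    ultimately show "\<exists>V\<in>(\<lambda>(U,V). U \<times> V) ` (A \<times> B). z \<in> V \<and> V \<subseteq> W"
      by (intro bexI[of _ "U' \<times> V'"]) (auto simp: mem_Times_iff)
  qed
qed

lemma separable_metrizable_imp_second_countable:
  assumes "separable_space X" "metrizable_space X"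
  shows "second_countable X"
proof -
  obtain M d where M: "Metric_space M d" and X: "X = Metric_space.mtopology M d"
    using assms(2) by (auto simp: metrizable_space_def)
  interpret Metric_space M d by (rule M)
  obtain C where C: "countable C" "C \<subseteq> M" "mtopology closure_of C = M"
    using assms(1) by (auto simp: separable_space_def X)
  let ?B = "(\<lambda>(c,n). mball c (1 / Suc n)) ` (C \<times> (UNIV::nat set))"
  show ?thesis unfolding second_countable_def
  proof (intro exI conjI ballI allI impI)
    show "countable ?B" using C(1) by simp
    show "openin X W" if "W \<in> ?B" for W using that by (auto simp: X)
    fix W z assume W: "openin X W \<and> z \<in> W"
    then obtain r where r: "r > 0" "mball z r \<subseteq> W" "z \<in> M" unfolding X openin_mtopology by blast
    obtain n where n: "1 / Suc n < r / 2" using r(1) by (meson half_gt_zero nat_approx_posE)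
    have "mball z (1 / Suc n) \<inter> C \<noteq> {}"
    proof -
      have "z \<in> mball z (1 / Suc n)" using r(3) by (simp add: in_mball)
      then show ?thesis
        using C(3) dense_intersects_open[of mtopology C] openin_mball[of z "1 / Suc n"]
        unfolding topspace_mtopology by blast
    qed
    then obtain c where c: "c \<in> C" "d z c < 1 / Suc n" "c \<in> M" using C(2) by (auto simp: in_mball)
    have "mball c (1 / Suc n) \<subseteq> mball z r"
    proof
      fix x assume "x \<in> mball c (1 / Suc n)"
      then have "d c x < 1 / Suc n" "x \<in> M" by (auto simp: in_mball)
      then show "x \<in> mball z r" using c n triangle[of z c x] r(3) by (auto simp: in_mball)
    qed
    then show "\<exists>V\<in>?B. z \<in> V \<and> V \<subseteq> W" using c r
      by (intro bexI[of _ "mball c (1 / Suc n)"]) (auto simp: in_mball commute)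
  qed
qed

lemma polish_space_imp_metrizable: "polish_space Y \<Longrightarrow> metrizable_space Y"
  by (simp add: polish_space_def completely_metrizable_imp_metrizable_space)

lemma polish_space_imp_Hausdorff: "polish_space Y \<Longrightarrow> Hausdorff_space Y"
  by (simp add: polish_space_imp_metrizable metrizable_imp_Hausdorff_space)

lemma polish_space_imp_second_countable: "polish_space Y \<Longrightarrow> second_countable Y"
  using polish_space_imp_metrizable separable_metrizable_imp_second_countable polish_space_def by blast

lemma polish_spaceI: "completely_metrizable_space Y \<Longrightarrow> second_countable Y \<Longrightarrow> polish_space Y"
  by (simp add: polish_space_def second_countable_imp_separable_space)

lemma polish_space_gdelta: "polish_space Y \<Longrightarrow> gdelta_in Y G \<Longrightarrow> polish_space (subtopology Y G)"
  by (meson completely_metrizable_space_gdelta_in polish_spaceI polish_space_def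
      polish_space_imp_second_countable second_countable_subtopology)

lemma polish_space_closedin: "polish_space Y \<Longrightarrow> closedin Y C \<Longrightarrow> polish_space (subtopology Y C)"
  by (simp add: polish_space_gdelta closed_imp_gdelta_in polish_space_imp_metrizable)

lemma polish_space_prod: "polish_space X \<Longrightarrow> polish_space Y \<Longrightarrow> polish_space (prod_topology X Y)"
  by (meson completely_metrizable_space_prod_topology polish_spaceI polish_space_def
      polish_space_imp_second_countable second_countable_prod_topology)

lemma euclidean_nat_discrete: "(euclidean :: nat topology) = discrete_topology UNIV"
  by (simp add: topology_eq open_discrete)

lemma polish_space_baire: "polish_space (euclidean :: (nat \<Rightarrow> nat) topology)"
proof (rule polish_spaceI)
  show "second_countable (euclidean :: (nat \<Rightarrow> nat) topology)"
  proof -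
    obtain B :: "(nat \<Rightarrow> nat) set set" where "countable B" "topological_basis B"
      using ex_countable_basis by blast
    then show ?thesis unfolding second_countable_def
      by (intro exI[of _ B]) (auto simp: topological_basis_open elim: topological_basisE)
  qed
next
  have "completely_metrizable_space (euclidean :: nat topology)"
    by (metis completely_metrizable_space_discrete_topology euclidean_nat_discrete)
  then have "completely_metrizable_space (product_topology (\<lambda>_ :: nat. euclidean :: nat topology) UNIV)"
    by (subst completely_metrizable_space_product_topology) auto
  then show "completely_metrizable_space (euclidean :: (nat \<Rightarrow> nat) topology)"
    by (simp add: euclidean_product_topology)
qed

definition meager_in :: "'a topology \<Rightarrow> 'a set \<Rightarrow> bool" where
  "meager_in Y A \<longleftrightarrow>
     (\<exists>\<G>. countable \<G> \<and> (\<forall>T\<in>\<G>. closedin Y T \<and> Y interior_of T = {}) \<and> A \<subseteq> \<Union>\<G>)"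

text \<open>Comeager sets are handled through the dense G-delta sets which they contain, because the latter are
  Polish again, so that one can restrict to them and continue.\<close>

definition dense_gdelta :: "'a topology \<Rightarrow> 'a set \<Rightarrow> bool" where
  "dense_gdelta Y G \<longleftrightarrow> gdelta_in Y G \<and> (\<forall>U. openin Y U \<longrightarrow> U \<noteq> {} \<longrightarrow> U \<inter> G \<noteq> {})"

lemma dense_gdeltaD: "dense_gdelta Y G \<Longrightarrow> openin Y U \<Longrightarrow> U \<noteq> {} \<Longrightarrow> \<exists>y. y \<in> U \<inter> G"
  by (auto simp: dense_gdelta_def)

lemma dense_gdelta_subset: "dense_gdelta Y G \<Longrightarrow> G \<subseteq> topspace Y"
  by (simp add: dense_gdelta_def gdelta_in_subset)

lemma polish_space_dense_gdelta: "polish_space Y \<Longrightarrow> dense_gdelta Y G \<Longrightarrow> polish_space (subtopology Y G)"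
  by (simp add: dense_gdelta_def polish_space_gdelta)

lemma meager_in_subset:
  assumes "meager_in Y B" "A \<subseteq> B"
  shows "meager_in Y A"
proof -
  obtain \<G> where "countable \<G>" "\<forall>T\<in>\<G>. closedin Y T \<and> Y interior_of T = {}" "B \<subseteq> \<Union>\<G>"
    using assms(1) unfolding meager_in_def by (elim exE conjE)
  moreover have "A \<subseteq> \<Union>\<G>" using assms(2) \<open>B \<subseteq> \<Union>\<G>\<close> by (rule subset_trans)
  ultimately show ?thesis unfolding meager_in_def by (intro exI conjI)
qed

lemma meager_in_closed: "closedin Y T \<Longrightarrow> Y interior_of T = {} \<Longrightarrow> meager_in Y T"
  unfolding meager_in_def by (intro exI[of _ "{T}"]) auto

lemma meager_in_Union:
  assumes "countable \<A>" "\<And>A. A \<in> \<A> \<Longrightarrow> meager_in Y A"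
  shows "meager_in Y (\<Union>\<A>)"
proof -
  obtain g where g: "\<And>A. A \<in> \<A> \<Longrightarrow>
      countable (g A) \<and> (\<forall>T\<in>g A. closedin Y T \<and> Y interior_of T = {}) \<and> A \<subseteq> \<Union>(g A)"
    using assms(2) unfolding meager_in_def by metis
  show ?thesis unfolding meager_in_def
  proof (intro exI[of _ "\<Union>(g ` \<A>)"] conjI)
    show "\<Union> \<A> \<subseteq> \<Union> (\<Union> (g ` \<A>))"
    proof
      fix x assume "x \<in> \<Union>\<A>"
      then obtain A where A: "A \<in> \<A>" "x \<in> A" by (rule UnionE)
      then have "x \<in> \<Union>(g A)" using g by (meson subsetD)
      then show "x \<in> \<Union>(\<Union>(g ` \<A>))" using A(1) by (auto simp only: Union_iff)
    qed
    show "countable (\<Union>(g ` \<A>))" using assms(1) g by blast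
    show "\<forall>T\<in>\<Union>(g ` \<A>). closedin Y T \<and> Y interior_of T = {}" using g by blast
  qed
qed

lemma meager_in_UN: "countable I \<Longrightarrow> (\<And>i. i \<in> I \<Longrightarrow> meager_in Y (A i)) \<Longrightarrow> meager_in Y (\<Union>i\<in>I. A i)"
  by (rule meager_in_Union) auto

lemma meager_in_Un: "meager_in Y A \<Longrightarrow> meager_in Y B \<Longrightarrow> meager_in Y (A \<union> B)"
  using meager_in_Union[of "{A,B}" Y] by auto

text \<open>The Baire category theorem: in a Polish space, the complement of a countable union of closed sets with
  empty interior is a dense G-delta set.\<close>

lemma meager_in_avoid:
  assumes "polish_space Y" "meager_in Y A"
  obtains G where "dense_gdelta Y G" "G \<inter> A = {}"
proof -
  obtain \<G> where G: "countable \<G>" "\<And>T. T \<in> \<G> \<Longrightarrow> closedin Y T \<and> Y interior_of T = {}" "A \<subseteq> \<Union>\<G>"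
    using assms(2) unfolding meager_in_def by blast
  have "fsigma_in Y (\<Union>\<G>)"
    using G(1,2) by (intro fsigma_in_Union) (blast intro: closed_imp_fsigma_in)+
  then have "gdelta_in Y (topspace Y - \<Union>\<G>)"
    by (simp add: gdelta_in_diff)
  moreover have "Y interior_of (\<Union>\<G>) = {}"
    using Baire_category_alt[of Y \<G>] G(1,2) assms(1) by (auto simp: polish_space_def)
  then have "U \<inter> (topspace Y - \<Union>\<G>) \<noteq> {}" if "openin Y U" "U \<noteq> {}" for U
    using that interior_of_maximal[of U "\<Union>\<G>" Y] openin_subset[of Y U] by blast
  ultimately show ?thesis using G(3) that[of "topspace Y - \<Union>\<G>"] by (auto simp: dense_gdelta_def)
qed

lemma not_meager_open:
  assumes "polish_space Y" "openin Y U" "U \<noteq> {}"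
  shows "\<not> meager_in Y U"
proof
  assume "meager_in Y U"
  then obtain G where "dense_gdelta Y G" "G \<inter> U = {}" by (rule meager_in_avoid[OF assms(1)])
  with dense_gdeltaD[OF this(1) assms(2,3)] show False by (auto simp only: Int_iff set_eq_iff empty_iff)
qed

lemma meager_in_complement:
  assumes "dense_gdelta Y G"
  shows "meager_in Y (topspace Y - G)"
proof -
  have "fsigma_in Y (topspace Y - G)" using assms by (simp add: dense_gdelta_def fsigma_in_diff)
  then obtain \<G> where G: "countable \<G>" "\<G> \<subseteq> Collect (closedin Y)" "\<Union>\<G> = topspace Y - G"
    by (auto simp: fsigma_in_def union_of_def)
  show ?thesis unfolding meager_in_def
  proof (intro exI[of _ \<G>] conjI ballI)
    fix T assume T: "T \<in> \<G>"
    have "T \<inter> G = {}" using T G(3) by blast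
    then have "Y interior_of T \<inter> G = {}" using interior_of_subset[of Y T] by blast
    then have "Y interior_of T = {}" using dense_gdeltaD[OF assms openin_interior_of] by (metis empty_iff)
    then show "Y interior_of T = {}" .
    show "closedin Y T" using T G(2) by (auto simp only: mem_Collect_eq subset_iff)
  next
    show "topspace Y - G \<subseteq> \<Union>\<G>" using G(3) by (simp only: subset_refl)
  qed (rule G(1))
qed

lemma dense_gdelta_INT:
  assumes "polish_space Y" "countable I" "\<And>i. i \<in> I \<Longrightarrow> dense_gdelta Y (G i)"
  obtains H where "dense_gdelta Y H" "\<And>i. i \<in> I \<Longrightarrow> H \<subseteq> G i"
proof -
  have "meager_in Y (\<Union>i\<in>I. topspace Y - G i)"
    using assms by (intro meager_in_UN meager_in_complement)
  then obtain H where H: "dense_gdelta Y H" "H \<inter> (\<Union>i\<in>I. topspace Y - G i) = {}"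
    using meager_in_avoid[OF assms(1)] by blast
  then show ?thesis using that[of H] dense_gdelta_subset[OF H(1)] by blast
qed

lemma gdelta_in_preimage:
  assumes "continuous_map X Y f" "gdelta_in Y G"
  shows "gdelta_in X {x \<in> topspace X. f x \<in> G}"
proof -
  obtain \<U> where U: "countable \<U>" "\<U> \<subseteq> Collect (openin Y)" "G = topspace Y \<inter> \<Inter>\<U>"
    using assms(2) unfolding gdelta_in_def relative_to_def intersection_of_def by auto
  let ?V = "insert (topspace X) ((\<lambda>U. {x \<in> topspace X. f x \<in> U}) ` \<U>)"
  have "gdelta_in X (\<Inter>?V)"
  proof (rule gdelta_in_Inter)
    show "gdelta_in X S" if "S \<in> ?V" for S
      using that U(2) by (auto intro!: open_imp_gdelta_in openin_continuous_map_preimage[OF assms(1)])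
  qed (use U(1) in auto)
  moreover have "\<Inter>?V = {x \<in> topspace X. f x \<in> G}"
    using U(3) continuous_map_image_subset_topspace[OF assms(1)] by auto
  ultimately show ?thesis by simp
qed

lemma fsigma_in_preimage:
  assumes "continuous_map X Y f" "fsigma_in Y F"
  shows "fsigma_in X {x \<in> topspace X. f x \<in> F}"
proof -
  have "gdelta_in X {x \<in> topspace X. f x \<in> topspace Y - F}"
    using assms by (intro gdelta_in_preimage) (auto simp: gdelta_in_diff)
  then have "fsigma_in X (topspace X - {x \<in> topspace X. f x \<in> topspace Y - F})"
    by (simp add: fsigma_in_diff)
  moreover have "topspace X - {x \<in> topspace X. f x \<in> topspace Y - F} = {x \<in> topspace X. f x \<in> F}"
    using continuous_map_image_subset_topspace[OF assms(1)] by auto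
  ultimately show ?thesis by simp
qed

section \<open>Borel sets as projections\<close>

lemma borel_in_preimage:
  assumes f: "continuous_map X Y f" and B: "borel_in Y B"
  shows "borel_in X {x \<in> topspace X. f x \<in> B}"
  using B unfolding borel_in_def
proof (induction rule: sigma_sets.induct)
  case (Basic a)
  then show ?case using openin_continuous_map_preimage[OF f] by (auto intro: sigma_sets.Basic)
next
  case Empty
  then show ?case by (simp add: sigma_sets.Empty)
next
  case (Compl a)
  have "{x \<in> topspace X. f x \<in> topspace Y - a} = topspace X - {x \<in> topspace X. f x \<in> a}"
    using continuous_map_image_subset_topspace[OF f] by auto
  then show ?case using Compl.IH by (simp add: sigma_sets.Compl)
next
  case (Union a)
  have "{x \<in> topspace X. f x \<in> \<Union>(range a)} = (\<Union>i. {x \<in> topspace X. f x \<in> a i})" by auto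
  then show ?case using Union.IH by (simp add: sigma_sets.Union)
qed

text \<open>These are the analytic subsets of \<open>Z\<close>, when \<open>Z\<close> is Polish.\<close>

definition closed_projection :: "'a topology \<Rightarrow> 'a set \<Rightarrow> bool" where
  "closed_projection Z B \<longleftrightarrow>
     (\<exists>C. closedin (prod_topology Z (euclidean :: (nat \<Rightarrow> nat) topology)) C \<and> fst ` C = B)"

lemma continuous_map_reindex:
  "continuous_map (prod_topology Z (euclidean :: (nat \<Rightarrow> nat) topology))
     (prod_topology Z (euclidean :: (nat \<Rightarrow> nat) topology)) (\<lambda>(z, w). (z, \<lambda>m. w (g m)))"
proof -
  have "continuous_on UNIV (\<lambda>w :: nat \<Rightarrow> nat. \<lambda>m. w (g m))"
    by (intro continuous_on_coordinatewise_then_product continuous_on_product_coordinates)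
  then have "continuous_map euclidean euclidean (\<lambda>w :: nat \<Rightarrow> nat. \<lambda>m. w (g m))" by simp
  from continuous_map_compose[OF continuous_map_snd this, of Z]
  show ?thesis by (auto simp: continuous_map_pairwise o_def split_def intro: continuous_map_fst)
qed

lemma closed_projection_closed: "closedin Z C \<Longrightarrow> closed_projection Z C"
  unfolding closed_projection_def by (intro exI[of _ "C \<times> UNIV"]) (auto simp: closedin_prod_Times_iff)

text \<open>The first entry of a sequence names one of the sets, and the rest is a witness for membership in it.\<close>

lemma closed_projection_UN:
  assumes "\<And>n :: nat. closed_projection Z (B n)"
  shows "closed_projection Z (\<Union>n. B n)"
proof -
  let ?P = "prod_topology Z (euclidean :: (nat \<Rightarrow> nat) topology)"
  obtain C where C: "\<And>n. closedin ?P (C n)" "\<And>n. fst ` C n = B n"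
    using assms unfolding closed_projection_def by metis
  define r where "r = (\<lambda>(z :: 'a, w :: nat \<Rightarrow> nat). (z, \<lambda>m. w (Suc m)))"
  have r: "continuous_map ?P ?P r" unfolding r_def by (rule continuous_map_reindex)
  have coord: "openin ?P {x \<in> topspace ?P. snd x 0 = n}" for n
  proof -
    have "open {w :: nat \<Rightarrow> nat. w 0 \<in> {n}}"
      using open_vimage[OF _ continuous_on_product_coordinates[of 0], of "{n}"] by (simp add: vimage_def open_discrete)
    then have "openin ?P (topspace Z \<times> {w :: nat \<Rightarrow> nat. w 0 \<in> {n}})"
      by (simp add: openin_prod_Times_iff)
    moreover have "topspace Z \<times> {w :: nat \<Rightarrow> nat. w 0 \<in> {n}} = {x \<in> topspace ?P. snd x 0 = n}" by auto
    ultimately show ?thesis by simp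
  qed
  define D where "D = {x \<in> topspace ?P. r x \<in> C (snd x 0)}"
  have "topspace ?P - D = (\<Union>n. {x \<in> topspace ?P. snd x 0 = n} \<inter> {x \<in> topspace ?P. r x \<in> topspace ?P - C n})"
    by (auto simp: D_def r_def)
  also have "openin ?P \<dots>"
  proof (intro openin_Union ballI, elim imageE, simp only:)
    fix n show "openin ?P ({x \<in> topspace ?P. snd x 0 = n} \<inter> {x \<in> topspace ?P. r x \<in> topspace ?P - C n})"
      by (intro openin_Int coord openin_continuous_map_preimage[OF r] openin_diff openin_topspace C(1))
  qed
  finally have "closedin ?P D" unfolding closedin_def by (auto simp: D_def)
  moreover have "fst ` D = (\<Union>n. B n)"
  proof (intro equalityI subsetI)
    fix z assume "z \<in> fst ` D"
    then obtain w where "(z, w) \<in> D" by auto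
    then have "(z, \<lambda>m. w (Suc m)) \<in> C (w 0)" by (auto simp: D_def r_def)
    then have "z \<in> fst ` C (w 0)" by force
    then show "z \<in> (\<Union>n. B n)" using C(2) by blast
  next
    fix z assume "z \<in> (\<Union>n. B n)"
    then obtain n where "z \<in> fst ` C n" using C(2) by blast
    then obtain w where w: "(z, w) \<in> C n" by auto
    have "(z, case_nat n w) \<in> D" using w closedin_subset[OF C(1)[of n]] by (auto simp: D_def r_def)
    then show "z \<in> fst ` D" by force
  qed
  ultimately show ?thesis unfolding closed_projection_def by blast
qed

text \<open>One sequence codes a sequence of witnesses, one for each set.\<close>

lemma closed_projection_INT:
  assumes "\<And>n :: nat. closed_projection Z (B n)"
  shows "closed_projection Z (\<Inter>n. B n)"
proof -
  let ?P = "prod_topology Z (euclidean :: (nat \<Rightarrow> nat) topology)"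
  obtain C where C: "\<And>n. closedin ?P (C n)" "\<And>n. fst ` C n = B n"
    using assms unfolding closed_projection_def by metis
  define r where "r n = (\<lambda>(z :: 'a, w :: nat \<Rightarrow> nat). (z, \<lambda>m. w (prod_encode (n, m))))" for n
  have r: "continuous_map ?P ?P (r n)" for n unfolding r_def by (rule continuous_map_reindex)
  define D where "D = (\<Inter>n. {x \<in> topspace ?P. r n x \<in> C n})"
  have "closedin ?P D" unfolding D_def
    using C(1) by (intro closedin_Inter) (auto intro!: closedin_continuous_map_preimage[OF r] simp del: topspace_prod_topology)
  moreover have "fst ` D = (\<Inter>n. B n)"
  proof (intro equalityI subsetI)
    fix z assume "z \<in> fst ` D"
    then obtain w where "(z, w) \<in> D" by auto
    then have "(z, \<lambda>m. w (prod_encode (n, m))) \<in> C n" for n by (auto simp: D_def r_def)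
    then have "z \<in> fst ` C n" for n by force
    then show "z \<in> (\<Inter>n. B n)" using C(2) by blast
  next
    fix z assume "z \<in> (\<Inter>n. B n)"
    then have "\<exists>w. (z, w) \<in> C n" for n using C(2) by force
    then obtain w where w: "\<And>n. (z, w n) \<in> C n" by metis
    have "(z, \<lambda>k. case prod_decode k of (n, m) \<Rightarrow> w n m) \<in> D"
      using w closedin_subset[OF C(1)] by (fastforce simp: D_def r_def)
    then show "z \<in> fst ` D" by force
  qed
  ultimately show ?thesis unfolding closed_projection_def by blast
qed

text \<open>The sets which together with their complement are projections of closed sets form a
  sigma-algebra.  It contains the open sets, which are F-sigma in a metrizable space.\<close>

lemma borel_in_closed_projection:
  assumes "metrizable_space Z" "borel_in Z B"
  shows "closed_projection Z B"
proof -
  have "closed_projection Z B \<and> closed_projection Z (topspace Z - B)"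
    using assms(2) unfolding borel_in_def
  proof (induction rule: sigma_sets.induct)
    case (Basic U)
    then have "fsigma_in Z U" using assms(1) by (simp add: open_imp_fsigma_in)
    then obtain C where "\<And>n :: nat. closedin Z (C n)" "\<Union>(range C) = U"
      by (auto simp: fsigma_in_ascending)
    then have "closed_projection Z U" using closed_projection_UN[of Z C] closed_projection_closed by auto
    then show ?case using Basic by (auto intro: closed_projection_closed)
  next
    case Empty
    then show ?case by (auto intro: closed_projection_closed)
  next
    case (Compl a)
    then have "topspace Z - (topspace Z - a) = a"
      using sigma_sets_into_sp[of "{U. openin Z U}" "topspace Z"] openin_subset by blast
    then show ?case using Compl.IH by simp
  next
    case (Union a)
    have "topspace Z - \<Union>(range a) = (\<Inter>n. topspace Z - a n)" by auto
    then show ?case using Union.IH closed_projection_UN[of Z a] closed_projection_INT[of Z "\<lambda>n. topspace Z - a n"]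
      by simp
  qed
  then show ?thesis ..
qed

lemma borel_in_polish_image:
  assumes "polish_space Z" "borel_in Z B"
  obtains C :: "('a \<times> (nat \<Rightarrow> nat)) topology"
  where "polish_space C" "continuous_map C Z fst" "fst ` topspace C = B"
proof -
  obtain C where C: "closedin (prod_topology Z (euclidean :: (nat \<Rightarrow> nat) topology)) C" "fst ` C = B"
    using borel_in_closed_projection[OF polish_space_imp_metrizable] assms unfolding closed_projection_def by blast
  let ?C = "subtopology (prod_topology Z euclidean) C"
  have "polish_space ?C"
    by (intro polish_space_closedin polish_space_prod polish_space_baire assms C)
  moreover have "continuous_map ?C Z fst"
    by (intro continuous_map_from_subtopology continuous_map_fst)
  moreover have "fst ` topspace ?C = B" using C closedin_subset[OF C(1)] by (simp add: topspace_subtopology Int_absorb1)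
  ultimately show ?thesis using that by blast
qed

section \<open>Continuous maps between Polish spaces over generic points\<close>

lemma second_countableE:
  assumes "second_countable X"
  obtains \<B> where "countable \<B>" "\<And>V. V \<in> \<B> \<Longrightarrow> openin X V"
    "\<And>U x. openin X U \<Longrightarrow> x \<in> U \<Longrightarrow> \<exists>V\<in>\<B>. x \<in> V \<and> V \<subseteq> U"
  using assms unfolding second_countable_def by metis

lemma dense_gdelta_Int:
  assumes "polish_space Y" "dense_gdelta Y A" "dense_gdelta Y B"
  shows "dense_gdelta Y (A \<inter> B)"
proof -
  have "meager_in Y ((topspace Y - A) \<union> (topspace Y - B))"
    by (intro meager_in_Un meager_in_complement assms)
  then obtain H where H: "dense_gdelta Y H" "H \<inter> ((topspace Y - A) \<union> (topspace Y - B)) = {}"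
    by (rule meager_in_avoid[OF assms(1)])
  have "H \<subseteq> A" "H \<subseteq> B" using H(2) dense_gdelta_subset[OF H(1)] by blast+
  then have "U \<inter> (A \<inter> B) \<noteq> {}" if "openin Y U" "U \<noteq> {}" for U
    using dense_gdeltaD[OF H(1) that] by blast
  moreover have "gdelta_in Y (A \<inter> B)" using assms by (simp add: dense_gdelta_def gdelta_in_Int)
  ultimately show ?thesis by (simp add: dense_gdelta_def)
qed

lemma nowhere_dense_frontier_closure:
  "meager_in Y (Y closure_of A - Y interior_of (Y closure_of A))"
proof (rule meager_in_closed)
  show "closedin Y (Y closure_of A - Y interior_of (Y closure_of A))"
    by (intro closedin_diff closedin_closure_of openin_interior_of)
  let ?W = "Y interior_of (Y closure_of A - Y interior_of (Y closure_of A))"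
  have "?W \<subseteq> Y closure_of A - Y interior_of (Y closure_of A)" by (rule interior_of_subset)
  moreover from this have "?W \<subseteq> Y interior_of (Y closure_of A)" by (intro interior_of_maximal) auto
  ultimately show "?W = {}" by blast
qed

text \<open>This strengthens the Baire property of analytic sets.  After removal of the set \<open>D\<close>, which is the union of
  the basic open sets with meager image, the image of an open set \<open>U\<close> is contained in \<open>I U\<close>, the
  interior of its closure, up to a meager set.  Conversely \<open>I U\<close> is covered, up to a meager set, by the sets \<open>I V\<close> for small \<open>V\<close>
  inside \<open>U\<close>.  So a generic \<open>y \<in> I U\<close> lies in \<open>I V\<close> for a sequence of sets \<open>V\<close> which shrink to a point, and
  \<open>p\<close> maps this point to \<open>y\<close>.\<close>

lemma generically_open_map:
  assumes C: "polish_space C" and Y: "polish_space Y" and p: "continuous_map C Y p"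
  obtains G where "dense_gdelta Y G"
    "\<And>U. openin C U \<Longrightarrow> openin (subtopology Y G) (p ` U \<inter> G)"
proof -
  obtain M d where "Metric_space M d" and mc: "Metric_space.mcomplete M d"
      and CM: "C = Metric_space.mtopology M d"
    using C by (auto simp: polish_space_def completely_metrizable_space_def)
  interpret Metric_space M d by fact
  obtain \<B> where B: "countable \<B>" "\<And>V. V \<in> \<B> \<Longrightarrow> openin C V"
    "\<And>U x. openin C U \<Longrightarrow> x \<in> U \<Longrightarrow> \<exists>V\<in>\<B>. x \<in> V \<and> V \<subseteq> U"
    using polish_space_imp_second_countable[OF C] by (rule second_countableE) blast
  have topC: "topspace C = M" by (simp add: CM)
  have pY: "p c \<in> topspace Y" if "c \<in> M" for c
    using continuous_map_image_subset_topspace[OF p] that topC by auto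
  define D where "D = \<Union>{V \<in> \<B>. meager_in Y (p ` V)}"
  have pD: "meager_in Y (p ` D)"
  proof -
    have "p ` D = (\<Union>V\<in>{V \<in> \<B>. meager_in Y (p ` V)}. p ` V)" unfolding D_def by blast
    also have "meager_in Y \<dots>" using B(1) by (intro meager_in_UN) auto
    finally show ?thesis .
  qed
  have big: "\<not> meager_in Y (p ` (U - D))" if U: "openin C U" "\<not> U \<subseteq> D" for U
  proof
    assume "meager_in Y (p ` (U - D))"
    then have "meager_in Y (p ` (U - D) \<union> p ` D)" using pD by (rule meager_in_Un)
    then have m: "meager_in Y (p ` U)" by (rule meager_in_subset) blast
    have "U \<subseteq> D"
    proof
      fix c assume "c \<in> U"
      then obtain V where V: "V \<in> \<B>" "c \<in> V" "V \<subseteq> U" using B(3)[OF U(1)] by blast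
      then have "meager_in Y (p ` V)" using meager_in_subset[OF m, of "p ` V"] by blast
      then show "c \<in> D" using V unfolding D_def by blast
    qed
    with U(2) show False by simp
  qed
  define I where "I U = Y interior_of (Y closure_of (p ` (U - D)))" for U
  have oI: "openin Y (I U)" for U unfolding I_def by simp
  have Icl: "I U \<subseteq> Y closure_of (p ` (U - D))" for U unfolding I_def by (rule interior_of_subset)
  have pU: "p ` (U - D) \<subseteq> Y closure_of (p ` (U - D))" if "openin C U" for U
    using openin_subset[OF that] pY topC by (intro closure_of_subset) auto
  have Ine: "I U \<noteq> {}" if U: "openin C U" "\<not> U \<subseteq> D" for U
  proof
    assume "I U = {}"
    then have "meager_in Y (Y closure_of (p ` (U - D)))"
      using nowhere_dense_frontier_closure[of Y "p ` (U - D)"] unfolding I_def by simp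
    then show False using big[OF U] meager_in_subset pU[OF U(1)] by blast
  qed
  \<comment> \<open>the admissible next steps inside \<open>U\<close>; the bound on their size makes sequences of steps converge\<close>
  define N where "N U n = {V \<in> \<B>. C closure_of V \<subseteq> U \<and> (\<exists>x. V \<subseteq> mball x (1 / Suc n))}" for U n
  have Nex: "\<exists>V\<in>N W n. c \<in> V" if W: "openin C W" "c \<in> W" for W c n
  proof -
    obtain r where r: "r > 0" "mball c r \<subseteq> W" "c \<in> M" using W unfolding CM openin_mtopology by blast
    define e where "e = min (r/2) (1 / Suc n)"
    have e: "e > 0" "e < r" "e \<le> 1 / Suc n" using r(1) by (auto simp: e_def)
    have "openin C (mball c e)" by (simp add: CM)
    moreover have "c \<in> mball c e" using e r by simp
    ultimately obtain V where V: "V \<in> \<B>" "c \<in> V" "V \<subseteq> mball c e" using B(3) by blast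
    have "C closure_of V \<subseteq> mcball c e"
      unfolding CM using V(3) by (intro closure_of_minimal) (auto simp: mball_subset_mcball intro: order_trans)
    also have "\<dots> \<subseteq> W" using e(2) r(2) by (meson mcball_subset_mball_concentric order_trans)
    finally have "V \<in> N W n" unfolding N_def using V e(3) mball_subset_concentric by blast
    then show ?thesis using V(2) by blast
  qed
  have NB: "N U n \<subseteq> \<B>" for U n unfolding N_def by blast
  have meagN: "meager_in Y (I U - (\<Union>V\<in>N U n. I V))" if U: "openin C U" for U n
  proof -
    let ?T = "Y closure_of (I U) - (\<Union>V\<in>N U n. I V)"
    have "meager_in Y ?T"
    proof (rule meager_in_closed)
      show "closedin Y ?T" by (intro closedin_diff closedin_closure_of openin_Union) (auto intro: oI)
      show "Y interior_of ?T = {}"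
      proof (rule ccontr)
        assume ne: "Y interior_of ?T \<noteq> {}"
        define W where "W = Y interior_of ?T"
        have W: "openin Y W" "W \<subseteq> ?T" "W \<noteq> {}" using ne unfolding W_def by (simp_all add: interior_of_subset)
        have "W \<inter> I U \<noteq> {}"
        proof
          assume "W \<inter> I U = {}"
          then have "W \<inter> Y closure_of (I U) = {}" using openin_Int_closure_of_eq_empty[OF W(1)] by simp
          then show False using W(2,3) by blast
        qed
        then obtain y0 where y0: "y0 \<in> W \<inter> I U" by blast
        have "openin Y (W \<inter> I U)" using W oI by blast
        obtain y where y: "y \<in> p ` (U - D)" "y \<in> W \<inter> I U"
        proof -
          have "y0 \<in> Y closure_of (p ` (U - D))" using y0 Icl[of U] by blast
          then show thesis using y0 \<open>openin Y (W \<inter> I U)\<close> that unfolding in_closure_of by meson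
        qed
        then obtain c where c: "c \<in> U" "c \<notin> D" "p c \<in> W \<inter> I U" by blast
        let ?W' = "U \<inter> {c \<in> topspace C. p c \<in> W \<inter> I U}"
        have oW': "openin C ?W'"
          by (intro openin_Int U openin_continuous_map_preimage[OF p] W(1) oI)
        moreover have "c \<in> ?W'" using c openin_subset[OF U] by blast
        ultimately obtain V where V: "V \<in> N ?W' n" "c \<in> V" using Nex by blast
        have "N ?W' n \<subseteq> N U n" unfolding N_def by blast
        with V have VN: "V \<in> N U n" by blast
        have oV: "openin C V" using V NB B(2) by blast
        have "I V \<noteq> {}" using Ine[OF oV] c(2) V(2) by blast
        then obtain z where "z \<in> I V" by blast
        then obtain z' where z': "z' \<in> p ` (V - D)" "z' \<in> I V"
        proof -
          have "z \<in> Y closure_of (p ` (V - D))" using \<open>z \<in> I V\<close> Icl[of V] by blast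
          then show thesis using \<open>z \<in> I V\<close> oI[of V] that unfolding in_closure_of by meson
        qed
        have "V \<subseteq> C closure_of V" using openin_subset[OF oV] by (rule closure_of_subset)
        then have "V \<subseteq> ?W'" using V(1) unfolding N_def by blast
        then have "z' \<in> W" using z'(1) by blast
        then show False using W(2) z'(2) VN by blast
      qed
    qed
    moreover have "I U \<subseteq> Y closure_of (I U)" using openin_subset[OF oI] by (rule closure_of_subset)
    ultimately show ?thesis by (elim meager_in_subset) blast
  qed
  define Bad where "Bad = p ` D \<union> (\<Union>U\<in>\<B>. p ` (U - D) - I U) \<union> (\<Union>U\<in>\<B>. \<Union>n. I U - (\<Union>V\<in>N U n. I V))"
  have "meager_in Y Bad" unfolding Bad_def
  proof (intro meager_in_Un meager_in_UN pD B(1) meagN B(2))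
    fix U assume "U \<in> \<B>"
    then show "meager_in Y (p ` (U - D) - I U)"
      using meager_in_subset[OF nowhere_dense_frontier_closure[of Y "p ` (U - D)"], of "p ` (U - D) - I U"] pU B(2)
      unfolding I_def by blast
  qed auto
  then obtain G where G: "dense_gdelta Y G" "G \<inter> Bad = {}" by (rule meager_in_avoid[OF Y])
  have eq: "p ` U \<inter> G = I U \<inter> G" if U: "U \<in> \<B>" for U
  proof (intro equalityI subsetI)
    fix y assume y: "y \<in> p ` U \<inter> G"
    then have "y \<notin> p ` D" "y \<notin> p ` (U - D) - I U" using G(2) U unfolding Bad_def by blast+
    then show "y \<in> I U \<inter> G" using y by blast
  next
    fix y assume y: "y \<in> I U \<inter> G"
    have step: "\<exists>V\<in>N U' n. y \<in> I V" if "U' \<in> \<B>" "y \<in> I U'" for U' n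
      using that y G(2) unfolding Bad_def by blast
    have "\<exists>S. \<forall>n. (S n \<in> \<B> \<and> y \<in> I (S n) \<and> (n = 0 \<longrightarrow> S n = U)) \<and> S (Suc n) \<in> N (S n) n"
      by (rule dependent_nat_choice) (use U y step NB in blast)+
    then obtain S where S: "\<And>n. S n \<in> \<B>" "\<And>n. y \<in> I (S n)" "S 0 = U" "\<And>n. S (Suc n) \<in> N (S n) n"
      by blast
    have oS: "openin C (S n)" for n using B(2) S(1) by blast
    have sub: "C closure_of S (Suc n) \<subseteq> S n" for n using S(4)[of n] unfolding N_def by blast
    have Ssub: "S n \<subseteq> C closure_of (S n)" for n using openin_subset[OF oS] by (rule closure_of_subset)
    have "\<Inter>(range (\<lambda>n. C closure_of (S n))) \<noteq> {}"
    proof (rule mcomplete_nest[THEN iffD1, OF mc, rule_format], intro conjI allI impI)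
      show "closedin mtopology (C closure_of S n)" for n by (simp add: CM)
      show "C closure_of S n \<noteq> {}" for n
        using S(2)[of n] Icl[of "S n"] Ssub[of n] by (auto simp: in_closure_of)
      show "decseq (\<lambda>n. C closure_of S n)"
        unfolding decseq_Suc_iff using sub Ssub by blast
      fix e :: real assume "e > 0"
      then obtain n where n: "1 / Suc n < e" using nat_approx_posE by blast
      obtain x where x: "S (Suc n) \<subseteq> mball x (1 / Suc n)" using S(4)[of n] unfolding N_def by blast
      have "C closure_of S (Suc n) \<subseteq> mcball x e"
      proof (unfold CM, rule closure_of_minimal)
        show "S (Suc n) \<subseteq> mcball x e" using x n
          by (meson less_imp_le mball_subset_concentric mball_subset_mcball order_trans)
      qed simp
      then show "\<exists>n a. C closure_of S n \<subseteq> mcball a e" by blast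
    qed
    then obtain c where c: "\<And>n. c \<in> C closure_of (S n)" by blast
    have cS: "c \<in> S n" for n using c[of "Suc n"] sub by blast
    have cM: "c \<in> M" using cS[of 0] openin_subset[OF oS] topC by blast
    have "p c = y"
    proof (rule ccontr)
      assume ne: "p c \<noteq> y"
      have "y \<in> topspace Y" using y oI openin_subset by blast
      then obtain A E where A: "openin Y A" "openin Y E" "p c \<in> A" "y \<in> E" "A \<inter> E = {}"
        using polish_space_imp_Hausdorff[OF Y] pY[OF cM] ne unfolding Hausdorff_space_def disjnt_def by metis
      have "openin C {x \<in> topspace C. p x \<in> A}" by (rule openin_continuous_map_preimage[OF p A(1)])
      moreover have "c \<in> {x \<in> topspace C. p x \<in> A}" using A cM topC by blast
      ultimately obtain r where r: "r > 0" "mball c r \<subseteq> {x \<in> topspace C. p x \<in> A}"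
        unfolding CM openin_mtopology by blast
      obtain n where n: "1 / Suc n < r / 2" using r(1) by (meson half_gt_zero nat_approx_posE)
      obtain x where x: "S (Suc n) \<subseteq> mball x (1 / Suc n)" using S(4)[of n] unfolding N_def by blast
      have "S (Suc n) \<subseteq> mball c r"
      proof
        fix u assume "u \<in> S (Suc n)"
        then have u: "u \<in> mball x (1 / Suc n)" "c \<in> mball x (1 / Suc n)" using x cS by blast+
        then have "d x u < r/2" "d x c < r/2" "x \<in> M" "u \<in> M" using n by (auto simp: in_mball)
        then show "u \<in> mball c r" using triangle[of c x u] cM commute[of c x] by (simp add: in_mball)
      qed
      then have "p ` (S (Suc n) - D) \<inter> E = {}" using r(2) A(5) by blast
      moreover have "y \<in> Y closure_of (p ` (S (Suc n) - D))" using S(2) Icl by blast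
      ultimately show False using A(2,4) unfolding in_closure_of by blast
    qed
    then show "y \<in> p ` U \<inter> G" using cS[of 0] S(3) y by blast
  qed
  have "openin (subtopology Y G) (p ` U \<inter> G)" if U: "openin C U" for U
  proof -
    have "p ` U = (\<Union>V\<in>{V \<in> \<B>. V \<subseteq> U}. p ` V)"
    proof (intro equalityI subsetI)
      fix y assume "y \<in> p ` U"
      then obtain c where "c \<in> U" "y = p c" by blast
      moreover from this obtain V where "V \<in> \<B>" "c \<in> V" "V \<subseteq> U" using B(3)[OF U] by blast
      ultimately show "y \<in> (\<Union>V\<in>{V \<in> \<B>. V \<subseteq> U}. p ` V)" by blast
    qed blast
    then have "p ` U \<inter> G = (\<Union>V\<in>{V \<in> \<B>. V \<subseteq> U}. p ` V \<inter> G)" by simp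
    also have "\<dots> = (\<Union>V\<in>{V \<in> \<B>. V \<subseteq> U}. I V \<inter> G)" by (intro SUP_cong refl) (simp add: eq)
    also have "\<dots> = (\<Union>V\<in>{V \<in> \<B>. V \<subseteq> U}. I V) \<inter> G" by simp
    also have "openin (subtopology Y G) \<dots>"
      by (auto simp: openin_subtopology intro!: exI[of _ "\<Union>V\<in>{V \<in> \<B>. V \<subseteq> U}. I V"] openin_Union oI)
    finally show ?thesis .
  qed
  with G(1) show ?thesis by (rule that)
qed

text \<open>Two applications of the Baire category theorem.  In a fibre, which is covered by the countably many closed sets on
  which \<open>k\<close> is constant, \<open>k\<close> is constant on a nonempty relatively open subset.  Hence \<open>p C\<close> is covered by the countably
  many sets \<open>Z V\<close> of those \<open>y\<close> over which \<open>k\<close> is constant on \<open>V\<close>, and some \<open>Z V\<close> is dense in a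
  nonempty open set.  There \<open>k\<close> is a function of \<open>p\<close> on \<open>V\<close>, by continuity and because \<open>p\<close> is open.\<close>

lemma functional_on_open:
  assumes C: "polish_space C" "topspace C \<noteq> {}" and Y: "polish_space Y" and X: "Hausdorff_space X"
    and p: "continuous_map C Y p" and op: "\<And>U. openin C U \<Longrightarrow> openin Y (p ` U)"
    and k: "continuous_map C X k"
    and cnt: "\<And>y. y \<in> topspace Y \<Longrightarrow> countable (k ` {c \<in> topspace C. p c = y})"
  obtains U where "openin C U" "U \<noteq> {}" "\<And>c c'. c \<in> U \<Longrightarrow> c' \<in> U \<Longrightarrow> p c = p c' \<Longrightarrow> k c = k c'"
proof -
  obtain \<B> where B: "countable \<B>" "\<And>V. V \<in> \<B> \<Longrightarrow> openin C V"
    "\<And>U x. openin C U \<Longrightarrow> x \<in> U \<Longrightarrow> \<exists>V\<in>\<B>. x \<in> V \<and> V \<subseteq> U"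
    using polish_space_imp_second_countable[OF C(1)] by (rule second_countableE) blast
  have pY: "p c \<in> topspace Y" if "c \<in> topspace C" for c
    using continuous_map_image_subset_topspace[OF p] that by auto
  have kX: "k c \<in> topspace X" if "c \<in> topspace C" for c
    using continuous_map_image_subset_topspace[OF k] that by auto
  define Z where "Z V = {y \<in> p ` V. \<forall>c\<in>V. \<forall>c'\<in>V. p c = y \<longrightarrow> p c' = y \<longrightarrow> k c = k c'}" for V
  have "p ` topspace C \<subseteq> (\<Union>V\<in>\<B>. Z V)"
  proof
    fix y assume y: "y \<in> p ` topspace C"
    then have yY: "y \<in> topspace Y" using pY by blast
    define F where "F = {c \<in> topspace C. p c = y}"
    have F: "closedin C F"
    proof -
      have "closedin Y {y}" using yY polish_space_imp_Hausdorff[OF Y] by (simp add: closedin_Hausdorff_singleton)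
      then show ?thesis unfolding F_def using closedin_continuous_map_preimage[OF p, of "{y}"] by simp
    qed
    let ?F = "subtopology C F"
    have topF: "topspace ?F = F" using closedin_subset[OF F] by (simp add: topspace_subtopology Int_absorb1)
    have PF: "polish_space ?F" using polish_space_closedin[OF C(1) F] .
    define L where "L x = {c \<in> topspace ?F. k c \<in> {x}}" for x
    have clL: "closedin ?F (L x)" if "x \<in> k ` F" for x
    proof -
      have "x \<in> topspace X" using that kX F_def by blast
      then have "closedin X {x}" using X by (simp add: closedin_Hausdorff_singleton)
      then show ?thesis unfolding L_def
        by (intro closedin_continuous_map_preimage[of _ X] continuous_map_from_subtopology k)
    qed
    have "\<exists>x\<in>k ` F. ?F interior_of L x \<noteq> {}"
    proof (rule ccontr)
      assume "\<not> ?thesis"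
      then have "meager_in ?F (\<Union>x\<in>k ` F. L x)"
        using cnt[OF yY] clL unfolding F_def[symmetric] by (intro meager_in_UN meager_in_closed) blast+
      moreover have "(\<Union>x\<in>k ` F. L x) = topspace ?F" unfolding L_def topF by blast
      ultimately show False using not_meager_open[OF PF openin_topspace] topF y unfolding F_def by auto
    qed
    then obtain x where x: "?F interior_of L x \<noteq> {}" by blast
    have "openin ?F (?F interior_of L x)" by simp
    then obtain W where W: "openin C W" "?F interior_of L x = W \<inter> F" unfolding openin_subtopology by blast
    then obtain c where c: "c \<in> W" "c \<in> F" using x by blast
    then obtain V where V: "V \<in> \<B>" "c \<in> V" "V \<subseteq> W" using B(3)[OF W(1)] by blast
    have kx: "k c' = x" if "c' \<in> V" "p c' = y" for c'
    proof -
      have "c' \<in> F" using that B(2)[OF V(1)] openin_subset unfolding F_def by blast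
      then have "c' \<in> L x" using W(2) interior_of_subset[of ?F "L x"] V(3) that by blast
      then show ?thesis unfolding L_def by blast
    qed
    have "y \<in> Z V" unfolding Z_def using kx c(2) V(2) unfolding F_def by auto
    then show "y \<in> (\<Union>V\<in>\<B>. Z V)" using V(1) by blast
  qed
  moreover have "\<not> meager_in Y (p ` topspace C)"
    using op[OF openin_topspace] C(2) by (intro not_meager_open[OF Y]) auto
  ultimately have "\<not> meager_in Y (\<Union>V\<in>\<B>. Z V)" using meager_in_subset by blast
  then obtain V where V: "V \<in> \<B>" "\<not> meager_in Y (Z V)"
    using meager_in_UN[OF B(1)] by blast
  define A where "A = Y interior_of (Y closure_of (Z V)) \<inter> p ` V"
  have oV: "openin C V" using V B by blast
  have oA: "openin Y A" unfolding A_def using op[OF oV] by auto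
  have ZY: "Z V \<subseteq> topspace Y" unfolding Z_def using pY openin_subset[OF oV] by blast
  have "A \<noteq> {}"
  proof -
    have "\<not> Z V \<subseteq> Y closure_of Z V - Y interior_of (Y closure_of Z V)"
      using V(2) meager_in_subset[OF nowhere_dense_frontier_closure] by blast
    then obtain y where "y \<in> Z V" "y \<in> Y interior_of (Y closure_of Z V)"
      using closure_of_subset[OF ZY] by blast
    then show ?thesis unfolding A_def Z_def by blast
  qed
  define U where "U = V \<inter> {c \<in> topspace C. p c \<in> A}"
  show ?thesis
  proof (rule that[of U])
    show "openin C U" unfolding U_def by (intro openin_Int oV openin_continuous_map_preimage[OF p oA])
    show "U \<noteq> {}" using \<open>A \<noteq> {}\<close> openin_subset[OF oV] unfolding U_def A_def by blast
    fix c c' assume c: "c \<in> U" "c' \<in> U" "p c = p c'"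
    show "k c = k c'"
    proof (rule ccontr)
      assume ne: "k c \<noteq> k c'"
      have "k c \<in> topspace X" "k c' \<in> topspace X" using c kX unfolding U_def by auto
      then obtain S S' where S: "openin X S" "openin X S'" "k c \<in> S" "k c' \<in> S'" "S \<inter> S' = {}"
        using X ne unfolding Hausdorff_space_def disjnt_def by metis
      let ?T = "U \<inter> {c \<in> topspace C. k c \<in> S}" and ?T' = "U \<inter> {c \<in> topspace C. k c \<in> S'}"
      have oT: "openin C ?T" by (intro openin_Int \<open>openin C U\<close> openin_continuous_map_preimage[OF k] S)
      have oT': "openin C ?T'" by (intro openin_Int \<open>openin C U\<close> openin_continuous_map_preimage[OF k] S)
      have "openin Y (p ` ?T \<inter> p ` ?T')" by (intro openin_Int op oT oT')
      moreover have "p c \<in> p ` ?T \<inter> p ` ?T'"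
      proof
        have cT: "c \<in> ?T" "c' \<in> ?T'" using c S unfolding U_def by auto
        show "p c \<in> p ` ?T" using cT(1) by (rule imageI)
        show "p c \<in> p ` ?T'" unfolding c(3) using cT(2) by (rule imageI)
      qed
      moreover have "p c \<in> Y closure_of Z V"
        using c interior_of_subset[of Y "Y closure_of Z V"] unfolding U_def A_def by auto
      ultimately have "\<exists>y. y \<in> Z V \<and> y \<in> p ` ?T \<inter> p ` ?T'"
        by (simp only: in_closure_of)
      then obtain y where y: "y \<in> Z V" "y \<in> p ` ?T" "y \<in> p ` ?T'" by (elim exE conjE IntE)
      obtain a where a: "a \<in> ?T" "p a = y" using y(2) by (elim imageE) simp
      obtain a' where a': "a' \<in> ?T'" "p a' = y" using y(3) by (elim imageE) simp
      have "a \<in> V" "a' \<in> V" using a(1) a'(1) unfolding U_def by simp_all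
      then have "k a = k a'" using y(1) a(2) a'(2) unfolding Z_def by blast
      then show False using a(1) a'(1) S(5) by auto
    qed
  qed
qed


text \<open>A generic form of the Lusin-Novikov theorem.  Call a set \<open>A \<subseteq> C\<close> small if the conclusion holds for its points.  Countable
  unions of small sets are small, so there is a largest small open set \<open>D\<close>.  If \<open>D\<close> were not all of \<open>C\<close>, then
  over generic points \<open>p\<close> would be open on the closed complement of \<open>D\<close>, and \<open>functional_on_open\<close> would give a
  nonempty relatively open piece \<open>U\<close> of this complement on which \<open>k\<close> is a function \<open>h\<close> of \<open>p\<close>.  This would make \<open>U \<union> D\<close>
  small, in contradiction with the choice of \<open>D\<close>.  The map \<open>k0\<close> provides the values outside the domain of \<open>h\<close>.\<close>

lemma generic_countable_uniformization:
  assumes C: "polish_space C" and Y: "polish_space Y" and X: "Hausdorff_space X"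
    and p: "continuous_map C Y p" and k: "continuous_map C X k" and k0: "continuous_map Y X k0"
    and cnt: "\<And>y. y \<in> topspace Y \<Longrightarrow> countable (k ` {c \<in> topspace C. p c = y})"
  obtains G H where "dense_gdelta Y G" "countable H"
    "\<And>h. h \<in> H \<Longrightarrow> continuous_map (subtopology Y G) X h"
    "\<And>c. c \<in> topspace C \<Longrightarrow> p c \<in> G \<Longrightarrow> \<exists>h\<in>H. k c = h (p c)"
proof -
  define small where "small A \<longleftrightarrow> (\<exists>G H. dense_gdelta Y G \<and> countable H \<and>
      (\<forall>h\<in>H. continuous_map (subtopology Y G) X h) \<and> (\<forall>c\<in>A. p c \<in> G \<longrightarrow> (\<exists>h\<in>H. k c = h (p c))))" for A
  have small_UN: "small A" if I: "countable I" "\<And>i. i \<in> I \<Longrightarrow> small (B i)"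
     and G0: "dense_gdelta Y G0" and A: "\<And>c. c \<in> A \<Longrightarrow> p c \<in> G0 \<Longrightarrow> c \<in> (\<Union>i\<in>I. B i)" for A I G0 and B :: "'d \<Rightarrow> 'a set"
  proof -
    obtain G H where GH: "\<And>i. i \<in> I \<Longrightarrow> dense_gdelta Y (G i)" "\<And>i. i \<in> I \<Longrightarrow> countable (H i)"
      "\<And>i h. i \<in> I \<Longrightarrow> h \<in> H i \<Longrightarrow> continuous_map (subtopology Y (G i)) X h"
      "\<And>i c. i \<in> I \<Longrightarrow> c \<in> B i \<Longrightarrow> p c \<in> G i \<Longrightarrow> (\<exists>h\<in>H i. k c = h (p c))"
      using I(2) unfolding small_def by metis
    obtain K1 where K1: "dense_gdelta Y K1" "\<And>i. i \<in> I \<Longrightarrow> K1 \<subseteq> G i"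
      using dense_gdelta_INT[OF Y I(1), of G, OF GH(1)] by blast
    define K where "K = K1 \<inter> G0"
    have K: "dense_gdelta Y K" "K \<subseteq> K1" "K \<subseteq> G0"
      unfolding K_def by (rule dense_gdelta_Int[OF Y K1(1) G0]) auto
    have K0: "K \<subseteq> G0" and Ki: "\<And>i. i \<in> I \<Longrightarrow> K \<subseteq> G i" using K K1(2) by blast+
    have "\<exists>h\<in>(\<Union>i\<in>I. H i). k c = h (p c)" if cA: "c \<in> A" and pcK: "p c \<in> K" for c
    proof -
      have "p c \<in> G0" using pcK K0 by blast
      then obtain i where "i \<in> I" "c \<in> B i" using A[OF cA] by blast
      moreover from this have "\<exists>h\<in>H i. k c = h (p c)" using GH(4) Ki pcK by blast
      ultimately show ?thesis by blast
    qed
    moreover have "continuous_map (subtopology Y K) X h" if "h \<in> (\<Union>i\<in>I. H i)" for h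
      using that GH(3) Ki continuous_map_from_subtopology_mono by blast
    moreover have "countable (\<Union>i\<in>I. H i)" using I(1) GH(2) by blast
    ultimately show ?thesis unfolding small_def using K(1) by (intro exI[of _ K] exI[of _ "\<Union>i\<in>I. H i"]) blast
  qed
  have dY: "dense_gdelta Y (topspace Y)" using openin_subset by (fastforce simp: dense_gdelta_def)
  obtain \<B> where B: "countable \<B>" "\<And>V. V \<in> \<B> \<Longrightarrow> openin C V"
    "\<And>U x. openin C U \<Longrightarrow> x \<in> U \<Longrightarrow> \<exists>V\<in>\<B>. x \<in> V \<and> V \<subseteq> U"
    using polish_space_imp_second_countable[OF C(1)] by (rule second_countableE) blast
  have pY: "p c \<in> topspace Y" if "c \<in> topspace C" for c
    using continuous_map_image_subset_topspace[OF p] that by auto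
  define D where "D = \<Union>{V \<in> \<B>. small V}"
  have sD: "small D"
    by (rule small_UN[of "{V \<in> \<B>. small V}" "\<lambda>V. V", OF _ _ dY]) (use B(1) in \<open>auto simp: D_def\<close>)
  have "topspace C \<subseteq> D"
  proof (rule ccontr)
    assume nD: "\<not> topspace C \<subseteq> D"
    define C1 where "C1 = subtopology C (topspace C - D)"
    have "openin C D" unfolding D_def using B(2) by blast
    then have cl: "closedin C (topspace C - D)" by blast
    have C1: "polish_space C1" unfolding C1_def by (rule polish_space_closedin[OF C cl])
    have top1: "topspace C1 = topspace C - D" unfolding C1_def by (auto simp: topspace_subtopology)
    have p1: "continuous_map C1 Y p" unfolding C1_def by (rule continuous_map_from_subtopology[OF p])
    obtain G1 where G1: "dense_gdelta Y G1" "\<And>U. openin C1 U \<Longrightarrow> openin (subtopology Y G1) (p ` U \<inter> G1)"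
      using generically_open_map[OF C1 Y p1] by blast
    define E where "E = {c \<in> topspace C1. p c \<in> G1}"
    define C2 where "C2 = subtopology C1 E"
    have "gdelta_in C1 E" unfolding E_def
      using G1(1) by (intro gdelta_in_preimage[OF p1]) (simp add: dense_gdelta_def)
    then have C2: "polish_space C2" unfolding C2_def by (rule polish_space_gdelta[OF C1])
    have top2: "topspace C2 = E" unfolding C2_def E_def by (auto simp: topspace_subtopology)
    let ?Y2 = "subtopology Y G1"
    have Y2: "polish_space ?Y2" by (rule polish_space_dense_gdelta[OF Y G1(1)])
    have p2: "continuous_map C2 ?Y2 p"
      unfolding C2_def using p1 by (auto simp: continuous_map_in_subtopology continuous_map_from_subtopology E_def topspace_subtopology)
    have k2: "continuous_map C2 X k" unfolding C2_def C1_def by (intro continuous_map_from_subtopology k)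
    show False
    proof (cases "topspace C2 = {}")
      case True
      have "small V" if "V \<in> \<B>" for V
      proof (rule small_UN[of "{()}" "\<lambda>_. D", OF _ _ G1(1)])
        fix c assume "c \<in> V" "p c \<in> G1"
        then show "c \<in> (\<Union>i\<in>{()}. D)" using True top2 top1 openin_subset[OF B(2)[OF that]] unfolding E_def by blast
      qed (use sD in auto)
      then have "D = \<Union>\<B>" unfolding D_def by blast
      moreover have "topspace C \<subseteq> \<Union>\<B>" using B(3)[OF openin_topspace] by blast
      ultimately show False using nD by simp
    next
      case False
      have op2: "openin ?Y2 (p ` U)" if U: "openin C2 U" for U
      proof -
        obtain U' where U': "openin C1 U'" "U = U' \<inter> E" using U unfolding C2_def openin_subtopology by blast
        have "p ` U = p ` U' \<inter> G1" using U'(2) openin_subset[OF U'(1)] unfolding E_def by blast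
        then show ?thesis using G1(2)[OF U'(1)] by simp
      qed
      have cnt2: "countable (k ` {c \<in> topspace C2. p c = y})" if "y \<in> topspace ?Y2" for y
      proof (rule countable_subset[OF _ cnt])
        show "k ` {c \<in> topspace C2. p c = y} \<subseteq> k ` {c \<in> topspace C. p c = y}"
          using top2 top1 unfolding E_def by blast
      qed (use that in \<open>simp add: topspace_subtopology\<close>)
      obtain U where U: "openin C2 U" "U \<noteq> {}" "\<And>c c'. c \<in> U \<Longrightarrow> c' \<in> U \<Longrightarrow> p c = p c' \<Longrightarrow> k c = k c'"
        using functional_on_open[OF C2 False Y2 X p2 op2 k2 cnt2] by metis
      obtain O1 where O1: "openin C O1" "U = O1 \<inter> E"
      proof -
        obtain U' where U': "openin C1 U'" "U = U' \<inter> E" using U(1) unfolding C2_def openin_subtopology by blast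
        obtain U'' where U'': "openin C U''" "U' = U'' \<inter> (topspace C - D)"
          using U'(1) unfolding C1_def openin_subtopology by blast
        have "U = U'' \<inter> E" using U' U'' top1 unfolding E_def by blast
        then show ?thesis using that U''(1) by blast
      qed
      obtain Q where Q: "openin Y Q" "p ` U = Q \<inter> G1" using op2[OF U(1)] unfolding openin_subtopology by blast
      define ext where "ext = topspace Y - Y closure_of Q"
      have oext: "openin Y ext" unfolding ext_def by (intro openin_diff) auto
      have disj: "ext \<inter> Q = {}" unfolding ext_def using closure_of_subset[OF openin_subset[OF Q(1)]] by blast
      \<comment> \<open>without the boundary of \<open>Q\<close>, the domain of \<open>h\<close> becomes clopen\<close>
      define G3 where "G3 = G1 \<inter> (Q \<union> ext)"
      have G3: "dense_gdelta Y G3"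
        unfolding dense_gdelta_def
      proof (intro conjI allI impI)
        show "gdelta_in Y G3" unfolding G3_def
        proof (rule gdelta_in_Int)
          show "gdelta_in Y G1" using G1(1) by (simp add: dense_gdelta_def)
          show "gdelta_in Y (Q \<union> ext)" by (intro open_imp_gdelta_in openin_Un Q(1) oext)
        qed
        fix W assume W: "openin Y W" "W \<noteq> {}"
        have "W \<inter> (Q \<union> ext) \<noteq> {}"
        proof
          assume e: "W \<inter> (Q \<union> ext) = {}"
          then have "W \<inter> Y closure_of Q = {}" using openin_Int_closure_of_eq_empty[OF W(1)] by blast
          then show False using e W openin_subset[OF W(1)] unfolding ext_def by blast
        qed
        moreover have "openin Y (W \<inter> (Q \<union> ext))" using W Q oext by blast
        ultimately obtain y where "y \<in> W \<inter> (Q \<union> ext) \<inter> G1" using dense_gdeltaD[OF G1(1)] by meson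
        then show "W \<inter> G3 \<noteq> {}" unfolding G3_def by blast
      qed
      define h where "h y = (if y \<in> Q then k (SOME c. c \<in> U \<and> p c = y) else k0 y)" for y
      have hk: "h (p c) = k c" if "c \<in> U" for c
      proof -
        define c' where "c' = (SOME c'. c' \<in> U \<and> p c' = p c)"
        have "c' \<in> U \<and> p c' = p c" unfolding c'_def by (rule someI[of _ c]) (simp add: that)
        then have "k c' = k c" using U(3)[OF _ that] by blast
        moreover have "p c \<in> Q" using that Q by blast
        ultimately show ?thesis by (simp add: h_def c'_def)
      qed
      have kX: "k c \<in> topspace X" if "c \<in> U" for c
        using continuous_map_image_subset_topspace[OF k2] that openin_subset[OF U(1)] by auto
      have k0X: "k0 y \<in> topspace X" if "y \<in> topspace Y" for y
        using continuous_map_image_subset_topspace[OF k0] that by auto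
      have G3Y: "G3 \<subseteq> topspace Y" by (rule dense_gdelta_subset[OF G3])
      have h: "continuous_map (subtopology Y G3) X h"
        unfolding continuous_map_def
      proof (intro conjI allI impI)
        show "h \<in> topspace (subtopology Y G3) \<rightarrow> topspace X"
        proof
          fix y assume "y \<in> topspace (subtopology Y G3)"
          then have y: "y \<in> G3" "y \<in> topspace Y" by (auto simp: topspace_subtopology)
          show "h y \<in> topspace X"
          proof (cases "y \<in> Q")
            case True
            then have "y \<in> p ` U" using y(1) unfolding Q(2) G3_def by simp
            then show ?thesis using hk kX by auto
          next
            case False
            then show ?thesis using k0X[OF y(2)] by (simp add: h_def)
          qed
        qed
        fix S assume S: "openin X S"
        have "openin C2 (U \<inter> {c \<in> topspace C2. k c \<in> S})"
          by (intro openin_Int U(1) openin_continuous_map_preimage[OF k2 S])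
        then obtain Q' where Q': "openin Y Q'" "p ` (U \<inter> {c \<in> topspace C2. k c \<in> S}) = Q' \<inter> G1"
          using op2 unfolding openin_subtopology by blast
        have eq: "{y \<in> topspace (subtopology Y G3). h y \<in> S} =
            ((Q \<inter> Q') \<union> (ext \<inter> {y \<in> topspace Y. k0 y \<in> S})) \<inter> G3" (is "?L = ?R")
        proof (intro equalityI subsetI)
          fix y assume "y \<in> ?L"
          then have y: "y \<in> G3" "y \<in> topspace Y" "h y \<in> S" by (auto simp: topspace_subtopology)
          show "y \<in> ?R"
          proof (cases "y \<in> Q")
            case True
            then have "y \<in> p ` U" using y(1) unfolding Q(2) G3_def by simp
            then obtain c where c: "c \<in> U" "p c = y" by (elim imageE) simp
            then have "c \<in> U \<inter> {c \<in> topspace C2. k c \<in> S}"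
              using hk[OF c(1)] y(3) openin_subset[OF U(1)] by auto
            then have "y \<in> Q' \<inter> G1" unfolding Q'(2)[symmetric] using c(2) by (intro image_eqI[of _ p c]) simp_all
            then show ?thesis using True y(1) by simp
          next
            case False
            then show ?thesis using y unfolding G3_def h_def by auto
          qed
        next
          fix y assume R: "y \<in> ?R"
          then have y: "y \<in> G3" "y \<in> topspace Y" using G3Y by auto
          show "y \<in> ?L"
          proof (cases "y \<in> Q")
            case True
            then have "y \<in> Q' \<inter> G1" using R disj unfolding G3_def by blast
            then have "y \<in> p ` (U \<inter> {c \<in> topspace C2. k c \<in> S})" unfolding Q'(2) .
            then obtain c where "c \<in> U" "p c = y" "k c \<in> S" by (elim imageE IntE CollectE conjE) simp
            then show ?thesis using hk y by (auto simp: topspace_subtopology)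
          next
            case False
            then show ?thesis using R y unfolding h_def by (auto simp: topspace_subtopology)
          qed
        qed
        show "openin (subtopology Y G3) {y \<in> topspace (subtopology Y G3). h y \<in> S}"
          unfolding eq openin_subtopology
          by (rule exI, rule conjI[OF _ refl])
            (intro openin_Un openin_Int Q(1) Q'(1) oext openin_continuous_map_preimage[OF k0 S])
      qed
      have sU: "small U" unfolding small_def
        by (intro exI[of _ G3] exI[of _ "{h}"]) (use G3 h hk in auto)
      obtain c where c: "c \<in> U" using U(2) by blast
      then obtain V where V: "V \<in> \<B>" "c \<in> V" "V \<subseteq> O1" using B(3)[OF O1(1)] O1(2) by blast
      have "small V"
      proof (rule small_UN[of "{True, False}" "\<lambda>b. if b then D else U", OF _ _ G1(1)])
        fix c assume "c \<in> V" "p c \<in> G1"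
        then show "c \<in> (\<Union>i\<in>{True, False}. if i then D else U)"
          using V O1(2) openin_subset[OF O1(1)] top1 unfolding E_def by auto
      qed (use sD sU in auto)
      then have "c \<in> D" unfolding D_def using V by blast
      then show False using c openin_subset[OF U(1)] top2 top1 unfolding E_def by blast
    qed
  qed
  then have "small (topspace C)" using sD unfolding small_def by blast
  then show ?thesis unfolding small_def using that by blast
qed

section \<open>Presentations of a relation which is not F-sigma\<close>

definition coord :: "bool \<Rightarrow> 'a \<times> 'a \<Rightarrow> 'a" where
  "coord e b = (if e then snd b else fst b)"

lemma continuous_map_coord: "continuous_map (prod_topology X X) X (coord e)"
  by (cases e) (simp_all add: coord_def[abs_def] continuous_map_fst continuous_map_snd)

lemma coord_in: "b \<in> topspace X \<times> topspace X \<Longrightarrow> coord e b \<in> topspace X"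
  by (auto simp: coord_def)

text \<open>\<open>B\<close> is dense along \<open>f\<close>, in the sense that every nonempty open subset of \<open>Y\<close> has images arbitrarily close to
  some point of \<open>B\<close>.  The points of \<open>B\<close> are limits of values of \<open>f\<close>, and in the applications they are not values
  of \<open>f\<close>.  The negligible sets are the corresponding analogue of the nowhere dense sets.\<close>

definition accumulates :: "'y topology \<Rightarrow> 'z topology \<Rightarrow> ('y \<Rightarrow> 'z) \<Rightarrow> 'z set \<Rightarrow> bool" where
  "accumulates Y Z f B \<longleftrightarrow>
     (\<forall>U. openin Y U \<longrightarrow> U \<noteq> {} \<longrightarrow> (\<exists>b\<in>B. b \<in> Z closure_of (f ` U)))"

definition negligible_along :: "'y topology \<Rightarrow> 'z topology \<Rightarrow> ('y \<Rightarrow> 'z) \<Rightarrow> 'z set \<Rightarrow> bool" where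
  "negligible_along Y Z f N \<longleftrightarrow>
     (\<forall>U. openin Y U \<longrightarrow> U \<noteq> {} \<longrightarrow>
        (\<exists>V. openin Y V \<and> V \<noteq> {} \<and> V \<subseteq> U \<and> (Z closure_of (f ` V)) \<inter> N = {}))"

lemma closure_of_meets: "b \<in> Z closure_of S \<Longrightarrow> openin Z T \<Longrightarrow> b \<in> T \<Longrightarrow> \<exists>c\<in>S. c \<in> T"
  by (auto simp: in_closure_of)

lemma accumulatesD:
  "accumulates Y Z f B \<Longrightarrow> openin Y U \<Longrightarrow> U \<noteq> {} \<Longrightarrow> \<exists>b\<in>B. b \<in> Z closure_of (f ` U)"
  by (simp add: accumulates_def)

lemma negligible_alongE:
  assumes "negligible_along Y Z f N" "openin Y U" "U \<noteq> {}"
  obtains V where "openin Y V" "V \<noteq> {}" "V \<subseteq> U" "(Z closure_of (f ` V)) \<inter> N = {}"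
  using assms unfolding negligible_along_def by meson

lemma negligible_along_subset:
  assumes N: "negligible_along Y Z f N" and sub: "N' \<subseteq> N"
  shows "negligible_along Y Z f N'"
  unfolding negligible_along_def
proof (intro allI impI)
  fix U assume "openin Y U" "U \<noteq> {}"
  then obtain V where "openin Y V" "V \<noteq> {}" "V \<subseteq> U" "(Z closure_of (f ` V)) \<inter> N = {}"
    using negligible_alongE[OF N] by metis
  moreover from this(4) sub have "(Z closure_of (f ` V)) \<inter> N' = {}" by blast
  ultimately show "\<exists>V. openin Y V \<and> V \<noteq> {} \<and> V \<subseteq> U \<and> (Z closure_of (f ` V)) \<inter> N' = {}"
    by (intro exI[of _ V] conjI)
qed

lemma negligible_along_Un:
  assumes N: "negligible_along Y Z f N" and N': "negligible_along Y Z f N'"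
  shows "negligible_along Y Z f (N \<union> N')"
  unfolding negligible_along_def
proof (intro allI impI)
  fix U assume U: "openin Y U" "U \<noteq> {}"
  obtain V where V: "openin Y V" "V \<noteq> {}" "V \<subseteq> U" "(Z closure_of (f ` V)) \<inter> N = {}"
    by (rule negligible_alongE[OF N U])
  obtain W where W: "openin Y W" "W \<noteq> {}" "W \<subseteq> V" "(Z closure_of (f ` W)) \<inter> N' = {}"
    by (rule negligible_alongE[OF N' V(1,2)])
  have "Z closure_of (f ` W) \<subseteq> Z closure_of (f ` V)" by (intro closure_of_mono image_mono W)
  then have "(Z closure_of (f ` W)) \<inter> (N \<union> N') = {}" using V(4) W(4) by blast
  then show "\<exists>V. openin Y V \<and> V \<noteq> {} \<and> V \<subseteq> U \<and> (Z closure_of (f ` V)) \<inter> (N \<union> N') = {}"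
    using V W by (intro exI[of _ W] conjI) auto
qed

lemma negligible_along_empty: "negligible_along Y Z f {}"
  unfolding negligible_along_def by blast

lemma negligible_along_UN:
  assumes "finite I" "\<And>i. i \<in> I \<Longrightarrow> negligible_along Y Z f (N i)"
  shows "negligible_along Y Z f (\<Union>i\<in>I. N i)"
  using assms by (induction I rule: finite_induct) (auto simp: negligible_along_empty intro!: negligible_along_Un)

lemma accumulates_Diff:
  assumes B: "accumulates Y Z f B" and N: "negligible_along Y Z f N"
  shows "accumulates Y Z f (B - N)"
  unfolding accumulates_def
proof (intro allI impI)
  fix U assume U: "openin Y U" "U \<noteq> {}"
  obtain V where V: "openin Y V" "V \<noteq> {}" "V \<subseteq> U" "(Z closure_of (f ` V)) \<inter> N = {}"
    by (rule negligible_alongE[OF N U])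
  obtain b where "b \<in> B" "b \<in> Z closure_of (f ` V)" using accumulatesD[OF B V(1,2)] by blast
  moreover have "Z closure_of (f ` V) \<subseteq> Z closure_of (f ` U)" by (intro closure_of_mono image_mono V)
  ultimately show "\<exists>b\<in>B - N. b \<in> Z closure_of (f ` U)" using V(4) by (intro bexI[of _ b]) auto
qed

lemma openin_sub_open: "openin Y U \<Longrightarrow> openin (subtopology Y U) V \<Longrightarrow> openin Y V \<and> V \<subseteq> U"
  by (simp add: openin_open_subtopology)

lemma accumulates_open:
  "openin Y U \<Longrightarrow> accumulates Y Z f B \<Longrightarrow> accumulates (subtopology Y U) Z f B"
  unfolding accumulates_def using openin_sub_open by meson

lemma negligible_along_open:
  assumes U: "openin Y U" and N: "negligible_along Y Z f N"
  shows "negligible_along (subtopology Y U) Z f N"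
  unfolding negligible_along_def
proof (intro allI impI)
  fix W assume W: "openin (subtopology Y U) W" "W \<noteq> {}"
  then have W': "openin Y W" "W \<subseteq> U" using openin_sub_open[OF U] by auto
  obtain V where V: "openin Y V" "V \<noteq> {}" "V \<subseteq> W" "(Z closure_of (f ` V)) \<inter> N = {}"
    by (rule negligible_alongE[OF N W'(1) W(2)])
  then have "openin (subtopology Y U) V" using W'(2) by (simp add: openin_open_subtopology[OF U] subset_trans)
  then show "\<exists>V. openin (subtopology Y U) V \<and> V \<noteq> {} \<and> V \<subseteq> W \<and> (Z closure_of (f ` V)) \<inter> N = {}"
    using V by (intro exI[of _ V] conjI)
qed

lemma closure_image_dense_gdelta:
  assumes G: "dense_gdelta Y G" and W: "openin Y W" and f: "continuous_map Y Z f"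
  shows "Z closure_of (f ` W) \<subseteq> Z closure_of (f ` (W \<inter> G))"
proof -
  have "W \<subseteq> Y closure_of (W \<inter> G)"
  proof
    fix y assume y: "y \<in> W"
    have "\<exists>z. z \<in> W \<inter> G \<and> z \<in> T" if T: "y \<in> T" "openin Y T" for T
    proof -
      have "openin Y (W \<inter> T)" "W \<inter> T \<noteq> {}" using T y W by auto
      from dense_gdeltaD[OF G this] show ?thesis by blast
    qed
    then show "y \<in> Y closure_of (W \<inter> G)" using y openin_subset[OF W] unfolding in_closure_of by blast
  qed
  then have "f ` W \<subseteq> f ` (Y closure_of (W \<inter> G))" by (rule image_mono)
  also have "\<dots> \<subseteq> Z closure_of (f ` (W \<inter> G))" by (rule continuous_map_image_closure_subset[OF f])
  finally show ?thesis by (intro closure_of_minimal) auto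
qed

lemma accumulates_dense_gdelta:
  assumes G: "dense_gdelta Y G" and f: "continuous_map Y Z f" and B: "accumulates Y Z f B"
  shows "accumulates (subtopology Y G) Z f B"
  unfolding accumulates_def
proof (intro allI impI)
  fix U assume U: "openin (subtopology Y G) U" "U \<noteq> {}"
  then obtain W where W: "openin Y W" "U = W \<inter> G" unfolding openin_subtopology by blast
  then have "W \<noteq> {}" using U(2) by auto
  from accumulatesD[OF B W(1) this] show "\<exists>b\<in>B. b \<in> Z closure_of (f ` U)"
    using closure_image_dense_gdelta[OF G W(1) f] W(2) by blast
qed

lemma accumulates_split:
  assumes B: "accumulates Y Z f B"
  obtains U where "openin Y U" "U \<noteq> {}" "accumulates (subtopology Y U) Z f (B \<inter> P)"
  | "accumulates Y Z f (B - P)"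
proof (cases "accumulates Y Z f (B - P)")
  case False
  then obtain U where U: "openin Y U" "U \<noteq> {}" "\<forall>b\<in>B - P. b \<notin> Z closure_of (f ` U)"
    unfolding accumulates_def by blast
  have "accumulates (subtopology Y U) Z f (B \<inter> P)" unfolding accumulates_def
  proof (intro allI impI)
    fix V assume V: "openin (subtopology Y U) V" "V \<noteq> {}"
    then have V': "openin Y V" "V \<subseteq> U" using openin_sub_open[OF U(1)] by auto
    obtain b where b: "b \<in> B" "b \<in> Z closure_of (f ` V)" using accumulatesD[OF B V'(1) V(2)] by blast
    have "Z closure_of (f ` V) \<subseteq> Z closure_of (f ` U)" by (intro closure_of_mono image_mono V')
    then have "b \<in> P" using b U(3) by blast
    then show "\<exists>b\<in>B \<inter> P. b \<in> Z closure_of (f ` V)" using b by blast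
  qed
  with U that(1) show ?thesis by blast
qed (rule that(2))

lemma not_negligible_along:
  assumes "\<not> negligible_along Y Z f N"
  obtains U where "openin Y U" "U \<noteq> {}" "accumulates (subtopology Y U) Z f N"
proof -
  obtain U where U: "openin Y U" "U \<noteq> {}"
    "\<And>V. openin Y V \<Longrightarrow> V \<noteq> {} \<Longrightarrow> V \<subseteq> U \<Longrightarrow> (Z closure_of (f ` V)) \<inter> N \<noteq> {}"
    using assms unfolding negligible_along_def by blast
  have "accumulates (subtopology Y U) Z f N" unfolding accumulates_def
  proof (intro allI impI)
    fix V assume V: "openin (subtopology Y U) V" "V \<noteq> {}"
    then have "openin Y V" "V \<subseteq> U" using openin_sub_open[OF U(1)] by auto
    from U(3)[OF this(1) V(2) this(2)] show "\<exists>b\<in>N. b \<in> Z closure_of (f ` V)" by blast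
  qed
  with U that show ?thesis by blast
qed

text \<open>A point is chosen for each set of a countable base, outside the negligible sets which are excluded
  by the finitely many points chosen before.\<close>

lemma accumulates_countable_independent:
  assumes Y: "second_countable Y" and B: "accumulates Y Z f B" and E: "sym E"
    and N: "\<And>q. q \<in> B \<Longrightarrow> negligible_along Y Z f {b \<in> B. (q, b) \<in> E}"
  obtains Q where "Q \<subseteq> B" "countable Q" "accumulates Y Z f Q"
    "\<forall>q\<in>Q. \<forall>q'\<in>Q. q \<noteq> q' \<longrightarrow> (q, q') \<notin> E"
proof -
  obtain \<B>0 where B0: "countable \<B>0" "\<And>V. V \<in> \<B>0 \<Longrightarrow> openin Y V"
    "\<And>U x. openin Y U \<Longrightarrow> x \<in> U \<Longrightarrow> \<exists>V\<in>\<B>0. x \<in> V \<and> V \<subseteq> U"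
    using Y by (rule second_countableE) blast
  define \<B> where "\<B> = \<B>0 - {{}}"
  show ?thesis
  proof (cases "\<B> = {}")
    case True
    have "U = {}" if "openin Y U" for U using B0(3)[OF that] True unfolding \<B>_def by blast
    then have "accumulates Y Z f {}" unfolding accumulates_def by blast
    then show ?thesis using that[of "{}"] by simp
  next
    case False
    define S where "S = from_nat_into \<B>"
    have S: "range S = \<B>" unfolding S_def using False B0(1) by (intro range_from_nat_into) (auto simp: \<B>_def)
    have "\<exists>q. \<forall>n. q n \<in> B \<and> q n \<in> Z closure_of (f ` S n) \<and> (\<forall>i<n. (q i, q n) \<notin> E)"
    proof (rule dependent_wellorder_choice)
      fix r and g h :: "nat \<Rightarrow> 'b" and n :: nat
      assume "\<And>y. y < n \<Longrightarrow> g y = h y"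
      then show "(r \<in> B \<and> r \<in> Z closure_of (f ` S n) \<and> (\<forall>i<n. (g i, r) \<notin> E)) \<longleftrightarrow>
          (r \<in> B \<and> r \<in> Z closure_of (f ` S n) \<and> (\<forall>i<n. (h i, r) \<notin> E))" by auto
    next
      fix n :: nat and g :: "nat \<Rightarrow> 'b"
      assume IH: "\<And>y. y < n \<Longrightarrow> g y \<in> B \<and> g y \<in> Z closure_of (f ` S y) \<and> (\<forall>i<y. (g i, g y) \<notin> E)"
      have "negligible_along Y Z f (\<Union>i\<in>{..<n}. {b \<in> B. (g i, b) \<in> E})"
        using IH by (intro negligible_along_UN N) auto
      from accumulates_Diff[OF B this] have acc: "accumulates Y Z f (B - (\<Union>i\<in>{..<n}. {b \<in> B. (g i, b) \<in> E}))" .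
      have "S n \<in> \<B>" unfolding S[symmetric] by simp
      then have "openin Y (S n)" "S n \<noteq> {}" using B0(2) by (simp_all add: \<B>_def)
      from accumulatesD[OF acc this] show "\<exists>r. r \<in> B \<and> r \<in> Z closure_of (f ` S n) \<and> (\<forall>i<n. (g i, r) \<notin> E)"
        by auto
    qed
    then obtain q where q: "\<And>n. q n \<in> B" "\<And>n. q n \<in> Z closure_of (f ` S n)" "\<And>i n. i < n \<Longrightarrow> (q i, q n) \<notin> E"
      by blast
    show ?thesis
    proof (rule that[of "range q"])
      show "accumulates Y Z f (range q)" unfolding accumulates_def
      proof (intro allI impI)
        fix U assume U: "openin Y U" "U \<noteq> {}"
        then obtain V where V: "V \<in> \<B>" "V \<subseteq> U" using B0(3)[OF U(1)] unfolding \<B>_def by blast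
        then obtain n where n: "S n = V" using S by blast
        have "Z closure_of (f ` V) \<subseteq> Z closure_of (f ` U)" by (intro closure_of_mono image_mono V)
        then show "\<exists>b\<in>range q. b \<in> Z closure_of (f ` U)" using q(2)[of n] n by blast
      qed
      show "\<forall>a\<in>range q. \<forall>b\<in>range q. a \<noteq> b \<longrightarrow> (a, b) \<notin> E"
      proof (intro ballI impI)
        fix a b assume "a \<in> range q" "b \<in> range q" "a \<noteq> b"
        then obtain i j where ij: "a = q i" "b = q j" by blast
        then have "i \<noteq> j" using \<open>a \<noteq> b\<close> by auto
        then show "(a, b) \<notin> E" using q(3)[of i j] q(3)[of j i] E ij by (auto simp: sym_def linorder_neq_iff)
      qed
    qed (use q in auto)
  qed
qed

text \<open>The last two conditions are what is used of the fact that no nonempty open subset of \<open>Y\<close> is mapped by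
  \<open>f\<close> into an F-sigma subset of \<open>R\<close>.  The last but one also reflects the local countability of \<open>R\<close>.
  In contrast to that fact, both conditions are evidently inherited by dense G-delta subspaces.\<close>

definition presents :: "'y topology \<Rightarrow> 'a topology \<Rightarrow> ('a \<times> 'a) set \<Rightarrow> ('y \<Rightarrow> 'a \<times> 'a) \<Rightarrow> bool" where
  "presents Y X R f \<longleftrightarrow> polish_space Y \<and> topspace Y \<noteq> {} \<and> continuous_map Y (prod_topology X X) f \<and>
     f ` topspace Y \<subseteq> R \<and>
     (\<forall>e x U. openin Y U \<longrightarrow> U \<noteq> {} \<longrightarrow> (\<exists>y\<in>U. coord e (f y) \<noteq> x)) \<and>
     accumulates Y (prod_topology X X) f (topspace X \<times> topspace X - R)"

lemma presentsD:
  assumes "presents Y X R f"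
  shows "polish_space Y" "topspace Y \<noteq> {}" "continuous_map Y (prod_topology X X) f"
    "\<And>y. y \<in> topspace Y \<Longrightarrow> f y \<in> R"
    "\<And>e x U. openin Y U \<Longrightarrow> U \<noteq> {} \<Longrightarrow> \<exists>y\<in>U. coord e (f y) \<noteq> x"
    "accumulates Y (prod_topology X X) f (topspace X \<times> topspace X - R)"
    "\<And>e. continuous_map Y X (\<lambda>y. coord e (f y))"
  using assms continuous_map_compose[OF _ continuous_map_coord, of Y X f] unfolding presents_def o_def by blast+

lemma presents_open:
  assumes P: "presents Y X R f" and U: "openin Y U" "U \<noteq> {}"
  shows "presents (subtopology Y U) X R f"
proof -
  have top: "topspace (subtopology Y U) = U" using openin_subset[OF U(1)] by (simp add: topspace_subtopology Int_absorb1)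
  show ?thesis unfolding presents_def
  proof (intro conjI allI impI)
    show "polish_space (subtopology Y U)" by (intro polish_space_gdelta presentsD(1)[OF P] open_imp_gdelta_in U)
    show "topspace (subtopology Y U) \<noteq> {}" using U(2) top by simp
    show "continuous_map (subtopology Y U) (prod_topology X X) f"
      by (intro continuous_map_from_subtopology presentsD(3)[OF P])
    show "f ` topspace (subtopology Y U) \<subseteq> R" using presentsD(4)[OF P] openin_subset[OF U(1)] top by auto
    show "accumulates (subtopology Y U) (prod_topology X X) f (topspace X \<times> topspace X - R)"
      by (intro accumulates_open presentsD(6)[OF P] U)
    fix e x V assume "openin (subtopology Y U) V" "V \<noteq> {}"
    then show "\<exists>y\<in>V. coord e (f y) \<noteq> x" using presentsD(5)[OF P] openin_sub_open[OF U(1)] by meson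
  qed
qed

lemma presents_dense_gdelta:
  assumes P: "presents Y X R f" and X: "Hausdorff_space X" and G: "dense_gdelta Y G"
  shows "presents (subtopology Y G) X R f"
proof -
  have top: "topspace (subtopology Y G) = G" using dense_gdelta_subset[OF G] by (simp add: topspace_subtopology Int_absorb1)
  show ?thesis unfolding presents_def
  proof (intro conjI allI impI)
    show "polish_space (subtopology Y G)" by (intro polish_space_dense_gdelta presentsD(1)[OF P] G)
    show "topspace (subtopology Y G) \<noteq> {}"
      using dense_gdeltaD[OF G openin_topspace presentsD(2)[OF P]] top by auto
    show "continuous_map (subtopology Y G) (prod_topology X X) f"
      by (intro continuous_map_from_subtopology presentsD(3)[OF P])
    show "f ` topspace (subtopology Y G) \<subseteq> R" using presentsD(4)[OF P] dense_gdelta_subset[OF G] top by auto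
    show "accumulates (subtopology Y G) (prod_topology X X) f (topspace X \<times> topspace X - R)"
      by (intro accumulates_dense_gdelta presentsD(3,6)[OF P] G)
    fix e x U assume "openin (subtopology Y G) U" "U \<noteq> {}"
    then obtain W where W: "openin Y W" "U = W \<inter> G" "W \<noteq> {}" unfolding openin_subtopology by blast
    define V where "V = W \<inter> {y \<in> topspace Y. coord e (f y) \<in> topspace X - {x}}"
    have "openin X (topspace X - {x})"
    proof (cases "x \<in> topspace X")
      case True
      then show ?thesis using closedin_Hausdorff_singleton[OF X] by blast
    qed simp
    then have "openin Y V"
      unfolding V_def by (intro openin_Int W(1) openin_continuous_map_preimage[OF presentsD(7)[OF P]])
    moreover have "V \<noteq> {}"
    proof -
      obtain y where y: "y \<in> W" "coord e (f y) \<noteq> x" using presentsD(5)[OF P W(1,3)] by blast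
      moreover have "y \<in> topspace Y" using y(1) openin_subset[OF W(1)] by blast
      moreover have "coord e (f y) \<in> topspace X"
        using continuous_map_image_subset_topspace[OF presentsD(7)[OF P]] \<open>y \<in> topspace Y\<close> by blast
      ultimately show ?thesis unfolding V_def by blast
    qed
    ultimately obtain y where "y \<in> V \<inter> G" using dense_gdeltaD[OF G] by meson
    then show "\<exists>y\<in>U. coord e (f y) \<noteq> x" unfolding V_def W(2) by blast
  qed
qed

lemma dense_gdelta_open:
  assumes U: "openin Y U" and H: "dense_gdelta Y H"
  shows "dense_gdelta (subtopology Y U) (U \<inter> H)"
  unfolding dense_gdelta_def
proof (intro conjI allI impI)
  show "gdelta_in (subtopology Y U) (U \<inter> H)"
    using H by (auto simp: gdelta_in_subtopology dense_gdelta_def)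
  fix V assume V: "openin (subtopology Y U) V" "V \<noteq> {}"
  then have V': "openin Y V" "V \<subseteq> U" using openin_sub_open[OF U] by auto
  with dense_gdeltaD[OF H V'(1) V(2)] show "V \<inter> (U \<inter> H) \<noteq> {}" by blast
qed

text \<open>Borel sets have the Baire property, which is obtained here from \<open>generically_open_map\<close>.\<close>

lemma presents_decide:
  assumes P: "presents Y X R f" and X: "Hausdorff_space X" and S: "borel_in Y S"
  obtains D where "D \<subseteq> topspace Y" "presents (subtopology Y D) X R f" "D \<subseteq> S \<or> D \<inter> S = {}"
proof -
  have Y: "polish_space Y" by (rule presentsD(1)[OF P])
  obtain C :: "('a \<times> (nat \<Rightarrow> nat)) topology" where C: "polish_space C" "continuous_map C Y fst" "fst ` topspace C = S"
    by (rule borel_in_polish_image[OF Y S])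
  obtain H where H: "dense_gdelta Y H" "\<And>U. openin C U \<Longrightarrow> openin (subtopology Y H) (fst ` U \<inter> H)"
    using generically_open_map[OF C(1) Y C(2)] by blast
  obtain Q where Q: "openin Y Q" "S \<inter> H = Q \<inter> H"
    using H(2)[OF openin_topspace] unfolding C(3) openin_subtopology by blast
  define U where "U = (if Q = {} then topspace Y else Q)"
  have U: "openin Y U" "U \<noteq> {}" using Q(1) presentsD(2)[OF P] by (auto simp: U_def)
  have "presents (subtopology (subtopology Y U) (U \<inter> H)) X R f"
    by (rule presents_dense_gdelta[OF presents_open[OF P U] X dense_gdelta_open[OF U(1) H(1)]])
  moreover have "subtopology (subtopology Y U) (U \<inter> H) = subtopology Y (U \<inter> H)"
    by (simp add: subtopology_subtopology Int_absorb1)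
  moreover have "U \<inter> H \<subseteq> S \<or> U \<inter> H \<inter> S = {}"
  proof (cases "Q = {}")
    case True
    then show ?thesis using Q(2) by blast
  next
    case False
    then have "U \<inter> H = S \<inter> H" using Q(2) by (simp add: U_def)
    then show ?thesis by blast
  qed
  ultimately show ?thesis using that[of "U \<inter> H"] openin_subset[OF U(1)] by auto
qed

text \<open>The coordinate takes a value different from \<open>v\<close> on every nonempty open set, and then it stays away from \<open>v\<close>
  on a smaller open set.\<close>

lemma negligible_along_coord:
  assumes P: "presents Y X R f" and X: "Hausdorff_space X"
  shows "negligible_along Y (prod_topology X X) f {b. coord e b = v}"
  unfolding negligible_along_def
proof (intro allI impI)
  let ?Z = "prod_topology X X"
  fix U assume U: "openin Y U" "U \<noteq> {}"
  obtain y where y: "y \<in> U" "coord e (f y) \<noteq> v" using presentsD(5)[OF P U] by blast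
  have yX: "coord e (f y) \<in> topspace X"
    using continuous_map_image_subset_topspace[OF presentsD(7)[OF P]] y(1) openin_subset[OF U(1)] by blast
  show "\<exists>V. openin Y V \<and> V \<noteq> {} \<and> V \<subseteq> U \<and> (?Z closure_of (f ` V)) \<inter> {b. coord e b = v} = {}"
  proof (cases "v \<in> topspace X")
    case False
    have "coord e b \<in> topspace X" if "b \<in> ?Z closure_of (f ` U)" for b
      using that closure_of_subset_topspace[of ?Z "f ` U"] by (intro coord_in) auto
    then have "(?Z closure_of (f ` U)) \<inter> {b. coord e b = v} = {}" using False by blast
    then show ?thesis using U by blast
  next
    case True
    then obtain A A' where A: "openin X A" "openin X A'" "coord e (f y) \<in> A" "v \<in> A'" "A \<inter> A' = {}"
      using X yX y(2) unfolding Hausdorff_space_def disjnt_def by metis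
    define V where "V = U \<inter> {y \<in> topspace Y. coord e (f y) \<in> A}"
    have V: "openin Y V" unfolding V_def
      by (intro openin_Int U(1) openin_continuous_map_preimage[OF presentsD(7)[OF P]] A(1))
    have "(?Z closure_of (f ` V)) \<inter> {b. coord e b = v} = {}"
    proof (intro equals0I)
      fix b assume b: "b \<in> (?Z closure_of (f ` V)) \<inter> {b. coord e b = v}"
      have o: "openin ?Z {b \<in> topspace ?Z. coord e b \<in> A'}"
        by (rule openin_continuous_map_preimage[OF continuous_map_coord A(2)])
      have "b \<in> ?Z closure_of (f ` V)" "coord e b = v" using b by auto
      moreover from this have "b \<in> {b \<in> topspace ?Z. coord e b \<in> A'}"
        using A(4) closure_of_subset_topspace[of ?Z "f ` V"] by auto
      ultimately have "\<exists>c\<in>f ` V. c \<in> {b \<in> topspace ?Z. coord e b \<in> A'}" by (intro closure_of_meets[OF _ o])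
      then show False using A(5) unfolding V_def by blast
    qed
    moreover have "y \<in> V" using y(1) A(3) openin_subset[OF U(1)] unfolding V_def by blast
    ultimately show ?thesis using V by (intro exI[of _ V] conjI) (auto simp: V_def)
  qed
qed

definition four_cycle_free :: "('a \<times> 'a) set \<Rightarrow> bool" where
  "four_cycle_free E \<longleftrightarrow>
     (\<forall>a b c d. distinct [a, b, c, d] \<longrightarrow> \<not> ((a, b) \<in> E \<and> (b, c) \<in> E \<and> (c, d) \<in> E \<and> (d, a) \<in> E))"

lemma s_acyclic_four_cycle_free:
  assumes "s_acyclic R"
  shows "four_cycle_free (symmetrization R)"
  unfolding four_cycle_free_def
proof (intro allI impI notI)
  fix a b c d
  assume d: "distinct [a, b, c, d]" and e: "(a, b) \<in> symmetrization R \<and> (b, c) \<in> symmetrization R \<and>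
    (c, d) \<in> symmetrization R \<and> (d, a) \<in> symmetrization R"
  define x where "x i = [a, b, c, d] ! i" for i
  have "rel_path (symmetrization R) 3 x"
    using e by (auto simp: rel_path_def x_def less_Suc_eq numeral_3_eq_3)
  moreover have "inj_on x {..3}"
  proof (rule inj_onI)
    fix i j :: nat assume "i \<in> {..3}" "j \<in> {..3}" "x i = x j"
    then show "i = j" using nth_eq_iff_index_eq[OF d, of i j] by (simp add: x_def)
  qed
  moreover have "(x 3, x 0) \<in> symmetrization R" using e by (simp add: x_def)
  ultimately show False using assms unfolding s_acyclic_def acyclic_rel_def by fastforce
qed

text \<open>This is where acyclicity enters.  Two different vertices \<open>u\<close> and \<open>u'\<close> have at most one common neighbour \<open>v\<close>, since two of
  them would form a cycle of length four together with \<open>u\<close> and \<open>u'\<close>.  So if the set \<open>N u\<close> of points with one coordinate next to \<open>u\<close> is not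
  negligible, then inside \<open>N u\<close> the points next to any other vertex lie on two lines, which are negligible.\<close>

lemma accumulates_sparse:
  fixes X :: "'a topology"
  assumes P: "presents Y X R f" and X: "Hausdorff_space X"
    and B: "accumulates Y (prod_topology X X) f B"
    and E: "sym E" "four_cycle_free E"
  obtains U B' where "openin Y U" "U \<noteq> {}" "B' \<subseteq> B" "accumulates (subtopology Y U) (prod_topology X X) f B'"
    "\<And>q e. q \<in> B' \<Longrightarrow>
       negligible_along (subtopology Y U) (prod_topology X X) f {b \<in> B'. (coord e q, coord \<eta> b) \<in> E \<union> Id}"
proof -
  let ?Z = "prod_topology X X"
  define N where "N u = {b \<in> B. (u, coord \<eta> b) \<in> E}" for u :: 'a
  show ?thesis
  proof (cases "\<forall>u. negligible_along Y ?Z f (N u)")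
    case True
    have sub: "subtopology Y (topspace Y) = Y" by simp
    show ?thesis
    proof (rule that[of "topspace Y" B], unfold sub)
      fix q e assume "q \<in> B"
      have "negligible_along Y ?Z f (N (coord e q) \<union> {b. coord \<eta> b = coord e q})"
        using True by (intro negligible_along_Un negligible_along_coord[OF P X]) blast
      then show "negligible_along Y ?Z f {b \<in> B. (coord e q, coord \<eta> b) \<in> E \<union> Id}"
        by (rule negligible_along_subset) (auto simp: N_def)
    qed (use B presentsD(2)[OF P] in simp_all)
  next
    case False
    then obtain u where "\<not> negligible_along Y ?Z f (N u)" by blast
    then obtain U where U: "openin Y U" "U \<noteq> {}" "accumulates (subtopology Y U) ?Z f (N u)"
      by (rule not_negligible_along)
    let ?Y = "subtopology Y U"
    have P': "presents ?Y X R f" by (rule presents_open[OF P U(1,2)])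
    define B' where "B' = N u - (\<Union>e\<in>UNIV. {b. coord e b = u})"
    have "accumulates ?Y ?Z f B'" unfolding B'_def
      by (intro accumulates_Diff U(3) negligible_along_UN negligible_along_coord[OF P' X]) simp
    moreover have "negligible_along ?Y ?Z f {b \<in> B'. (coord e q, coord \<eta> b) \<in> E \<union> Id}" if q: "q \<in> B'" for q e
    proof -
      define u' where "u' = coord e q"
      have "u' \<noteq> u" using q unfolding B'_def u'_def by blast
      have uniq: "coord \<eta> b = coord \<eta> c" if "b \<in> B'" "c \<in> B'" "(u', coord \<eta> b) \<in> E" "(u', coord \<eta> c) \<in> E"
        "coord \<eta> b \<noteq> u'" "coord \<eta> c \<noteq> u'" for b c
      proof (rule ccontr)
        assume "coord \<eta> b \<noteq> coord \<eta> c"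
        moreover have "coord \<eta> b \<noteq> u" "coord \<eta> c \<noteq> u" using that unfolding B'_def by blast+
        ultimately have "distinct [u, coord \<eta> b, u', coord \<eta> c]" using that \<open>u' \<noteq> u\<close> by auto
        moreover have "(u, coord \<eta> b) \<in> E" "(coord \<eta> c, u) \<in> E" "(coord \<eta> b, u') \<in> E" "(u', coord \<eta> c) \<in> E"
          using that E(1) unfolding B'_def N_def sym_def by blast+
        ultimately show False using E(2) unfolding four_cycle_free_def by blast
      qed
      obtain v where v: "\<And>b. b \<in> B' \<Longrightarrow> (u', coord \<eta> b) \<in> E \<Longrightarrow> coord \<eta> b \<noteq> u' \<Longrightarrow> coord \<eta> b = v"
      proof (cases "\<exists>b\<in>B'. (u', coord \<eta> b) \<in> E \<and> coord \<eta> b \<noteq> u'")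
        case True
        then obtain b where "b \<in> B'" "(u', coord \<eta> b) \<in> E" "coord \<eta> b \<noteq> u'" by blast
        then show ?thesis using uniq that[of "coord \<eta> b"] by metis
      qed (use that in blast)
      have "negligible_along ?Y ?Z f ({b. coord \<eta> b = u'} \<union> {b. coord \<eta> b = v})"
        by (intro negligible_along_Un negligible_along_coord[OF P' X])
      then show ?thesis unfolding u'_def[symmetric]
        by (rule negligible_along_subset) (use v in auto)
    qed
    ultimately show ?thesis using that[OF U(1,2), of B'] unfolding B'_def N_def by blast
  qed
qed

lemma separate_closures:
  assumes X: "Hausdorff_space X" "regular_space X" and "x \<in> topspace X" "y \<in> topspace X" "x \<noteq> y"
  obtains A A' where "openin X A" "openin X A'" "x \<in> A" "y \<in> A'" "(X closure_of A) \<inter> (X closure_of A') = {}"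
proof -
  obtain S S' where S: "openin X S" "openin X S'" "x \<in> S" "y \<in> S'" "S \<inter> S' = {}"
    using X(1) assms(3-5) unfolding Hausdorff_space_def disjnt_def by metis
  have "closedin X (topspace X - S')" "y \<in> topspace X - (topspace X - S')" using S assms by auto
  then obtain U V where U: "openin X U" "openin X V" "y \<in> U" "topspace X - S' \<subseteq> V" "disjnt U V"
    using X(2) unfolding regular_space_def by meson
  have "X closure_of U \<subseteq> topspace X - V"
    using U openin_subset[OF U(1)] by (intro closure_of_minimal) (auto simp: disjnt_def)
  then have "X closure_of U \<subseteq> S'" using U(4) by blast
  moreover have "S' \<inter> X closure_of S = {}" using openin_Int_closure_of_eq_empty[OF S(2)] S(5) by blast
  ultimately have "(X closure_of S) \<inter> (X closure_of U) = {}" by blast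
  then show ?thesis using that[of S U] S U by blast
qed

text \<open>If the two coordinates agree everywhere, then they agree on the closure of the range.  If they differ
  at some point, then they have neighbourhoods with disjoint closures there, and the preimage of these
  neighbourhoods is the required open set.\<close>

lemma presents_coordinates:
  assumes P: "presents Y X R f" and X: "Hausdorff_space X" "regular_space X"
  obtains U where "openin Y U" "U \<noteq> {}" "\<And>b. b \<in> prod_topology X X closure_of (f ` U) \<Longrightarrow> fst b = snd b"
  | U where "openin Y U" "U \<noteq> {}" "\<And>b. b \<in> prod_topology X X closure_of (f ` U) \<Longrightarrow> fst b \<noteq> snd b"
proof (cases "\<exists>y\<in>topspace Y. fst (f y) \<noteq> snd (f y)")
  case True
  let ?Z = "prod_topology X X"
  obtain y where y: "y \<in> topspace Y" "fst (f y) \<noteq> snd (f y)" using True by blast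
  have cont: "continuous_map Y X (\<lambda>y. fst (f y))" "continuous_map Y X (\<lambda>y. snd (f y))"
    using presentsD(7)[OF P, of False] presentsD(7)[OF P, of True] by (simp_all add: coord_def)
  have "fst (f y) \<in> topspace X" "snd (f y) \<in> topspace X"
    using cont[THEN continuous_map_image_subset_topspace] y(1) by blast+
  then obtain A A' where A: "openin X A" "openin X A'" "fst (f y) \<in> A" "snd (f y) \<in> A'" "(X closure_of A) \<inter> (X closure_of A') = {}"
    using separate_closures[OF X] y(2) by metis
  define U where "U = {y \<in> topspace Y. fst (f y) \<in> A} \<inter> {y \<in> topspace Y. snd (f y) \<in> A'}"
  have "openin Y U" unfolding U_def by (intro openin_Int openin_continuous_map_preimage[OF cont(1)] openin_continuous_map_preimage[OF cont(2)] A)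
  moreover have "U \<noteq> {}" using y A unfolding U_def by blast
  moreover have "fst b \<noteq> snd b" if b: "b \<in> ?Z closure_of (f ` U)" for b
  proof -
    have "f y \<in> A \<times> A'" if "y \<in> U" for y using that by (simp add: U_def mem_Times_iff)
    then have "f ` U \<subseteq> A \<times> A'" by blast
    then have "?Z closure_of (f ` U) \<subseteq> ?Z closure_of (A \<times> A')" by (rule closure_of_mono)
    then have "fst b \<in> X closure_of A" "snd b \<in> X closure_of A'" using b by (auto simp: closure_of_Times mem_Times_iff)
    then show ?thesis using A(5) by auto
  qed
  ultimately show ?thesis using that(2) by blast
next
  case False
  have "closedin (prod_topology X X) ((\<lambda>x. (x, x)) ` topspace X)" using X(1) by (simp add: Hausdorff_space_closedin_diagonal)
  moreover have "f ` topspace Y \<subseteq> (\<lambda>x. (x, x)) ` topspace X"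
  proof
    fix b assume "b \<in> f ` topspace Y"
    then obtain y where y: "y \<in> topspace Y" "b = f y" by blast
    then have "b \<in> topspace X \<times> topspace X" using continuous_map_image_subset_topspace[OF presentsD(3)[OF P]] by auto
    moreover have "fst b = snd b" using False y by blast
    ultimately show "b \<in> (\<lambda>x. (x, x)) ` topspace X"
      by (intro image_eqI[of _ _ "fst b"]) (simp_all add: prod_eq_iff mem_Times_iff)
  qed
  ultimately have "prod_topology X X closure_of (f ` topspace Y) \<subseteq> (\<lambda>x. (x, x)) ` topspace X"
    by (intro closure_of_minimal)
  then show ?thesis using that(1)[OF openin_topspace presentsD(2)[OF P]] by fastforce
qed


lemma presents_homogeneous:
  assumes P: "presents Y X R f" and X: "Hausdorff_space X" and R: "borel_in (prod_topology X X) R"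
    and I: "finite I"
  shows "\<exists>D\<subseteq>topspace Y. presents (subtopology Y D) X R f \<and>
     (\<forall>(e, e')\<in>I. \<exists>v. \<forall>y\<in>D. ((coord e (f y), coord e' (f y)) \<in> R) = v)"
  using I
proof (induction I rule: finite_induct)
  case empty
  show ?case using P by (intro exI[of _ "topspace Y"]) simp
next
  case (insert i I)
  obtain e e' where i: "i = (e, e')" by (cases i)
  obtain D where D: "D \<subseteq> topspace Y" "presents (subtopology Y D) X R f"
    "\<forall>(e, e')\<in>I. \<exists>v. \<forall>y\<in>D. ((coord e (f y), coord e' (f y)) \<in> R) = v"
    using insert.IH by blast
  let ?Y = "subtopology Y D"
  define S where "S = {y \<in> topspace ?Y. (coord e (f y), coord e' (f y)) \<in> R}"
  have "continuous_map ?Y (prod_topology X X) (\<lambda>y. (coord e (f y), coord e' (f y)))"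
    by (intro continuous_map_pairedI presentsD(7)[OF D(2)])
  then have "borel_in ?Y S" unfolding S_def by (rule borel_in_preimage[OF _ R])
  then obtain D' where D': "D' \<subseteq> topspace ?Y" "presents (subtopology ?Y D') X R f" "D' \<subseteq> S \<or> D' \<inter> S = {}"
    by (rule presents_decide[OF D(2) X])
  have "D' \<subseteq> D" using D'(1) by (simp add: topspace_subtopology)
  then have "presents (subtopology Y D') X R f" using D'(2) by (simp add: subtopology_subtopology Int_absorb1)
  moreover have "\<exists>v. \<forall>y\<in>D'. ((coord e (f y), coord e' (f y)) \<in> R) = v"
    using D'(3)
  proof
    assume "D' \<subseteq> S"
    then show ?thesis unfolding S_def by (intro exI[of _ True]) blast
  next
    assume "D' \<inter> S = {}"
    then show ?thesis using D'(1) unfolding S_def by (intro exI[of _ False]) blast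
  qed
  moreover have "\<forall>(e, e')\<in>I. \<exists>v. \<forall>y\<in>D'. ((coord e (f y), coord e' (f y)) \<in> R) = v"
  proof (intro ballI case_prodI2)
    fix j e e' assume j: "j \<in> I" "j = (e, e')"
    then obtain v where "\<forall>y\<in>D. ((coord e (f y), coord e' (f y)) \<in> R) = v" using D(3) by fast
    then show "\<exists>v. \<forall>y\<in>D'. ((coord e (f y), coord e' (f y)) \<in> R) = v"
      using \<open>D' \<subseteq> D\<close> by (intro exI[of _ v]) (simp add: subset_iff)
  qed
  ultimately show ?case using \<open>D' \<subseteq> D\<close> D(1) by (intro exI[of _ D']) (simp add: i subset_trans)
qed

text \<open>If the points of \<open>B\<close> with \<open>P i\<close> do not accumulate on any nonempty open set, then those without \<open>P i\<close> accumulate everywhere.\<close>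

lemma accumulates_homogeneous:
  fixes P :: "'i \<Rightarrow> 'z \<Rightarrow> bool"
  assumes I: "finite I" and Y: "topspace Y \<noteq> {}" and B: "accumulates Y Z f B"
  shows "\<exists>U B'. openin Y U \<and> U \<noteq> {} \<and> B' \<subseteq> B \<and> accumulates (subtopology Y U) Z f B' \<and>
     (\<forall>i\<in>I. \<exists>v. \<forall>b\<in>B'. P i b = v)"
  using I
proof (induction I rule: finite_induct)
  case empty
  show ?case using Y B by (intro exI[of _ "topspace Y"] exI[of _ B]) simp
next
  case (insert i I)
  obtain U B' where U: "openin Y U" "U \<noteq> {}" "B' \<subseteq> B" "accumulates (subtopology Y U) Z f B'"
     "\<forall>i\<in>I. \<exists>v. \<forall>b\<in>B'. P i b = v" using insert.IH by blast
  from U(4) show ?case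
  proof (rule accumulates_split[where P = "Collect (P i)"])
    fix V assume V: "openin (subtopology Y U) V" "V \<noteq> {}"
      "accumulates (subtopology (subtopology Y U) V) Z f (B' \<inter> Collect (P i))"
    have V': "openin Y V" "V \<subseteq> U" using openin_sub_open[OF U(1) V(1)] by auto
    then have "subtopology (subtopology Y U) V = subtopology Y V" by (simp add: subtopology_subtopology Int_absorb1)
    moreover have "\<forall>j\<in>insert i I. \<exists>v. \<forall>b\<in>B' \<inter> Collect (P i). P j b = v"
    proof
      fix j assume j: "j \<in> insert i I"
      show "\<exists>v. \<forall>b\<in>B' \<inter> Collect (P i). P j b = v"
      proof (cases "j = i")
        case False
        then obtain v where "\<forall>b\<in>B'. P j b = v" using U(5) j by blast
        then show ?thesis by (intro exI[of _ v]) simp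
      qed (intro exI[of _ True], simp)
    qed
    moreover have "B' \<inter> Collect (P i) \<subseteq> B" using U(3) by blast
    ultimately show ?thesis using V' V(2,3)
      by (intro exI[of _ V] exI[of _ "B' \<inter> Collect (P i)"] conjI) simp_all
  next
    assume acc: "accumulates (subtopology Y U) Z f (B' - Collect (P i))"
    have "\<forall>j\<in>insert i I. \<exists>v. \<forall>b\<in>B' - Collect (P i). P j b = v"
    proof
      fix j assume j: "j \<in> insert i I"
      show "\<exists>v. \<forall>b\<in>B' - Collect (P i). P j b = v"
      proof (cases "j = i")
        case False
        then obtain v where "\<forall>b\<in>B'. P j b = v" using U(5) j by blast
        then show ?thesis by (intro exI[of _ v]) simp
      qed (intro exI[of _ False], simp)
    qed
    moreover have "B' - Collect (P i) \<subseteq> B" using U(3) by blast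
    ultimately show ?thesis using U(1,2) acc
      by (intro exI[of _ U] exI[of _ "B' - Collect (P i)"] conjI)
  qed
qed

lemma accumulates_closure:
  assumes "accumulates Y Z f B"
  shows "accumulates Y Z f (B \<inter> Z closure_of (f ` topspace Y))"
  unfolding accumulates_def
proof (intro allI impI)
  fix U assume U: "openin Y U" "U \<noteq> {}"
  have "Z closure_of (f ` U) \<subseteq> Z closure_of (f ` topspace Y)"
    using openin_subset[OF U(1)] by (intro closure_of_mono image_mono)
  then show "\<exists>b\<in>B \<inter> Z closure_of (f ` topspace Y). b \<in> Z closure_of (f ` U)"
    using accumulatesD[OF assms U] by blast
qed

lemma analytic_space_imp_image:
  assumes "analytic_space X"
  obtains W :: "(nat \<Rightarrow> nat) topology" and k
  where "polish_space W" "continuous_map W X k" "k ` topspace W = topspace X"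
proof -
  obtain Y :: "(nat \<Rightarrow> nat) topology" and A where A: "analytic_in Y A" "X homeomorphic_space subtopology Y A"
    using assms unfolding analytic_space_def by blast
  obtain W :: "(nat \<Rightarrow> nat) topology" and g where g: "polish_space W" "continuous_map W Y g" "g ` topspace W = A" "A \<subseteq> topspace Y"
    using A(1) unfolding analytic_in_def by blast
  obtain h where h: "homeomorphic_map (subtopology Y A) X h"
    using A(2) unfolding homeomorphic_space by (metis homeomorphic_space homeomorphic_space_sym A(2))
  have "continuous_map W (subtopology Y A) g" using g by (auto simp: continuous_map_in_subtopology)
  then have "continuous_map W X (h \<circ> g)"
    using homeomorphic_imp_continuous_map[OF h] by (rule continuous_map_compose)
  moreover have "(h \<circ> g) ` topspace W = topspace X"
  proof -
    have "topspace (subtopology Y A) = A" using g(4) by (simp add: topspace_subtopology Int_absorb1)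
    then have "h ` A = topspace X" using homeomorphic_imp_surjective_map[OF h] by simp
    then show ?thesis using g(3) by (metis image_comp)
  qed
  ultimately show ?thesis using that g(1) by blast
qed

text \<open>Start from a Polish space \<open>C\<close> which is mapped onto \<open>R\<close>, and remove all basic open sets whose image is contained
  in an F-sigma subset of \<open>R\<close>.  Something remains, since \<open>R\<close> is not F-sigma, and no nonempty open
  subset of the remainder \<open>Y\<close> is mapped into an F-sigma subset of \<open>R\<close>.  Now closed sets are F-sigma, and so are the
  countable sets of points of \<open>R\<close> on a horizontal or vertical line.\<close>

lemma presentation_exists:
  fixes X :: "'a topology"
  assumes XR: "(X, R) \<in> non_Sigma02_lc_borel"
  obtains Y :: "(((nat \<Rightarrow> nat) \<times> (nat \<Rightarrow> nat)) \<times> (nat \<Rightarrow> nat)) topology" and f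
  where "presents Y X R f"
proof -
  let ?Z = "prod_topology X X"
  have an: "analytic_space X" and RX: "R \<subseteq> topspace X \<times> topspace X" and RB: "borel_in ?Z R"
    and nF: "\<not> fsigma_in ?Z R" and lc: "locally_countable (X, R)"
    using XR unfolding non_Sigma02_lc_borel_def by auto
  have mX: "metrizable_space X" using an by (simp add: analytic_space_def)
  then have HX: "Hausdorff_space X" by (rule metrizable_imp_Hausdorff_space)
  then have HZ: "Hausdorff_space ?Z" by (simp add: Hausdorff_space_prod_topology)
  obtain W :: "(nat \<Rightarrow> nat) topology" and k
    where W: "polish_space W" "continuous_map W X k" "k ` topspace W = topspace X"
    by (rule analytic_space_imp_image[OF an])
  define kk where "kk = (\<lambda>w. (k (fst w), k (snd w)))"
  have kk: "continuous_map (prod_topology W W) ?Z kk"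
    unfolding kk_def
    by (intro continuous_map_pairedI continuous_map_compose[OF continuous_map_fst W(2), unfolded o_def]
        continuous_map_compose[OF continuous_map_snd W(2), unfolded o_def])
  let ?S = "{w \<in> topspace (prod_topology W W). kk w \<in> R}"
  have "borel_in (prod_topology W W) ?S" by (rule borel_in_preimage[OF kk RB])
  then obtain C :: "(((nat \<Rightarrow> nat) \<times> (nat \<Rightarrow> nat)) \<times> (nat \<Rightarrow> nat)) topology"
    where C: "polish_space C" "continuous_map C (prod_topology W W) fst" "fst ` topspace C = ?S"
    by (rule borel_in_polish_image[OF polish_space_prod[OF W(1) W(1)]])
  define f where "f = kk \<circ> (fst :: ((nat \<Rightarrow> nat) \<times> (nat \<Rightarrow> nat)) \<times> (nat \<Rightarrow> nat) \<Rightarrow> _)"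
  have f: "continuous_map C ?Z f" unfolding f_def by (rule continuous_map_compose[OF C(2) kk])
  have fR: "f ` topspace C = R"
  proof -
    have "kk ` ?S = R"
    proof (intro equalityI subsetI)
      fix z assume z: "z \<in> R"
      have "fst z \<in> k ` topspace W" "snd z \<in> k ` topspace W" unfolding W(3) using RX z by auto
      then obtain u v where "u \<in> topspace W" "k u = fst z" "v \<in> topspace W" "k v = snd z"
        by (elim imageE) simp
      then show "z \<in> kk ` ?S" using z by (intro image_eqI[of _ _ "(u, v)"]) (auto simp: kk_def)
    qed auto
    then show ?thesis unfolding f_def using C(3) by (metis image_comp)
  qed
  obtain \<B> where B: "countable \<B>" "\<And>V. V \<in> \<B> \<Longrightarrow> openin C V"
    "\<And>U x. openin C U \<Longrightarrow> x \<in> U \<Longrightarrow> \<exists>V\<in>\<B>. x \<in> V \<and> V \<subseteq> U"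
    using polish_space_imp_second_countable[OF C(1)] by (rule second_countableE) blast
  define \<V> where "\<V> = {V \<in> \<B>. \<exists>F. fsigma_in ?Z F \<and> f ` V \<subseteq> F \<and> F \<subseteq> R}"
  have "\<forall>V\<in>\<V>. \<exists>F. fsigma_in ?Z F \<and> f ` V \<subseteq> F \<and> F \<subseteq> R" unfolding \<V>_def by simp
  then obtain F where F: "\<And>V. V \<in> \<V> \<Longrightarrow> fsigma_in ?Z (F V) \<and> f ` V \<subseteq> F V \<and> F V \<subseteq> R"
    by (elim bchoice[elim_format] exE) blast
  define FW where "FW = (\<Union>V\<in>\<V>. F V)"
  have FW: "fsigma_in ?Z FW" "FW \<subseteq> R"
  proof -
    have "countable \<V>" using B(1) unfolding \<V>_def by simp
    then show "fsigma_in ?Z FW" unfolding FW_def using F by (intro fsigma_in_Union) auto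
    show "FW \<subseteq> R" unfolding FW_def using F by blast
  qed
  have fW: "f ` (\<Union>\<V>) \<subseteq> FW" unfolding FW_def using F by blast
  have oW: "openin C (\<Union>\<V>)" unfolding \<V>_def using B(2) by blast
  define Y where "Y = subtopology C (topspace C - \<Union>\<V>)"
  have topY: "topspace Y = topspace C - \<Union>\<V>" unfolding Y_def by (auto simp: topspace_subtopology)
  have key: False if U: "openin Y U" "U \<noteq> {}" and K: "fsigma_in ?Z K" "f ` U \<subseteq> K" "K \<subseteq> R" for U K
  proof -
    obtain U0 where U0: "openin C U0" "U = U0 \<inter> (topspace C - \<Union>\<V>)" using U(1) unfolding Y_def openin_subtopology by blast
    obtain c where c: "c \<in> U" using U(2) by blast
    then obtain V where V: "V \<in> \<B>" "c \<in> V" "V \<subseteq> U0" using B(3)[OF U0(1)] U0(2) by blast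
    have "f ` V \<subseteq> K \<union> FW"
    proof
      fix z assume "z \<in> f ` V"
      then obtain v where v: "v \<in> V" "z = f v" by blast
      show "z \<in> K \<union> FW"
      proof (cases "v \<in> \<Union>\<V>")
        case True
        then show ?thesis using fW v(2) by blast
      next
        case False
        then have "v \<in> U" using U0(2) V(3) v(1) openin_subset[OF U0(1)] by blast
        then show ?thesis using K(2) v(2) by blast
      qed
    qed
    then have "V \<in> \<V>" unfolding \<V>_def using V(1) K FW by (intro CollectI conjI exI[of _ "K \<union> FW"]) (auto intro: fsigma_in_Un)
    then show False using c V(2) U0(2) by blast
  qed
  have cntF: "fsigma_in ?Z K" if K: "countable K" "K \<subseteq> topspace ?Z" for K
  proof -
    have "fsigma_in ?Z (\<Union>((\<lambda>z. {z}) ` K))"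
      using K by (intro fsigma_in_Union) (auto intro!: closed_imp_fsigma_in closedin_Hausdorff_singleton[OF HZ])
    then show ?thesis by simp
  qed
  have "presents Y X R f" unfolding presents_def
  proof (intro conjI allI impI)
    show "polish_space Y" unfolding Y_def using oW by (intro polish_space_closedin C(1)) blast
    show "topspace Y \<noteq> {}"
    proof
      assume "topspace Y = {}"
      then have "R \<subseteq> FW" using fR fW topY by blast
      then show False using FW nF by (metis subset_antisym)
    qed
    show fY: "continuous_map Y ?Z f" unfolding Y_def by (rule continuous_map_from_subtopology[OF f])
    show "f ` topspace Y \<subseteq> R" using fR topY by blast
    show "accumulates Y ?Z f (topspace X \<times> topspace X - R)" unfolding accumulates_def
    proof (intro allI impI, rule ccontr)
      fix U assume U: "openin Y U" "U \<noteq> {}" and n: "\<not> (\<exists>b\<in>topspace X \<times> topspace X - R. b \<in> ?Z closure_of (f ` U))"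
      have "?Z closure_of (f ` U) \<subseteq> R" using n closure_of_subset_topspace[of ?Z "f ` U"] by auto
      moreover have "f ` U \<subseteq> ?Z closure_of (f ` U)"
        using continuous_map_image_subset_topspace[OF fY] openin_subset[OF U(1)] by (intro closure_of_subset) auto
      ultimately show False using key[OF U closed_imp_fsigma_in[OF closedin_closure_of]] by blast
    qed
    fix e x U assume U: "openin Y U" "U \<noteq> {}"
    show "\<exists>y\<in>U. coord e (f y) \<noteq> x"
    proof (rule ccontr)
      assume n: "\<not> ?thesis"
      define K where "K = {z \<in> R. coord e z = x}"
      have "x \<in> topspace X"
      proof -
        obtain y where y: "y \<in> U" using U(2) by blast
        then have "coord e (f y) = x" using n by blast
        moreover have "f y \<in> topspace X \<times> topspace X" using fR RX y openin_subset[OF U(1)] topY by blast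
        ultimately show ?thesis using coord_in by metis
      qed
      then have c: "countable (R `` {x})" "countable (R\<inverse> `` {x})" using lc unfolding locally_countable_def by auto
      have "K \<subseteq> ({x} \<times> R `` {x}) \<union> (R\<inverse> `` {x} \<times> {x})" unfolding K_def by (cases e) (auto simp: coord_def)
      then have "countable K" by (rule countable_subset) (use c in simp)
      moreover have "K \<subseteq> topspace ?Z" unfolding K_def using RX by auto
      ultimately have "fsigma_in ?Z K" by (rule cntF)
      moreover have "f ` U \<subseteq> K" using n fR openin_subset[OF U(1)] topY unfolding K_def by blast
      ultimately show False using key[OF U] unfolding K_def by blast
    qed
  qed
  then show ?thesis by (rule that)
qed

text \<open>The uniformization is applied to the Borel set of all \<open>(y, w)\<close> such that \<open>k w\<close> is related to a coordinate of \<open>f y\<close>.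
  The Polish space \<open>W\<close> replaces \<open>X\<close>, which is only analytic.\<close>

lemma presents_neighbour_functions:
  assumes P: "presents Y X R f" and X: "Hausdorff_space X"
    and W: "polish_space W" "continuous_map W X k" "k ` topspace W = topspace X"
    and T: "borel_in (prod_topology X X) T" "T \<subseteq> topspace X \<times> topspace X" "\<And>x. countable (T `` {x})"
  obtains G H where "dense_gdelta Y G" "countable H"
    "\<And>h. h \<in> H \<Longrightarrow> continuous_map (subtopology Y G) X h"
    "\<And>y e x. y \<in> G \<Longrightarrow> (coord e (f y), x) \<in> T \<Longrightarrow> \<exists>h\<in>H. x = h y"
proof -
  have Y: "polish_space Y" by (rule presentsD(1)[OF P])
  let ?YW = "prod_topology Y W"
  have "borel_in ?YW {z \<in> topspace ?YW. (coord e (f (fst z)), k (snd z)) \<in> T}" for e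
  proof (rule borel_in_preimage[OF _ T(1)])
    show "continuous_map ?YW (prod_topology X X) (\<lambda>z. (coord e (f (fst z)), k (snd z)))"
      by (intro continuous_map_pairedI continuous_map_compose[OF continuous_map_fst presentsD(7)[OF P], unfolded o_def]
        continuous_map_compose[OF continuous_map_snd W(2), unfolded o_def])
  qed
  note b = this
  define S where "S = (\<Union>e\<in>UNIV. {z \<in> topspace ?YW. (coord e (f (fst z)), k (snd z)) \<in> T})"
  have "borel_in ?YW S"
  proof -
    have "S = {z \<in> topspace ?YW. (coord False (f (fst z)), k (snd z)) \<in> T} \<union>
        {z \<in> topspace ?YW. (coord True (f (fst z)), k (snd z)) \<in> T}"
      unfolding S_def by (simp only: UNIV_bool UN_insert UN_empty Un_empty_right)
    also have "borel_in ?YW \<dots>" using b unfolding borel_in_def by (intro sigma_sets_Un)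
    finally show ?thesis .
  qed
  then obtain C :: "(('a \<times> 'c) \<times> (nat \<Rightarrow> nat)) topology"
    where C: "polish_space C" "continuous_map C ?YW fst" "fst ` topspace C = S"
    by (rule borel_in_polish_image[OF polish_space_prod[OF Y W(1)]])
  define p where "p = fst \<circ> (fst :: ('a \<times> 'c) \<times> (nat \<Rightarrow> nat) \<Rightarrow> 'a \<times> 'c)"
  define kk where "kk = k \<circ> (snd \<circ> (fst :: ('a \<times> 'c) \<times> (nat \<Rightarrow> nat) \<Rightarrow> 'a \<times> 'c))"
  have p: "continuous_map C Y p" unfolding p_def by (rule continuous_map_compose[OF C(2) continuous_map_fst])
  have kk: "continuous_map C X kk" unfolding kk_def
    by (rule continuous_map_compose[OF continuous_map_compose[OF C(2) continuous_map_snd] W(2)])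
  have cnt: "countable (kk ` {c \<in> topspace C. p c = y})" for y
  proof (rule countable_subset)
    show "kk ` {c \<in> topspace C. p c = y} \<subseteq> (\<Union>e\<in>UNIV. T `` {coord e (f y)})"
    proof
      fix x assume "x \<in> kk ` {c \<in> topspace C. p c = y}"
      then obtain c where c: "c \<in> topspace C" "p c = y" "x = kk c" by blast
      then have "fst c \<in> S" using C(3) by blast
      then show "x \<in> (\<Union>e\<in>UNIV. T `` {coord e (f y)})" using c unfolding S_def p_def kk_def by auto
    qed
  qed (use T(3) in auto)
  obtain G H where GH: "dense_gdelta Y G" "countable H"
    "\<And>h. h \<in> H \<Longrightarrow> continuous_map (subtopology Y G) X h"
    "\<And>c. c \<in> topspace C \<Longrightarrow> p c \<in> G \<Longrightarrow> \<exists>h\<in>H. kk c = h (p c)"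
    by (rule generic_countable_uniformization[OF C(1) Y X p kk presentsD(7)[OF P, of False] cnt]) blast
  have "\<exists>h\<in>H. x = h y" if y: "y \<in> G" "(coord e (f y), x) \<in> T" for y e x
  proof -
    have "x \<in> k ` topspace W" unfolding W(3) using y(2) T(2) by blast
    then obtain w where w: "w \<in> topspace W" "k w = x" by blast
    have "(y, w) \<in> S" using y w dense_gdelta_subset[OF GH(1)] unfolding S_def by auto
    then have "(y, w) \<in> fst ` topspace C" unfolding C(3) .
    then obtain c where c: "c \<in> topspace C" "fst c = (y, w)" by (elim imageE) simp
    then have "p c = y" "kk c = x" using w unfolding p_def kk_def by simp_all
    then show ?thesis using GH(4)[OF c(1)] y(1) by simp
  qed
  with GH(1-3) show ?thesis by (rule that)
qed


text \<open>All that is needed to build the copy of the Cantor space.  The properties are obtained one after the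
  other, each by passing to a nonempty open subspace or a dense G-delta subspace, and the earlier properties are
  inherited.  The set \<open>Q\<close> is cut down to the closure of the range of \<open>f\<close>, so that the equality or inequality of the coordinates
  passes to its points.\<close>

lemma prepared_presentation:
  fixes X :: "'a topology" and R :: "('a \<times> 'a) set"
  assumes XR: "(X, R) \<in> non_Sigma02_lc_borel" and acyc: "s_acyclic R"
  defines "Z \<equiv> prod_topology X X" and "T \<equiv> symmetrization R \<union> Id_on (topspace X)"
  obtains Y :: "(((nat \<Rightarrow> nat) \<times> (nat \<Rightarrow> nat)) \<times> (nat \<Rightarrow> nat)) topology" and f H Q \<gamma> \<delta> \<sigma>
  where "presents Y X R f" "countable H" "\<And>h. h \<in> H \<Longrightarrow> continuous_map Y X h"
    "\<And>y e x. y \<in> topspace Y \<Longrightarrow> (coord e (f y), x) \<in> T \<Longrightarrow> \<exists>h\<in>H. x = h y"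
    "Q \<subseteq> topspace Z - R" "countable Q" "accumulates Y Z f Q"
    "\<And>q q' e e'. q \<in> Q \<Longrightarrow> q' \<in> Q \<Longrightarrow> q \<noteq> q' \<Longrightarrow> (coord e q, coord e' q') \<notin> T"
    "\<And>y e e'. y \<in> topspace Y \<Longrightarrow> ((coord e (f y), coord e' (f y)) \<in> R) = \<gamma> e e'"
    "\<And>q e e'. q \<in> Q \<Longrightarrow> ((coord e q, coord e' q) \<in> R) = \<delta> e e'"
    "\<And>b. b \<in> f ` topspace Y \<union> Q \<Longrightarrow> (fst b = snd b) = \<sigma>"
proof -
  have an: "analytic_space X" and RX: "R \<subseteq> topspace X \<times> topspace X" and RB: "borel_in Z R"
    and lc: "locally_countable (X, R)"
    using XR unfolding non_Sigma02_lc_borel_def Z_def by auto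
  have mX: "metrizable_space X" using an by (simp add: analytic_space_def)
  then have HX: "Hausdorff_space X" and regX: "regular_space X"
    by (rule metrizable_imp_Hausdorff_space, rule metrizable_imp_regular_space)
  have topZ: "topspace Z = topspace X \<times> topspace X" by (simp add: Z_def)
  have mZ: "metrizable_space Z" unfolding Z_def using mX by (simp add: metrizable_space_prod_topology)
  obtain W :: "(nat \<Rightarrow> nat) topology" and k
    where W: "polish_space W" "continuous_map W X k" "k ` topspace W = topspace X"
    by (rule analytic_space_imp_image[OF an])
  have TX: "T \<subseteq> topspace X \<times> topspace X" using RX unfolding T_def symmetrization_def by auto
  have symT: "sym T" unfolding T_def symmetrization_def sym_def by auto
  have Tcount: "countable (T `` {x})" for x
  proof (cases "x \<in> topspace X")
    case True
    then have "countable (R `` {x})" "countable (R\<inverse> `` {x})" using lc unfolding locally_countable_def by auto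
    moreover have "T `` {x} \<subseteq> R `` {x} \<union> R\<inverse> `` {x} \<union> {x}" unfolding T_def symmetrization_def by auto
    ultimately show ?thesis by (meson countable_Un countable_empty countable_insert countable_subset)
  next
    case False
    then have "T `` {x} = {}" using TX by blast
    then show ?thesis by simp
  qed
  have TB: "borel_in (prod_topology X X) T"
  proof -
    have "borel_in Z (R\<inverse>)"
    proof -
      have "continuous_map Z Z (\<lambda>z. (snd z, fst z))" unfolding Z_def
        by (intro continuous_map_pairedI continuous_map_fst continuous_map_snd)
      from borel_in_preimage[OF this RB] have "borel_in Z {z \<in> topspace Z. (snd z, fst z) \<in> R}" .
      moreover have "{z \<in> topspace Z. (snd z, fst z) \<in> R} = R\<inverse>" using RX by (auto simp: topZ)
      ultimately show ?thesis by simp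
    qed
    moreover have "borel_in Z (Id_on (topspace X))"
    proof -
      have "closedin Z (Id_on (topspace X))"
      proof -
        have "Id_on (topspace X) = (\<lambda>x. (x, x)) ` topspace X" by (auto simp: Id_on_def)
        then show ?thesis using HX unfolding Z_def Hausdorff_space_closedin_diagonal by simp
      qed
      then have "openin Z (topspace Z - Id_on (topspace X))" by blast
      then have "topspace Z - (topspace Z - Id_on (topspace X)) \<in> sigma_sets (topspace Z) {U. openin Z U}"
        by (intro sigma_sets.Compl sigma_sets.Basic) simp
      moreover have "topspace Z - (topspace Z - Id_on (topspace X)) = Id_on (topspace X)" by (auto simp: topZ)
      ultimately show ?thesis by (simp add: borel_in_def)
    qed
    ultimately show ?thesis using RB unfolding T_def symmetrization_def borel_in_def Z_def[symmetric]
      by (intro sigma_sets_Un)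
  qed
  obtain Y0 :: "(((nat \<Rightarrow> nat) \<times> (nat \<Rightarrow> nat)) \<times> (nat \<Rightarrow> nat)) topology" and f
    where P0: "presents Y0 X R f" using presentation_exists[OF XR] by metis
  obtain U1 \<sigma> where U1: "openin Y0 U1" "U1 \<noteq> {}" "\<And>b. b \<in> Z closure_of (f ` U1) \<Longrightarrow> (fst b = snd b) = \<sigma>"
  proof (rule presents_coordinates[OF P0 HX regX])
    fix U assume "openin Y0 U" "U \<noteq> {}" "\<And>b. b \<in> prod_topology X X closure_of f ` U \<Longrightarrow> fst b = snd b"
    then show thesis using that[of U True] by (simp add: Z_def)
  next
    fix U assume "openin Y0 U" "U \<noteq> {}" "\<And>b. b \<in> prod_topology X X closure_of f ` U \<Longrightarrow> fst b \<noteq> snd b"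
    then show thesis using that[of U False] by (simp add: Z_def)
  qed
  define Y1 where "Y1 = subtopology Y0 U1"
  have P1: "presents Y1 X R f" unfolding Y1_def by (rule presents_open[OF P0 U1(1,2)])
  obtain D2 where D2: "D2 \<subseteq> topspace Y1" "presents (subtopology Y1 D2) X R f"
     "\<forall>(e, e')\<in>UNIV. \<exists>v. \<forall>y\<in>D2. ((coord e (f y), coord e' (f y)) \<in> R) = v"
    using presents_homogeneous[OF P1 HX RB[unfolded Z_def], of UNIV] by auto
  define Y2 where "Y2 = subtopology Y1 D2"
  have P2: "presents Y2 X R f" unfolding Y2_def by (rule D2(2))
  obtain G3 H where G3: "dense_gdelta Y2 G3" and H: "countable H"
    "\<And>h. h \<in> H \<Longrightarrow> continuous_map (subtopology Y2 G3) X h"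
    "\<And>y e x. y \<in> G3 \<Longrightarrow> (coord e (f y), x) \<in> T \<Longrightarrow> \<exists>h\<in>H. x = h y"
    by (rule presents_neighbour_functions[OF P2 HX W TB TX Tcount]) blast
  define Y3 where "Y3 = subtopology Y2 G3"
  have P3: "presents Y3 X R f" unfolding Y3_def by (rule presents_dense_gdelta[OF P2 HX G3])
  have top3: "topspace Y3 \<subseteq> G3 \<inter> D2 \<inter> U1" unfolding Y3_def Y2_def Y1_def by (auto simp: topspace_subtopology)
  define B3 where "B3 = (topspace Z - R) \<inter> Z closure_of (f ` topspace Y3)"
  have "accumulates Y3 Z f B3" unfolding B3_def
    using presentsD(6)[OF P3] by (intro accumulates_closure) (simp add: Z_def)
  then obtain U4 B4 where U4: "openin Y3 U4" "U4 \<noteq> {}" "B4 \<subseteq> B3" "accumulates (subtopology Y3 U4) Z f B4"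
     "\<forall>(i :: bool \<times> bool)\<in>UNIV. \<exists>v. \<forall>b\<in>B4. ((coord (fst i) b, coord (snd i) b) \<in> R) = v"
    using accumulates_homogeneous[of "UNIV :: (bool \<times> bool) set" Y3 Z f B3
        "\<lambda>i b. (coord (fst i) b, coord (snd i) b) \<in> R"] presentsD(2)[OF P3] by auto
  define Y4 where "Y4 = subtopology Y3 U4"
  have P4: "presents Y4 X R f" unfolding Y4_def by (rule presents_open[OF P3 U4(1,2)])
  have E: "sym (symmetrization R)" "four_cycle_free (symmetrization R)"
    using s_acyclic_four_cycle_free[OF acyc] by (auto simp: symmetrization_def sym_def)
  let ?E = "symmetrization R \<union> Id"
  obtain U5 B5 where U5: "openin Y4 U5" "U5 \<noteq> {}" "B5 \<subseteq> B4" "accumulates (subtopology Y4 U5) Z f B5"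
    "\<And>q e. q \<in> B5 \<Longrightarrow> negligible_along (subtopology Y4 U5) Z f {b \<in> B5. (coord e q, coord False b) \<in> ?E}"
    by (rule accumulates_sparse[OF P4 HX U4(4)[folded Y4_def, unfolded Z_def] E, of False, folded Z_def]) blast
  define Y5 where "Y5 = subtopology Y4 U5"
  have P5: "presents Y5 X R f" unfolding Y5_def by (rule presents_open[OF P4 U5(1,2)])
  obtain U6 B6 where U6: "openin Y5 U6" "U6 \<noteq> {}" "B6 \<subseteq> B5" "accumulates (subtopology Y5 U6) Z f B6"
    "\<And>q e. q \<in> B6 \<Longrightarrow> negligible_along (subtopology Y5 U6) Z f {b \<in> B6. (coord e q, coord True b) \<in> ?E}"
    by (rule accumulates_sparse[OF P5 HX U5(4)[folded Y5_def, unfolded Z_def] E, of True, folded Z_def]) blast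
  define Y6 where "Y6 = subtopology Y5 U6"
  have P6: "presents Y6 X R f" unfolding Y6_def by (rule presents_open[OF P5 U6(1,2)])
  define EE where "EE = {(q, b). \<exists>e e'. (coord e q, coord e' b) \<in> ?E}"
  have symEE: "sym EE"
  proof (rule symI)
    fix q b assume "(q, b) \<in> EE"
    then obtain e e' where "(coord e q, coord e' b) \<in> ?E" by (auto simp only: EE_def mem_Collect_eq prod.case)
    then have "(coord e' b, coord e q) \<in> ?E" using symD[OF E(1)] by auto
    then show "(b, q) \<in> EE" unfolding EE_def by blast
  qed
  have neg: "negligible_along Y6 Z f {b \<in> B6. (q, b) \<in> EE}" if q: "q \<in> B6" for q
  proof -
    have q5: "q \<in> B5" using q U6(3) by blast
    have "negligible_along Y6 Z f {b \<in> B6. (coord e q, coord e' b) \<in> ?E}" for e e'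
    proof (cases e')
      case True
      then show ?thesis using U6(5)[OF q, of e] unfolding Y6_def by simp
    next
      case False
      have "negligible_along Y6 Z f {b \<in> B5. (coord e q, coord False b) \<in> ?E}"
        unfolding Y6_def by (rule negligible_along_open[OF U6(1)]) (use U5(5)[OF q5] in \<open>simp add: Y5_def\<close>)
      then show ?thesis by (rule negligible_along_subset) (use U6(3) False in auto)
    qed
    then have "negligible_along Y6 Z f (\<Union>e\<in>UNIV. \<Union>e'\<in>UNIV. {b \<in> B6. (coord e q, coord e' b) \<in> ?E})"
      by (intro negligible_along_UN) simp_all
    then show ?thesis by (rule negligible_along_subset) (auto simp: EE_def)
  qed
  obtain Q where Q: "Q \<subseteq> B6" "countable Q" "accumulates Y6 Z f Q" "\<forall>q\<in>Q. \<forall>q'\<in>Q. q \<noteq> q' \<longrightarrow> (q, q') \<notin> EE"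
    by (rule accumulates_countable_independent[OF polish_space_imp_second_countable[OF presentsD(1)[OF P6]]
        U6(4)[folded Y6_def] symEE neg]) blast
  have QB: "Q \<subseteq> B3" "Q \<subseteq> B4" using Q(1) U6(3) U5(3) U4(3) by blast+
  have top6: "topspace Y6 \<subseteq> topspace Y3" unfolding Y6_def Y5_def Y4_def by (auto simp: topspace_subtopology)
  have clos: "Z closure_of (f ` topspace Y3) \<subseteq> Z closure_of (f ` U1)"
    using top3 by (intro closure_of_mono image_mono) blast
  have fcl: "f ` topspace Y6 \<subseteq> Z closure_of (f ` topspace Y3)"
  proof -
    have "f ` topspace Y3 \<subseteq> Z closure_of (f ` topspace Y3)"
      using continuous_map_image_subset_topspace[OF presentsD(3)[OF P3]] by (intro closure_of_subset) (auto simp: Z_def)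
    then show ?thesis using top6 by blast
  qed
  have "topspace Y6 \<subseteq> D2" using top6 top3 by blast
  have "\<forall>e e'. \<exists>v. \<forall>y\<in>topspace Y6. ((coord e (f y), coord e' (f y)) \<in> R) = v"
  proof (intro allI)
    fix e e'
    have "\<exists>v. \<forall>y\<in>D2. ((coord e (f y), coord e' (f y)) \<in> R) = v" using bspec[OF D2(3), of "(e, e')"] by simp
    then obtain v where "\<forall>y\<in>D2. ((coord e (f y), coord e' (f y)) \<in> R) = v" by (rule exE)
    then show "\<exists>v. \<forall>y\<in>topspace Y6. ((coord e (f y), coord e' (f y)) \<in> R) = v"
      using \<open>topspace Y6 \<subseteq> D2\<close> by (intro exI[of _ v] ballI) (drule bspec, erule subsetD, assumption, assumption)
  qed
  then obtain \<gamma> where g: "\<And>e e' y. y \<in> topspace Y6 \<Longrightarrow> ((coord e (f y), coord e' (f y)) \<in> R) = \<gamma> e e'" by metis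
  have "\<forall>e e'. \<exists>v. \<forall>b\<in>B4. ((coord e b, coord e' b) \<in> R) = v"
  proof (intro allI)
    fix e e' show "\<exists>v. \<forall>b\<in>B4. ((coord e b, coord e' b) \<in> R) = v"
      using U4(5)[rule_format, of "(e, e')"] by simp
  qed
  then obtain \<delta> where d: "\<And>e e' b. b \<in> B4 \<Longrightarrow> ((coord e b, coord e' b) \<in> R) = \<delta> e e'" by metis
  have cont6: "continuous_map Y6 X h" if "h \<in> H" for h
    using H(2)[OF that] unfolding Y6_def Y5_def Y4_def Y3_def[symmetric] by (intro continuous_map_from_subtopology)
  have nb6: "\<exists>h\<in>H. x = h y" if "y \<in> topspace Y6" "(coord e (f y), x) \<in> T" for y e x
    using H(3)[OF _ that(2)] that(1) top6 top3 by blast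
  have QZ: "Q \<subseteq> topspace Z - R" using QB(1) unfolding B3_def by blast
  have ind: "(coord e q, coord e' q') \<notin> T" if "q \<in> Q" "q' \<in> Q" "q \<noteq> q'" for q q' e e'
    using Q(4) that unfolding EE_def T_def by auto
  have dQ: "((coord e q, coord e' q) \<in> R) = \<delta> e e'" if "q \<in> Q" for q e e' using d that QB(2) by blast
  have sig: "(fst b = snd b) = \<sigma>" if "b \<in> f ` topspace Y6 \<union> Q" for b
    using that U1(3) clos fcl QB(1) unfolding B3_def by blast
  show ?thesis by (rule that[OF P6 H(1) cont6 nb6 QZ Q(2,3) ind g dQ sig])
qed

section \<open>A copy of the Cantor space\<close>

text \<open>The coordinate \<open>e\<close> of \<open>f\<close> takes two different values on \<open>U\<close>, and these have neighbourhoods \<open>A1\<close> and \<open>A2\<close> with disjoint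
  closures.  So \<open>V\<close> is the union of the sets on which \<open>h\<close> misses the closure of \<open>A1\<close> and of \<open>A2\<close>, respectively, and \<open>q\<close> is
  an accumulation point of one of the two.  It is essential here that \<open>h\<close> is single-valued.\<close>

lemma avoid_on_smaller_sets:
  assumes P: "presents Y X R f" and X: "Hausdorff_space X" "regular_space X"
    and h: "continuous_map Y X h"
    and V: "openin Y V" "q \<in> prod_topology X X closure_of (f ` V)" and U: "openin Y U" "U \<noteq> {}"
  obtains V' U' where "openin Y V'" "V' \<subseteq> V" "q \<in> prod_topology X X closure_of (f ` V')"
    "openin Y U'" "U' \<noteq> {}" "U' \<subseteq> U" "\<forall>v\<in>V'. \<forall>u\<in>U'. h v \<noteq> coord e (f u)"
proof -
  note result = that
  let ?Z = "prod_topology X X"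
  have cX: "coord e (f y) \<in> topspace X" if "y \<in> topspace Y" for y
    using continuous_map_image_subset_topspace[OF presentsD(7)[OF P]] that by blast
  obtain y1 where y1: "y1 \<in> U" using U(2) by blast
  obtain y2 where y2: "y2 \<in> U" "coord e (f y2) \<noteq> coord e (f y1)" using presentsD(5)[OF P U] by blast
  have in_Y: "y1 \<in> topspace Y" "y2 \<in> topspace Y" using y1 y2 openin_subset[OF U(1)] by auto
  obtain A1 A2 where A: "openin X A1" "openin X A2" "coord e (f y2) \<in> A1" "coord e (f y1) \<in> A2"
      "(X closure_of A1) \<inter> (X closure_of A2) = {}"
    by (rule separate_closures[OF X cX[OF in_Y(2)] cX[OF in_Y(1)] y2(2)])
  have step: thesis
    if A: "openin X A" "y \<in> U" "coord e (f y) \<in> A"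
      and q: "q \<in> ?Z closure_of (f ` (V \<inter> {v \<in> topspace Y. h v \<in> topspace X - X closure_of A}))" for A y
  proof (rule result)
    show "openin Y (V \<inter> {v \<in> topspace Y. h v \<in> topspace X - X closure_of A})"
      by (intro openin_Int V(1) openin_continuous_map_preimage[OF h] openin_diff) auto
    show "q \<in> ?Z closure_of (f ` (V \<inter> {v \<in> topspace Y. h v \<in> topspace X - X closure_of A}))" by (rule q)
    show "openin Y (U \<inter> {u \<in> topspace Y. coord e (f u) \<in> A})"
      by (intro openin_Int U(1) openin_continuous_map_preimage[OF presentsD(7)[OF P]] A(1))
    show "U \<inter> {u \<in> topspace Y. coord e (f u) \<in> A} \<noteq> {}" using A openin_subset[OF U(1)] by blast
    show "\<forall>v\<in>V \<inter> {v \<in> topspace Y. h v \<in> topspace X - X closure_of A}.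
        \<forall>u\<in>U \<inter> {u \<in> topspace Y. coord e (f u) \<in> A}. h v \<noteq> coord e (f u)"
      using closure_of_subset[OF openin_subset[OF A(1)]] by auto
  qed auto
  have "V \<subseteq> (V \<inter> {v \<in> topspace Y. h v \<in> topspace X - X closure_of A1}) \<union>
      (V \<inter> {v \<in> topspace Y. h v \<in> topspace X - X closure_of A2})" (is "_ \<subseteq> ?V1 \<union> ?V2")
  proof
    fix v assume v: "v \<in> V"
    then have "v \<in> topspace Y" using openin_subset[OF V(1)] by blast
    moreover from this have "h v \<in> topspace X" using continuous_map_image_subset_topspace[OF h] by blast
    ultimately show "v \<in> ?V1 \<union> ?V2" using v A(5) by blast
  qed
  then have "f ` V \<subseteq> f ` ?V1 \<union> f ` ?V2" by blast
  then have "?Z closure_of (f ` V) \<subseteq> ?Z closure_of (f ` ?V1 \<union> f ` ?V2)" by (rule closure_of_mono)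
  then have "q \<in> ?Z closure_of (f ` ?V1) \<or> q \<in> ?Z closure_of (f ` ?V2)" using V(2) unfolding closure_of_Un by blast
  then show thesis
  proof
    assume "q \<in> ?Z closure_of (f ` ?V1)"
    then show thesis by (rule step[OF A(1) y2(1) A(3)])
  next
    assume "q \<in> ?Z closure_of (f ` ?V2)"
    then show thesis by (rule step[OF A(2) y1 A(4)])
  qed
qed

lemma avoid_on_smaller_sets_finite:
  assumes P: "presents Y X R f" and X: "Hausdorff_space X" "regular_space X"
    and J: "finite J" "\<And>i h e. (i, h, e) \<in> J \<Longrightarrow> i \<in> I \<and> continuous_map Y X h"
    and V: "\<And>i. i \<in> I \<Longrightarrow> openin Y (V i) \<and> q i \<in> prod_topology X X closure_of (f ` V i)"
    and U: "openin Y U" "U \<noteq> {}"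
  shows "\<exists>V' U'. (\<forall>i\<in>I. openin Y (V' i) \<and> V' i \<subseteq> V i \<and> q i \<in> prod_topology X X closure_of (f ` V' i)) \<and>
    openin Y U' \<and> U' \<noteq> {} \<and> U' \<subseteq> U \<and>
    (\<forall>(i, h, e)\<in>J. \<forall>v\<in>V' i. \<forall>u\<in>U'. h v \<noteq> coord e (f u))"
  using J
proof (induction J rule: finite_induct)
  case empty
  show ?case using V U by (intro exI[of _ V] exI[of _ U]) simp
next
  case (insert j J)
  obtain i0 h0 e0 where j: "j = (i0, h0, e0)" by (cases j)
  have i0: "i0 \<in> I" "continuous_map Y X h0" using insert.prems[of i0 h0 e0] j by auto
  obtain V' U' where VU: "\<forall>i\<in>I. openin Y (V' i) \<and> V' i \<subseteq> V i \<and> q i \<in> prod_topology X X closure_of (f ` V' i)"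
    "openin Y U'" "U' \<noteq> {}" "U' \<subseteq> U" and J': "\<forall>(i, h, e)\<in>J. \<forall>v\<in>V' i. \<forall>u\<in>U'. h v \<noteq> coord e (f u)"
    using insert.IH insert.prems by blast
  have V0: "openin Y (V' i0)" "q i0 \<in> prod_topology X X closure_of (f ` V' i0)" using VU(1) i0(1) by auto
  obtain W U'' where W: "openin Y W" "W \<subseteq> V' i0" "q i0 \<in> prod_topology X X closure_of (f ` W)"
    and U'': "openin Y U''" "U'' \<noteq> {}" "U'' \<subseteq> U'" and WU: "\<forall>v\<in>W. \<forall>u\<in>U''. h0 v \<noteq> coord e0 (f u)"
    by (rule avoid_on_smaller_sets[OF P X i0(2) V0 VU(2,3), of e0])
  let ?V = "V'(i0 := W)"
  have sub: "?V i \<subseteq> V' i" for i using W(2) by simp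
  have "\<forall>i\<in>I. openin Y (?V i) \<and> ?V i \<subseteq> V i \<and> q i \<in> prod_topology X X closure_of (f ` ?V i)"
    using VU(1) W by (auto split: if_splits)
  moreover have "\<forall>(i, h, e)\<in>insert j J. \<forall>v\<in>?V i. \<forall>u\<in>U''. h v \<noteq> coord e (f u)"
  proof (intro ballI, clarify)
    fix i h e v u assume a: "(i, h, e) \<in> insert j J" "v \<in> ?V i" "u \<in> U''" "h v = coord e (f u)"
    show False
    proof (cases "(i, h, e) = j")
      case True
      then have "v \<in> W" "h = h0" "e = e0" using a(2) j by auto
      then show False using WU a(3,4) by blast
    next
      case False
      then have "(i, h, e) \<in> J" using a(1) by simp
      then have "\<forall>v\<in>V' i. \<forall>u\<in>U'. h v \<noteq> coord e (f u)" using J' by fast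
      then show False using a(2-4) sub[of i] U''(3) by blast
    qed
  qed
  moreover have "U'' \<subseteq> U" using U''(3) VU(4) by (rule subset_trans)
  ultimately show ?case using U'' by (intro exI[of _ ?V] exI[of _ U''] conjI)
qed

text \<open>The nodes of the construction are the finite sets of natural numbers, written in binary.  The node of an
  initial segment of \<open>\<alpha>\<close> is \<open>code \<alpha> n\<close>, and for \<open>c < 2 ^ i\<close> the node \<open>2 ^ i + c\<close> is the child of \<open>c\<close> which is obtained by
  adding the element \<open>i\<close>.  Thus parents come before their children in the order of the natural numbers.\<close>

primrec code :: "cantor \<Rightarrow> nat \<Rightarrow> nat" where
  "code \<alpha> 0 = 0"
| "code \<alpha> (Suc i) = (if \<alpha> i then 2 ^ i + code \<alpha> i else code \<alpha> i)"

lemma code_less: "code \<alpha> i < 2 ^ i"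
  by (induction i) auto

lemma code_inject: "code \<alpha> n = code \<beta> n \<Longrightarrow> k < n \<Longrightarrow> \<alpha> k = \<beta> k"
proof (induction n arbitrary: k)
  case (Suc n)
  have "\<alpha> n = \<beta> n \<and> code \<alpha> n = code \<beta> n"
    using Suc.prems(1) code_less[of \<alpha> n] code_less[of \<beta> n] by (auto split: if_splits)
  then show ?case using Suc.IH Suc.prems(2) by (auto simp: less_Suc_eq)
qed simp

lemma code_cong: "(\<And>k. k < n \<Longrightarrow> \<alpha> k = \<beta> k) \<Longrightarrow> code \<alpha> n = code \<beta> n"
  by (induction n) auto

lemma code_const: "i \<le> j \<Longrightarrow> (\<And>k. i \<le> k \<Longrightarrow> k < j \<Longrightarrow> \<not> \<alpha> k) \<Longrightarrow> code \<alpha> j = code \<alpha> i"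
  by (induction j rule: dec_induct) auto

lemma top_bit_unique:
  assumes "2 ^ i + c = 2 ^ j + c'" "c < 2 ^ i" "c' < (2 :: nat) ^ j"
  shows "i = j \<and> c = c'"
proof -
  have *: False if "i < j" "2 ^ i + c = 2 ^ j + c'" "c < 2 ^ i" for i j c c' :: nat
  proof -
    have "(2 :: nat) ^ Suc i \<le> 2 ^ j" using that(1) by (intro power_increasing) auto
    then show False using that by simp
  qed
  have "i = j" using *[of i j c c'] *[of j i c' c] assms by (metis linorder_neqE_nat)
  then show ?thesis using assms(1) by simp
qed

lemma top_bit_exists:
  assumes "(m :: nat) > 0"
  obtains i c where "m = 2 ^ i + c" "c < 2 ^ i"
proof -
  obtain i where i: "2 ^ i \<le> m" "m < 2 ^ (i + 1)" using ex_power_ivl1[of 2 m] assms by auto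
  then show ?thesis using that[of i "m - 2 ^ i"] by auto
qed

lemma topspace_cantor [simp]: "topspace cantor_top = UNIV"
  by (simp add: cantor_top_def)

lemma openin_cylinder: "openin cantor_top {\<beta>. \<forall>k<n. \<beta> k = \<alpha> k}"
proof -
  have "{\<beta> :: cantor. \<forall>k<n. \<beta> k = \<alpha> k} = (\<Pi>\<^sub>E k\<in>UNIV. if k < n then {\<alpha> k} else UNIV)"
    by (auto simp: PiE_iff split: if_splits)
  also have "openin cantor_top \<dots>" unfolding cantor_top_def
  proof (rule product_topology_basis)
    have "{k. (if k < n then {\<alpha> k} else UNIV) \<noteq> topspace (discrete_topology (UNIV :: bool set))} \<subseteq> {..<n}"
      by auto
    then show "finite {k. (if k < n then {\<alpha> k} else UNIV) \<noteq> topspace (discrete_topology (UNIV :: bool set))}"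
      by (rule finite_subset) simp
  qed auto
  finally show ?thesis .
qed

text \<open>Node \<open>i\<close> is created at stage \<open>i\<close>, with a point \<open>q i\<close> of \<open>Q\<close> and an open set \<open>V i i\<close> whose image accumulates at \<open>q i\<close>.  At
  later stages \<open>n\<close> only the set \<open>V n i\<close> is available for the creation of further children of \<open>i\<close>; it shrinks with \<open>n\<close>, but its
  image still accumulates at \<open>q i\<close>.  When the node \<open>n + 1\<close> is created, the sets of all
  earlier nodes shrink so that \<open>hs k\<close> maps them away from the image of the new set, for all \<open>k \<le> n\<close>.  The child of \<open>c\<close> by the element
  \<open>i\<close> is chosen close to \<open>q c\<close>, the closer the larger \<open>i\<close> is.\<close>

lemma fusion_scheme:
  fixes Y :: "'y topology" and X :: "'a topology"
  assumes P: "presents Y X R f" and X: "metrizable_space X" and YM: "Y = Metric_space.mtopology M d" "Metric_space M d"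
    and ZM: "prod_topology X X = Metric_space.mtopology N D" "Metric_space N D"
    and hs: "\<And>k :: nat. continuous_map Y X (hs k)"
    and Q: "accumulates Y (prod_topology X X) f Q"
  obtains V :: "nat \<Rightarrow> nat \<Rightarrow> 'y set" and q :: "nat \<Rightarrow> 'a \<times> 'a" where
    "\<forall>n i. i \<le> n \<longrightarrow> openin Y (V n i) \<and> q i \<in> prod_topology X X closure_of (f ` V n i)"
    "\<forall>i. q i \<in> Q" "inj q"
    "\<forall>n n' i. i \<le> n \<longrightarrow> n \<le> n' \<longrightarrow> V n' i \<subseteq> V n i"
    "\<forall>n i c. Suc n = 2 ^ i + c \<longrightarrow> c < 2 ^ i \<longrightarrow>
        Y closure_of (V (Suc n) (Suc n)) \<subseteq> V n c \<and>
        f ` V (Suc n) (Suc n) \<subseteq> Metric_space.mball N D (q c) (1 / Suc i)"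
    "\<forall>n. \<exists>x. V (Suc n) (Suc n) \<subseteq> Metric_space.mball M d x (1 / Suc n)"
    "\<forall>n i k e v u. i \<le> n \<longrightarrow> k \<le> n \<longrightarrow> v \<in> V (Suc n) i \<longrightarrow> u \<in> V (Suc n) (Suc n) \<longrightarrow> hs k v \<noteq> coord e (f u)"
proof -
  let ?Z = "prod_topology X X"
  interpret YM: Metric_space M d by (rule YM(2))
  interpret ZM: Metric_space N D by (rule ZM(2))
  have HX: "Hausdorff_space X" and rX: "regular_space X"
    using X by (rule metrizable_imp_Hausdorff_space, rule metrizable_imp_regular_space)
  define Inv where "Inv n S \<longleftrightarrow> (\<forall>i\<le>n. openin Y (fst S i) \<and> snd S i \<in> ?Z closure_of (f ` fst S i) \<and> snd S i \<in> Q) \<and>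
     inj_on (snd S) {..n}" for n :: nat and S :: "(nat \<Rightarrow> 'y set) \<times> (nat \<Rightarrow> 'a \<times> 'a)"
  define Nxt where "Nxt n S S' \<longleftrightarrow> (\<forall>i\<le>n. fst S' i \<subseteq> fst S i \<and> snd S' i = snd S i) \<and>
     (\<forall>i c. Suc n = 2 ^ i + c \<longrightarrow> c < 2 ^ i \<longrightarrow> Y closure_of (fst S' (Suc n)) \<subseteq> fst S c \<and>
        f ` fst S' (Suc n) \<subseteq> ZM.mball (snd S c) (1 / Suc i)) \<and>
     (\<exists>x. fst S' (Suc n) \<subseteq> YM.mball x (1 / Suc n)) \<and>
     (\<forall>i\<le>n. \<forall>k\<le>n. \<forall>e. \<forall>v\<in>fst S' i. \<forall>u\<in>fst S' (Suc n). hs k v \<noteq> coord e (f u))"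
     for n :: nat and S S' :: "(nat \<Rightarrow> 'y set) \<times> (nat \<Rightarrow> 'a \<times> 'a)"
  have "\<exists>S. \<forall>n. Inv n (S n) \<and> Nxt n (S n) (S (Suc n))"
  proof (rule dependent_nat_choice)
    obtain b where "b \<in> Q" "b \<in> ?Z closure_of (f ` topspace Y)"
      using accumulatesD[OF Q openin_topspace presentsD(2)[OF P]] by blast
    then show "\<exists>S. Inv 0 S" unfolding Inv_def by (intro exI[of _ "(\<lambda>_. topspace Y, \<lambda>_. b)"]) simp
  next
    fix S n assume I: "Inv n S"
    define V where "V = fst S"
    define q where "q = snd S"
    have V: "\<And>i. i \<in> {..n} \<Longrightarrow> openin Y (V i) \<and> q i \<in> ?Z closure_of (f ` V i)" and qQ: "\<And>i. i \<le> n \<Longrightarrow> q i \<in> Q"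
      and qinj: "inj_on q {..n}" using I unfolding Inv_def V_def q_def by auto
    obtain i c where ic: "Suc n = 2 ^ i + c" "c < 2 ^ i" by (rule top_bit_exists[of "Suc n"]) auto
    have cn: "c \<le> n" using ic by (metis Suc_leI add_less_cancel_right add_0 less_Suc_eq_le zero_less_numeral zero_less_power)
    let ?W = "V c \<inter> {y \<in> topspace Y. f y \<in> ZM.mball (q c) (1 / Suc i)}"
    have qc: "q c \<in> ?Z closure_of (f ` V c)" "openin Y (V c)" using V cn by auto
    have "openin ?Z (ZM.mball (q c) (1 / Suc i))" by (simp add: ZM(1))
    moreover have "q c \<in> ZM.mball (q c) (1 / Suc i)"
    proof -
      have "q c \<in> topspace ?Z" using subsetD[OF closure_of_subset_topspace qc(1)] .
      then have "q c \<in> N" by (simp only: ZM(1) ZM.topspace_mtopology)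
      then show ?thesis by simp
    qed
    ultimately obtain y where y: "y \<in> ?W" using closure_of_meets[OF qc(1)] openin_subset[OF qc(2)] by blast
    have "openin Y ?W"
      by (intro openin_Int qc(2) openin_continuous_map_preimage[OF presentsD(3)[OF P]]) (simp add: ZM(1))
    then obtain r where r: "r > 0" "YM.mball y r \<subseteq> ?W" "y \<in> M" using y unfolding YM(1) YM.openin_mtopology by blast
    define \<epsilon> where "\<epsilon> = min (r / 2) (1 / Suc n)"
    have e: "\<epsilon> > 0" "\<epsilon> < r" "\<epsilon> \<le> 1 / Suc n" using r(1) by (auto simp: \<epsilon>_def)
    define U where "U = YM.mball y \<epsilon>"
    have U: "openin Y U" "U \<noteq> {}" using e r(3) by (auto simp: U_def YM(1))
    have clU: "Y closure_of U \<subseteq> V c"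
    proof -
      have "Y closure_of U \<subseteq> YM.mcball y \<epsilon>" unfolding YM(1) U_def
        by (intro closure_of_minimal YM.mball_subset_mcball) simp
      also have "\<dots> \<subseteq> YM.mball y r" using e(2) by (rule YM.mcball_subset_mball_concentric)
      finally show ?thesis using r(2) by blast
    qed
    have fU: "f ` U \<subseteq> ZM.mball (q c) (1 / Suc i)"
    proof -
      have "U \<subseteq> YM.mball y r" unfolding U_def using e(2) by (intro YM.mball_subset_concentric) simp
      then show ?thesis using r(2) by blast
    qed
    let ?J = "{..n} \<times> hs ` {..n} \<times> (UNIV :: bool set)"
    have "\<exists>V' U'. (\<forall>i\<in>{..n}. openin Y (V' i) \<and> V' i \<subseteq> V i \<and> q i \<in> ?Z closure_of (f ` V' i)) \<and>
      openin Y U' \<and> U' \<noteq> {} \<and> U' \<subseteq> U \<and> (\<forall>(i, h, e)\<in>?J. \<forall>v\<in>V' i. \<forall>u\<in>U'. h v \<noteq> coord e (f u))"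
      by (rule avoid_on_smaller_sets_finite[OF P HX rX _ _ V U]) (use hs in auto)
    then obtain V' U' where V': "\<forall>i\<in>{..n}. openin Y (V' i) \<and> V' i \<subseteq> V i \<and> q i \<in> ?Z closure_of (f ` V' i)"
      and U': "openin Y U'" "U' \<noteq> {}" "U' \<subseteq> U" and J: "\<forall>(i, h, e)\<in>?J. \<forall>v\<in>V' i. \<forall>u\<in>U'. h v \<noteq> coord e (f u)"
      by (elim exE conjE)
    have "negligible_along Y ?Z f (\<Union>i\<in>{..n}. {b. coord False b = coord False (q i)})"
      by (intro negligible_along_UN negligible_along_coord[OF P HX]) simp
    from accumulatesD[OF accumulates_Diff[OF Q this] U'(1,2)]
    obtain b where b': "b \<in> Q - (\<Union>i\<in>{..n}. {b. coord False b = coord False (q i)})" "b \<in> ?Z closure_of (f ` U')"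
      by (rule bexE)
    then have b: "b \<in> Q" "\<And>i. i \<le> n \<Longrightarrow> b \<noteq> q i" "b \<in> ?Z closure_of (f ` U')" by auto
    define S' where "S' = (V'(Suc n := U'), q(Suc n := b))"
    have "Inv (Suc n) S'" unfolding Inv_def
    proof (intro conjI allI impI)
      fix i assume i: "i \<le> Suc n"
      show "openin Y (fst S' i)" "snd S' i \<in> ?Z closure_of f ` fst S' i" "snd S' i \<in> Q"
        using V' U' b(1,3) qQ i unfolding S'_def by (auto simp: le_Suc_eq)
    next
      have "inj_on (q(Suc n := b)) {..Suc n}"
        unfolding atMost_Suc using qinj b(2) by (auto simp: inj_on_def)
      then show "inj_on (snd S') {..Suc n}" by (simp add: S'_def)
    qed
    moreover have "Nxt n S S'" unfolding Nxt_def V_def[symmetric] q_def[symmetric]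
    proof (intro conjI allI impI ballI)
      fix i assume i: "i \<le> n"
      show "fst S' i \<subseteq> V i" "snd S' i = q i" using V' i unfolding S'_def by auto
    next
      fix i' c' assume ic': "Suc n = 2 ^ i' + c'" "c' < 2 ^ i'"
      have "2 ^ i' + c' = 2 ^ i + c" using ic(1) ic'(1) by linarith
      from top_bit_unique[OF this ic'(2) ic(2)] have "i' = i" "c' = c" by blast+
      moreover have "Y closure_of U' \<subseteq> Y closure_of U" using U'(3) by (rule closure_of_mono)
      ultimately show "Y closure_of fst S' (Suc n) \<subseteq> V c'" "f ` fst S' (Suc n) \<subseteq> ZM.mball (q c') (1 / Suc i')"
        using clU order_trans[OF image_mono[OF U'(3)] fU] unfolding S'_def by (simp_all add: subset_trans)
    next
      have "U \<subseteq> YM.mball y (1 / Suc n)" unfolding U_def using e(3) by (rule YM.mball_subset_concentric)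
      then show "\<exists>x. fst S' (Suc n) \<subseteq> YM.mball x (1 / Suc n)" using U'(3) unfolding S'_def by auto
    next
      fix i k e v u assume "i \<le> n" "k \<le> n" "v \<in> fst S' i" "u \<in> fst S' (Suc n)"
      then have "(i, hs k, e) \<in> ?J" and vu: "v \<in> V' i" "u \<in> U'" unfolding S'_def by auto
      from bspec[OF J this(1)] have "\<forall>v\<in>V' i. \<forall>u\<in>U'. hs k v \<noteq> coord e (f u)" by simp
      then show "hs k v \<noteq> coord e (f u)" using vu by simp
    qed
    ultimately show "\<exists>S'. Inv (Suc n) S' \<and> Nxt n S S'" by blast
  qed
  then obtain S where Inv: "\<And>n. Inv n (S n)" and Nxt: "\<And>n. Nxt n (S n) (S (Suc n))" by blast
  define V where "V n = fst (S n)" for n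
  define q where "q n = snd (S n) n" for n
  have mono: "V n' i \<subseteq> V n i \<and> snd (S n') i = snd (S n) i" if "i \<le> n" "n \<le> n'" for n n' i
    using that(2)
  proof (induction n' rule: dec_induct)
    case (step m)
    have "fst (S (Suc m)) i \<subseteq> fst (S m) i \<and> snd (S (Suc m)) i = snd (S m) i"
      using Nxt[of m] step(1) that(1) unfolding Nxt_def by auto
    then show ?case using step.IH unfolding V_def by auto
  qed simp
  have qS: "snd (S n) i = q i" if "i \<le> n" for n i unfolding q_def using mono[OF le_refl that] by simp
  show thesis
  proof (rule that[of V q]; (intro allI impI)?)
    show "openin Y (V n i) \<and> q i \<in> ?Z closure_of (f ` V n i)" if "i \<le> n" for n i
      using Inv[of n] that qS[OF that] unfolding Inv_def V_def by metis
    show "q i \<in> Q" for i using Inv[of i] unfolding Inv_def q_def by blast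
    show "inj q"
    proof (rule injI)
      fix i j assume ij: "q i = q j"
      have "inj_on (snd (S (max i j))) {..max i j}" using Inv unfolding Inv_def by blast
      moreover have "snd (S (max i j)) i = snd (S (max i j)) j" using ij qS by simp
      ultimately show "i = j" by (auto dest: inj_onD)
    qed
    show "V n' i \<subseteq> V n i" if "i \<le> n" "n \<le> n'" for n n' i using mono[OF that] by blast
    show "Y closure_of (V (Suc n) (Suc n)) \<subseteq> V n c \<and> f ` V (Suc n) (Suc n) \<subseteq> ZM.mball (q c) (1 / Suc i)"
      if ic: "Suc n = 2 ^ i + c" "c < 2 ^ i" for n i c
    proof -
      have "c \<le> n" using ic by (metis Suc_leI add_less_cancel_right add_0 less_Suc_eq_le zero_less_numeral zero_less_power)
      then show ?thesis using Nxt[of n] ic qS unfolding Nxt_def V_def by metis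
    qed
    show "\<exists>x. V (Suc n) (Suc n) \<subseteq> YM.mball x (1 / Suc n)" for n using Nxt[of n] unfolding Nxt_def V_def by blast
    show "hs k v \<noteq> coord e (f u)" if "i \<le> n" "k \<le> n" "v \<in> V (Suc n) i" "u \<in> V (Suc n) (Suc n)" for n i k e v u
      using Nxt[of n] that unfolding Nxt_def V_def by blast
  qed
qed


text \<open>A sequence with finitely many ones is sent to the point of \<open>Q\<close> at its node, and a sequence with
  infinitely many ones is sent to the value of \<open>f\<close> at the limit of the sets along its branch.  The map is continuous
  since all nodes which extend an initial segment of length \<open>i\<close> are close to the point of \<open>Q\<close> at this
  segment (\<open>near\<close>).  Consider two branches \<open>\<alpha>\<close> and \<open>\<beta>\<close>, and a late node \<open>m\<close> on \<open>\<alpha>\<close>.  When \<open>m\<close> is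
  created, the last node on \<open>\<beta>\<close> before \<open>m\<close> shrinks its set, and \<open>\<beta>\<close> continues inside the smaller set.  So \<open>h\<close> maps the limit
  of \<open>\<beta>\<close> away from the limit of \<open>\<alpha>\<close>.\<close>

lemma cantor_copy:
  fixes Y :: "'y topology" and X :: "'a topology"
  assumes P: "presents Y X R f" and X: "metrizable_space X"
    and H: "countable H" "\<And>h. h \<in> H \<Longrightarrow> continuous_map Y X h"
    and Q: "accumulates Y (prod_topology X X) f Q"
  obtains \<phi> :: "cantor \<Rightarrow> 'a \<times> 'a" and \<psi> :: "cantor \<Rightarrow> 'y" where
    "continuous_map cantor_top (prod_topology X X) \<phi>"
    "\<forall>\<alpha>. \<alpha> \<notin> P_infinity \<longrightarrow> \<phi> \<alpha> \<in> Q" "inj_on \<phi> (UNIV - P_infinity)"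
    "\<forall>\<alpha>\<in>P_infinity. \<psi> \<alpha> \<in> topspace Y \<and> \<phi> \<alpha> = f (\<psi> \<alpha>)"
    "\<forall>\<alpha>\<in>P_infinity. \<forall>\<beta>\<in>P_infinity. \<forall>h\<in>H. \<forall>e. \<alpha> \<noteq> \<beta> \<longrightarrow> h (\<psi> \<beta>) \<noteq> coord e (f (\<psi> \<alpha>))"
proof -
  let ?Z = "prod_topology X X"
  obtain M d where YM: "Y = Metric_space.mtopology M d" "Metric_space M d" and mc: "Metric_space.mcomplete M d"
    using presentsD(1)[OF P] by (auto simp: polish_space_def completely_metrizable_space_def)
  obtain N D where ZM: "?Z = Metric_space.mtopology N D" "Metric_space N D"
    using X metrizable_space_prod_topology[of X X] by (metis metrizable_space_def)
  interpret YM: Metric_space M d by (rule YM(2))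
  interpret ZM: Metric_space N D by (rule ZM(2))
  define h0 where "h0 = (\<lambda>y. coord False (f y))"
  define hs where "hs = from_nat_into (insert h0 H)"
  have rhs: "range hs = insert h0 H" unfolding hs_def using H(1) by (intro range_from_nat_into) auto
  have hs: "continuous_map Y X (hs k)" for k
  proof -
    have "hs k \<in> insert h0 H" unfolding rhs[symmetric] by simp
    then show ?thesis using H(2) presentsD(7)[OF P, of False] unfolding h0_def by auto
  qed
  obtain V :: "nat \<Rightarrow> nat \<Rightarrow> 'y set" and q :: "nat \<Rightarrow> 'a \<times> 'a" where
    V': "\<forall>n i. i \<le> n \<longrightarrow> openin Y (V n i) \<and> q i \<in> ?Z closure_of (f ` V n i)"
    and qQ': "\<forall>i. q i \<in> Q" and injq: "inj q"
    and mono': "\<forall>n n' i. i \<le> n \<longrightarrow> n \<le> n' \<longrightarrow> V n' i \<subseteq> V n i"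
    and child0: "\<forall>n i c. Suc n = 2 ^ i + c \<longrightarrow> c < 2 ^ i \<longrightarrow>
        Y closure_of (V (Suc n) (Suc n)) \<subseteq> V n c \<and> f ` V (Suc n) (Suc n) \<subseteq> ZM.mball (q c) (1 / Suc i)"
    and small': "\<forall>n. \<exists>x. V (Suc n) (Suc n) \<subseteq> YM.mball x (1 / Suc n)"
    and avoid': "\<forall>n i k e v u. i \<le> n \<longrightarrow> k \<le> n \<longrightarrow> v \<in> V (Suc n) i \<longrightarrow> u \<in> V (Suc n) (Suc n) \<longrightarrow> hs k v \<noteq> coord e (f u)"
    by (rule fusion_scheme[OF P X YM ZM, of hs, OF hs Q])
  note V = V'[rule_format] and qQ = qQ'[rule_format] and mono = mono'[rule_format] and child = child0[rule_format]
    and small = small'[rule_format] and avoid = avoid'[rule_format]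
  define c where "c n = V n n" for n
  have oc: "openin Y (c n)" and qc: "q n \<in> ?Z closure_of (f ` c n)" for n using V[of n n] by (auto simp: c_def)
  have child': "Y closure_of (c (2 ^ i + a)) \<subseteq> V (2 ^ i + a - 1) a" "f ` c (2 ^ i + a) \<subseteq> ZM.mball (q a) (1 / Suc i)"
    "a \<le> 2 ^ i + a - 1" if "a < 2 ^ i" for i a
  proof -
    have "Suc (2 ^ i + a - 1) = 2 ^ i + a" by simp
    from child[OF this that] show "Y closure_of (c (2 ^ i + a)) \<subseteq> V (2 ^ i + a - 1) a"
      "f ` c (2 ^ i + a) \<subseteq> ZM.mball (q a) (1 / Suc i)" by (simp_all add: c_def)
    have "(2::nat) ^ i \<ge> 1" by simp
    then show "a \<le> 2 ^ i + a - 1" by linarith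
  qed
  have clc: "c n \<subseteq> Y closure_of (c n)" for n by (rule closure_of_subset[OF openin_subset[OF oc]])
  have csub: "Y closure_of c (2 ^ i + a) \<subseteq> c a" if "a < 2 ^ i" for i a
    using child'(1,3)[OF that] mono[of a a "2 ^ i + a - 1"] unfolding c_def by blast
  have cSuc: "c (code \<alpha> (Suc i)) \<subseteq> c (code \<alpha> i)" for \<alpha> i
    using csub[OF code_less[of \<alpha> i]] clc by auto
  have canti: "c (code \<alpha> j) \<subseteq> c (code \<alpha> i)" if "i \<le> j" for \<alpha> i j
    using that by (induction j rule: dec_induct) (use cSuc in blast)+
  have cne: "c n \<noteq> {}" for n using qc[of n] by auto
  have "\<exists>y. \<forall>i. y \<in> c (code \<alpha> i)" if \<alpha>: "\<alpha> \<in> P_infinity" for \<alpha>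
  proof -
    have inf: "\<exists>j\<ge>i. \<alpha> j" for i
      using \<alpha> unfolding P_infinity_def infinite_nat_iff_unbounded_le by auto
    have "\<Inter> (range (\<lambda>i. Y closure_of (c (code \<alpha> i)))) \<noteq> {}"
    proof (rule YM.mcomplete_nest[THEN iffD1, OF mc, rule_format], intro conjI allI impI)
      show "closedin YM.mtopology (Y closure_of c (code \<alpha> n))" for n by (simp add: YM(1))
      show "Y closure_of c (code \<alpha> n) \<noteq> {}" for n using cne clc by blast
      show "decseq (\<lambda>i. Y closure_of c (code \<alpha> i))"
        unfolding decseq_Suc_iff by (intro allI closure_of_mono cSuc)
      fix e :: real assume "e > 0"
      then obtain n where n: "1 / Suc n < e" using nat_approx_posE by blast
      obtain j where j: "j \<ge> Suc n" "\<alpha> j" using inf by blast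
      have "j < (2 :: nat) ^ j" by (rule less_exp)
      then obtain m where m: "code \<alpha> (Suc j) = Suc m" "n \<le> m"
      proof -
        have "Suc n \<le> 2 ^ j" using j(1) \<open>j < 2 ^ j\<close> by linarith
        then have "code \<alpha> (Suc j) \<ge> Suc n" using j(2) by simp
        then show thesis using that by (cases "code \<alpha> (Suc j)") auto
      qed
      obtain x where x: "V (Suc m) (Suc m) \<subseteq> YM.mball x (1 / Suc m)" using small by blast
      have "1 / real (Suc m) \<le> 1 / Suc n" using m(2) by (intro divide_left_mono) auto
      then have le: "1 / Suc m \<le> e" using n by linarith
      have "Y closure_of c (code \<alpha> (Suc j)) \<subseteq> YM.mcball x e" unfolding YM(1)
      proof (rule closure_of_minimal)
        show "c (code \<alpha> (Suc j)) \<subseteq> YM.mcball x e"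
          using x YM.mball_subset_concentric[OF le, of x] YM.mball_subset_mcball[of x e] unfolding m(1) c_def by blast
      qed simp
      then show "\<exists>n a. Y closure_of c (code \<alpha> n) \<subseteq> YM.mcball a e" by blast
    qed
    then obtain y where y: "\<And>i. y \<in> Y closure_of (c (code \<alpha> i))" by blast
    have "y \<in> c (code \<alpha> i)" for i
    proof -
      obtain j where j: "j \<ge> i" "\<alpha> j" using inf by blast
      have "y \<in> Y closure_of (c (2 ^ j + code \<alpha> j))" using y[of "Suc j"] j(2) by simp
      then have "y \<in> c (code \<alpha> j)" using csub[OF code_less] by blast
      then show ?thesis using canti[OF j(1)] by blast
    qed
    then show ?thesis by blast
  qed
  then obtain \<psi> where psi: "\<And>\<alpha> i. \<alpha> \<in> P_infinity \<Longrightarrow> \<psi> \<alpha> \<in> c (code \<alpha> i)" by metis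
  define top where "top \<alpha> = (LEAST n. \<forall>k\<ge>n. \<not> \<alpha> k)" for \<alpha> :: cantor
  have top: "\<not> \<alpha> k" if "\<alpha> \<notin> P_infinity" "k \<ge> top \<alpha>" for \<alpha> k
  proof -
    have "\<exists>n. \<forall>k\<ge>n. \<not> \<alpha> k" using that(1) unfolding P_infinity_def infinite_nat_iff_unbounded_le by auto
    from LeastI_ex[OF this] show ?thesis using that(2) unfolding top_def by blast
  qed
  have code_top: "code \<alpha> n = code \<alpha> (top \<alpha>)" if "\<alpha> \<notin> P_infinity" "n \<ge> top \<alpha>" for \<alpha> n
    using that top[OF that(1)] by (intro code_const) auto
  define \<phi> where "\<phi> \<alpha> = (if \<alpha> \<in> P_infinity then f (\<psi> \<alpha>) else q (code \<alpha> (top \<alpha>)))" for \<alpha>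
  have psiY: "\<psi> \<alpha> \<in> topspace Y" if "\<alpha> \<in> P_infinity" for \<alpha> using psi[OF that, of 0] openin_subset[OF oc] by blast
  have fcl: "f y \<in> ?Z closure_of (f ` c n)" if "y \<in> c n" for y n
  proof -
    have "f ` c n \<subseteq> topspace ?Z"
      using continuous_map_image_subset_topspace[OF presentsD(3)[OF P]] openin_subset[OF oc[of n]] by blast
    then show ?thesis using closure_of_subset[of "f ` c n" ?Z] that by blast
  qed
  have phi_cl: "\<phi> \<alpha> \<in> ?Z closure_of (f ` c (code \<alpha> i))" for \<alpha> i
  proof (cases "\<alpha> \<in> P_infinity")
    case True
    then show ?thesis using fcl[OF psi[OF True]] by (simp add: \<phi>_def)
  next
    case False
    have "code \<alpha> (max i (top \<alpha>)) = code \<alpha> (top \<alpha>)" by (rule code_top[OF False]) simp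
    then have "c (code \<alpha> (top \<alpha>)) \<subseteq> c (code \<alpha> i)" using canti[of i "max i (top \<alpha>)" \<alpha>] by simp
    then have "?Z closure_of (f ` c (code \<alpha> (top \<alpha>))) \<subseteq> ?Z closure_of (f ` c (code \<alpha> i))"
      by (intro closure_of_mono image_mono)
    then show ?thesis using False qc[of "code \<alpha> (top \<alpha>)"] by (auto simp: \<phi>_def)
  qed
  have qN: "q n \<in> N" for n
    using subsetD[OF closure_of_subset_topspace qc[of n]] by (simp only: ZM(1) ZM.topspace_mtopology)
  have near: "\<phi> \<alpha> \<in> ZM.mcball (q (code \<alpha> i)) (1 / Suc i)" for \<alpha> i
  proof (cases "\<exists>j\<ge>i. \<alpha> j")
    case True
    define j where "j = (LEAST j. j \<ge> i \<and> \<alpha> j)"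
    have j: "j \<ge> i \<and> \<alpha> j" using True unfolding j_def by (rule LeastI_ex)
    have "\<not> \<alpha> k" if "i \<le> k" "k < j" for k using not_less_Least[of k "\<lambda>j. j \<ge> i \<and> \<alpha> j"] that unfolding j_def by blast
    then have cj: "code \<alpha> j = code \<alpha> i" using j by (intro code_const) auto
    have "f ` c (code \<alpha> (Suc j)) \<subseteq> ZM.mball (q (code \<alpha> j)) (1 / Suc j)"
      using child'(2)[OF code_less[of \<alpha> j]] j by simp
    also have "\<dots> \<subseteq> ZM.mcball (q (code \<alpha> i)) (1 / Suc i)"
      unfolding cj using j by (intro order_trans[OF ZM.mball_subset_mcball] ZM.mcball_subset_concentric divide_left_mono) auto
    finally have "?Z closure_of (f ` c (code \<alpha> (Suc j))) \<subseteq> ZM.mcball (q (code \<alpha> i)) (1 / Suc i)"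
      unfolding ZM(1) by (intro closure_of_minimal) simp_all
    then show ?thesis using phi_cl by blast
  next
    case False
    then have nP: "\<alpha> \<notin> P_infinity" unfolding P_infinity_def infinite_nat_iff_unbounded_le by auto
    have "code \<alpha> (max i (top \<alpha>)) = code \<alpha> i" using False by (intro code_const) auto
    moreover have "code \<alpha> (max i (top \<alpha>)) = code \<alpha> (top \<alpha>)" by (rule code_top[OF nP]) simp
    ultimately have "\<phi> \<alpha> = q (code \<alpha> i)" using nP by (simp add: \<phi>_def)
    then show ?thesis using qN by simp
  qed
  show thesis
  proof (rule that[of \<phi> \<psi>])
    show "continuous_map cantor_top ?Z \<phi>"
      unfolding continuous_map_def
    proof (intro conjI allI impI)
      show "\<phi> \<in> topspace cantor_top \<rightarrow> topspace ?Z"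
        by (intro Pi_I) (rule subsetD[OF closure_of_subset_topspace phi_cl])
      fix W assume W: "openin ?Z W"
      show "openin cantor_top {\<alpha> \<in> topspace cantor_top. \<phi> \<alpha> \<in> W}"
      proof (subst openin_subopen, intro ballI)
        fix \<alpha> assume "\<alpha> \<in> {\<alpha> \<in> topspace cantor_top. \<phi> \<alpha> \<in> W}"
        then have "\<phi> \<alpha> \<in> W" by simp
        then obtain r where r: "r > 0" "ZM.mball (\<phi> \<alpha>) r \<subseteq> W" using W unfolding ZM(1) ZM.openin_mtopology by blast
        obtain i where i: "1 / Suc i < r / 2" using r(1) by (meson half_gt_zero nat_approx_posE)
        define B where "B = {\<beta> :: cantor. \<forall>k<i. \<beta> k = \<alpha> k}"
        have oB: "openin cantor_top B" unfolding B_def by (rule openin_cylinder)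
        have "\<phi> \<beta> \<in> W" if "\<beta> \<in> B" for \<beta>
        proof -
          have "code \<beta> i = code \<alpha> i" using that unfolding B_def by (intro code_cong) auto
          then have "\<phi> \<beta> \<in> ZM.mcball (q (code \<alpha> i)) (1 / Suc i)" "\<phi> \<alpha> \<in> ZM.mcball (q (code \<alpha> i)) (1 / Suc i)"
            using near[of \<beta> i] near[of \<alpha> i] by simp_all
          then have "D (q (code \<alpha> i)) (\<phi> \<beta>) < r / 2" "D (q (code \<alpha> i)) (\<phi> \<alpha>) < r / 2" "\<phi> \<alpha> \<in> N" "\<phi> \<beta> \<in> N" "q (code \<alpha> i) \<in> N"
            using i by (auto simp: ZM.in_mcball)
          then have "\<phi> \<beta> \<in> ZM.mball (\<phi> \<alpha>) r"
            using ZM.triangle[of "\<phi> \<alpha>" "q (code \<alpha> i)" "\<phi> \<beta>"] ZM.commute[of "\<phi> \<alpha>" "q (code \<alpha> i)"] by (simp add: ZM.in_mball)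
          then show ?thesis using r(2) by blast
        qed
        moreover have "\<alpha> \<in> B" unfolding B_def by simp
        moreover have "B \<subseteq> topspace cantor_top" by (rule openin_subset[OF oB])
        ultimately show "\<exists>T. openin cantor_top T \<and> \<alpha> \<in> T \<and> T \<subseteq> {\<alpha> \<in> topspace cantor_top. \<phi> \<alpha> \<in> W}"
          using oB by (intro exI[of _ B]) auto
      qed
    qed
    show "\<forall>\<alpha>. \<alpha> \<notin> P_infinity \<longrightarrow> \<phi> \<alpha> \<in> Q" using qQ by (simp add: \<phi>_def)
    show "inj_on \<phi> (UNIV - P_infinity)"
    proof (rule inj_onI)
      fix \<alpha> \<beta> assume a: "\<alpha> \<in> UNIV - P_infinity" "\<beta> \<in> UNIV - P_infinity" "\<phi> \<alpha> = \<phi> \<beta>"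
      then have "code \<alpha> (top \<alpha>) = code \<beta> (top \<beta>)" using injq by (simp add: \<phi>_def inj_eq)
      then have eq: "code \<alpha> n = code \<beta> n" if "n \<ge> max (top \<alpha>) (top \<beta>)" for n
        using code_top[of \<alpha> n] code_top[of \<beta> n] a(1,2) that by simp
      show "\<alpha> = \<beta>"
      proof
        fix k show "\<alpha> k = \<beta> k"
          by (rule code_inject[OF eq[of "max (Suc k) (max (top \<alpha>) (top \<beta>))"]]) auto
      qed
    qed
    show "\<forall>\<alpha>\<in>P_infinity. \<psi> \<alpha> \<in> topspace Y \<and> \<phi> \<alpha> = f (\<psi> \<alpha>)" using psiY by (simp add: \<phi>_def)
    show "\<forall>\<alpha>\<in>P_infinity. \<forall>\<beta>\<in>P_infinity. \<forall>h\<in>H. \<forall>e. \<alpha> \<noteq> \<beta> \<longrightarrow> h (\<psi> \<beta>) \<noteq> coord e (f (\<psi> \<alpha>))"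
    proof (intro ballI allI impI)
      fix \<alpha> \<beta> h e assume P\<alpha>: "\<alpha> \<in> P_infinity" and P\<beta>: "\<beta> \<in> P_infinity" and h: "h \<in> H" and ne: "\<alpha> \<noteq> \<beta>"
      have "h \<in> range hs" unfolding rhs using h by simp
      then obtain k where k: "h = hs k" by blast
      obtain i0 where i0: "\<alpha> i0 \<noteq> \<beta> i0" using ne by blast
      obtain i where i: "i \<ge> Suc (max i0 k)" "\<alpha> i"
        using P\<alpha> unfolding P_infinity_def infinite_nat_iff_unbounded_le by blast
      define m where "m = 2 ^ i + code \<alpha> i"
      have m: "m = code \<alpha> (Suc i)" using i by (simp add: m_def)
      have "i < (2 :: nat) ^ i" by (rule less_exp)
      then have "k < (2 :: nat) ^ i" using i(1) by linarith
      then have km: "k < m" "m > 0" unfolding m_def by auto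
      \<comment> \<open>\<open>j\<close> is the position at which the branch of \<open>\<beta>\<close> leaves the nodes which precede \<open>m\<close>\<close>
      define j where "j = (LEAST j. code \<beta> (Suc j) \<ge> m)"
      have "\<exists>j. code \<beta> (Suc j) \<ge> m"
      proof -
        obtain j where j: "j \<ge> m" "\<beta> j" using P\<beta> unfolding P_infinity_def infinite_nat_iff_unbounded_le by blast
        have "j < (2 :: nat) ^ j" by (rule less_exp)
        then have "m \<le> 2 ^ j" using j(1) by linarith
        then have "code \<beta> (Suc j) \<ge> m" using j(2) by simp
        then show ?thesis ..
      qed
      then have j1: "code \<beta> (Suc j) \<ge> m" unfolding j_def by (rule LeastI_ex)
      have j0: "code \<beta> j < m"
      proof (cases j)
        case 0
        then show ?thesis using km by simp
      next
        case (Suc j')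
        then have "\<not> code \<beta> (Suc j') \<ge> m" using not_less_Least[of j' "\<lambda>j. code \<beta> (Suc j) \<ge> m"] unfolding j_def by simp
        then show ?thesis using Suc by simp
      qed
      have bj: "\<beta> j" using j0 j1 by (auto split: if_splits)
      have neq: "code \<beta> (Suc j) \<noteq> m"
      proof
        assume "code \<beta> (Suc j) = m"
        then have "2 ^ j + code \<beta> j = 2 ^ i + code \<alpha> i" using bj by (simp add: m_def)
        then have "j = i" "code \<beta> j = code \<alpha> i" using top_bit_unique[OF _ code_less code_less] by blast+
        then have "\<beta> i0 = \<alpha> i0" using code_inject[of \<beta> i \<alpha> i0] i(1) by simp
        then show False using i0 by simp
      qed
      obtain n where n: "m = Suc n" using km(2) by (cases m) auto
      have "\<psi> \<beta> \<in> Y closure_of c (code \<beta> (Suc j))" using psi[OF P\<beta>] clc by blast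
      then have "\<psi> \<beta> \<in> V (code \<beta> (Suc j) - 1) (code \<beta> j)" using child'(1)[OF code_less[of \<beta> j]] bj by auto
      moreover have "V (code \<beta> (Suc j) - 1) (code \<beta> j) \<subseteq> V m (code \<beta> j)"
        using j0 j1 neq by (intro mono) auto
      ultimately have "\<psi> \<beta> \<in> V (Suc n) (code \<beta> j)" using n by blast
      moreover have "\<psi> \<alpha> \<in> V (Suc n) (Suc n)"
        using psi[OF P\<alpha>, of "Suc i"] unfolding m[symmetric] n c_def .
      moreover have "code \<beta> j \<le> n" "k \<le> n" using j0 km(1) n by simp_all
      ultimately show "h (\<psi> \<beta>) \<noteq> coord e (f (\<psi> \<alpha>))" unfolding k by (intro avoid)
    qed
  qed
qed

section \<open>The complexity of \<open>P_infinity\<close> in the Cantor space\<close>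

lemma topspace_D [simp]: "topspace D_top = UNIV"
  by (simp add: D_top_def)

lemma openin_cantor_cylinder:
  assumes "openin cantor_top U" "\<alpha> \<in> U"
  obtains n where "{\<beta>. \<forall>k<n. \<beta> k = \<alpha> k} \<subseteq> U"
proof -
  obtain B where B: "finite {i \<in> UNIV. B i \<noteq> topspace (discrete_topology (UNIV :: bool set))}"
    "\<alpha> \<in> Pi\<^sub>E UNIV B" "Pi\<^sub>E UNIV B \<subseteq> U"
    using assms unfolding cantor_top_def openin_product_topology_alt by blast
  obtain n where n: "\<And>i. B i \<noteq> UNIV \<Longrightarrow> i < n"
    using B(1) finite_nat_set_iff_bounded by auto
  have "{\<beta>. \<forall>k<n. \<beta> k = \<alpha> k} \<subseteq> Pi\<^sub>E UNIV B"
  proof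
    fix \<beta> assume b: "\<beta> \<in> {\<beta>. \<forall>k<n. \<beta> k = \<alpha> k}"
    have "\<beta> k \<in> B k" for k
    proof (cases "B k = UNIV")
      case False
      then have "\<beta> k = \<alpha> k" using n b by simp
      then show ?thesis using B(2) by (auto simp: PiE_iff)
    qed simp
    then show "\<beta> \<in> Pi\<^sub>E UNIV B" by (simp add: PiE_iff)
  qed
  then show ?thesis using B(3) by (rule that[OF subset_trans])
qed

lemma polish_space_cantor: "polish_space cantor_top"
proof (rule polish_spaceI)
  show "completely_metrizable_space cantor_top" unfolding cantor_top_def
    by (subst completely_metrizable_space_product_topology) (auto simp: completely_metrizable_space_discrete_topology)
  let ?B = "(\<lambda>(n, m). {\<beta>. code \<beta> n = m}) ` (UNIV :: (nat \<times> nat) set)"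
  have cyl: "{\<beta>. code \<beta> n = code \<alpha> n} = {\<beta>. \<forall>k<n. \<beta> k = \<alpha> k}" for \<alpha> n
  proof (intro equalityI subsetI CollectI allI impI)
    fix \<beta> k assume "\<beta> \<in> {\<beta>. code \<beta> n = code \<alpha> n}" "k < n"
    then show "\<beta> k = \<alpha> k" by (intro code_inject[of \<beta> n]) simp_all
  next
    fix \<beta> assume "\<beta> \<in> {\<beta>. \<forall>k<n. \<beta> k = \<alpha> k}"
    then show "code \<beta> n = code \<alpha> n" by (intro code_cong) simp
  qed
  show "second_countable cantor_top" unfolding second_countable_def
  proof (intro exI[of _ ?B] conjI ballI allI impI)
    show "countable ?B" by simp
    fix V assume "V \<in> ?B"
    then obtain n m where V: "V = {\<beta>. code \<beta> n = m}" by auto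
    show "openin cantor_top V"
    proof (cases "\<exists>\<alpha>. code \<alpha> n = m")
      case True
      then show ?thesis using cyl openin_cylinder V by auto
    next
      case False
      then have "V = {}" using V by blast
      then show ?thesis by simp
    qed
  next
    fix U \<alpha> assume U: "openin cantor_top U \<and> \<alpha> \<in> U"
    obtain n where "{\<beta>. \<forall>k<n. \<beta> k = \<alpha> k} \<subseteq> U"
      by (rule openin_cantor_cylinder[OF conjunct1[OF U] conjunct2[OF U]])
    then show "\<exists>V\<in>?B. \<alpha> \<in> V \<and> V \<subseteq> U" unfolding cyl[symmetric]
      by (intro bexI[of _ "{\<beta>. code \<beta> n = code \<alpha> n}"]) auto
  qed
qed

lemma polish_space_D: "polish_space D_top"
  unfolding D_top_def
  by (intro polish_space_prod polish_space_cantor polish_spaceI)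
     (simp_all add: completely_metrizable_space_discrete_topology second_countable_discrete_topology)

lemma open_meets_P_infinity:
  assumes U: "openin cantor_top U" "U \<noteq> {}"
  shows "\<exists>\<alpha>\<in>U. \<alpha> \<in> P_infinity" "\<exists>\<alpha>\<in>U. \<alpha> \<notin> P_infinity"
proof -
  obtain \<alpha> where "\<alpha> \<in> U" using U(2) by blast
  obtain n where n: "{\<beta>. \<forall>k<n. \<beta> k = \<alpha> k} \<subseteq> U" by (rule openin_cantor_cylinder[OF U(1) \<open>\<alpha> \<in> U\<close>])
  define \<beta> where "\<beta> b k = (if k < n then \<alpha> k else b)" for b k
  have "\<beta> b \<in> U" for b using n unfolding \<beta>_def by auto
  moreover have "{n..} \<subseteq> {k. \<beta> True k}" unfolding \<beta>_def by auto
  then have "\<beta> True \<in> P_infinity" unfolding P_infinity_def using infinite_Ici infinite_super by blast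
  moreover have "{k. \<beta> False k} \<subseteq> {..<n}" unfolding \<beta>_def by (auto split: if_splits)
  then have "\<beta> False \<notin> P_infinity" unfolding P_infinity_def using finite_subset[OF _ finite_lessThan] by simp
  ultimately show "\<exists>\<alpha>\<in>U. \<alpha> \<in> P_infinity" "\<exists>\<alpha>\<in>U. \<alpha> \<notin> P_infinity" by blast+
qed

lemma countable_complement_P_infinity: "countable (UNIV - P_infinity)"
proof -
  have "inj_on (\<lambda>\<alpha>. {n. \<alpha> n}) (UNIV - P_infinity)" by (intro inj_onI) (auto simp: fun_eq_iff set_eq_iff)
  moreover have "countable ((\<lambda>\<alpha>. {n. \<alpha> n}) ` (UNIV - P_infinity))"
  proof (rule countable_subset)
    show "(\<lambda>\<alpha>. {n. \<alpha> n}) ` (UNIV - P_infinity) \<subseteq> Collect finite" unfolding P_infinity_def by auto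
  qed (rule countable_Collect_finite)
  ultimately show ?thesis by (metis countable_image_inj_on)
qed

lemma closedin_cantor_singleton: "closedin cantor_top {\<alpha>}"
  using polish_space_imp_Hausdorff[OF polish_space_cantor] by (simp add: closedin_Hausdorff_singleton)

lemma fsigma_cantor_countable: "countable K \<Longrightarrow> fsigma_in cantor_top K"
proof -
  assume K: "countable K"
  then have "fsigma_in cantor_top (\<Union>((\<lambda>z. {z}) ` K))"
    by (intro fsigma_in_Union) (auto intro!: closed_imp_fsigma_in closedin_cantor_singleton)
  then show ?thesis by simp
qed

text \<open>Otherwise \<open>U\<close> would be covered by the countable complement of \<open>P_infinity\<close> and by countably many closed subsets
  of \<open>P_infinity\<close>, which have empty interior in \<open>U\<close>.\<close>

lemma not_fsigma_P_infinity:
  assumes U: "openin cantor_top U" "U \<noteq> {}" and F: "fsigma_in cantor_top F" "U \<inter> P_infinity = U \<inter> F"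
  shows False
proof -
  obtain C where C: "\<And>n :: nat. closedin cantor_top (C n)" "\<Union>(range C) = F"
    using F(1) by (auto simp: fsigma_in_ascending)
  have sing: "cantor_top interior_of {\<alpha>} = {}" for \<alpha>
  proof (rule ccontr)
    assume "cantor_top interior_of {\<alpha>} \<noteq> {}"
    from open_meets_P_infinity[OF openin_interior_of this] show False
      using interior_of_subset[of cantor_top "{\<alpha>}"] by (metis singletonD subsetD)
  qed
  have "\<exists>n. cantor_top interior_of (C n) \<inter> U \<noteq> {}"
  proof (rule ccontr)
    assume n: "\<not> ?thesis"
    have "meager_in cantor_top ((\<Union>n. C n - cantor_top interior_of (C n)) \<union> (\<Union>\<alpha>\<in>UNIV - P_infinity. {\<alpha>}))"
    proof (intro meager_in_Un meager_in_UN countable_complement_P_infinity)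
      show "meager_in cantor_top {\<alpha>}" for \<alpha> by (rule meager_in_closed[OF closedin_cantor_singleton sing])
      show "meager_in cantor_top (C n - cantor_top interior_of (C n))" for n
        using nowhere_dense_frontier_closure[of cantor_top "C n"] C(1)[of n] by (simp add: closure_of_closedin)
    qed simp
    moreover have "U \<subseteq> (\<Union>n. C n - cantor_top interior_of (C n)) \<union> (\<Union>\<alpha>\<in>UNIV - P_infinity. {\<alpha>})"
    proof
      fix \<alpha> assume a: "\<alpha> \<in> U"
      show "\<alpha> \<in> (\<Union>n. C n - cantor_top interior_of (C n)) \<union> (\<Union>\<alpha>\<in>UNIV - P_infinity. {\<alpha>})"
      proof (cases "\<alpha> \<in> P_infinity")
        case True
        then obtain m where "\<alpha> \<in> C m" using a F(2) C(2) by blast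
        then show ?thesis using n a by blast
      qed blast
    qed
    ultimately have "meager_in cantor_top U" by (rule meager_in_subset)
    then show False using not_meager_open[OF polish_space_cantor U] by blast
  qed
  then obtain n where n: "cantor_top interior_of (C n) \<inter> U \<noteq> {}" by blast
  moreover have "openin cantor_top (cantor_top interior_of (C n) \<inter> U)" by (intro openin_Int openin_interior_of U(1))
  ultimately obtain \<alpha> where "\<alpha> \<in> cantor_top interior_of (C n) \<inter> U" "\<alpha> \<notin> P_infinity"
    using open_meets_P_infinity(2) by blast
  then show False using interior_of_subset[of cantor_top "C n"] C(2) F(2) by blast
qed

lemma fsigma_S_sec: "j \<noteq> 0 \<Longrightarrow> fsigma_in cantor_top (S_sec j)"
  using fsigma_in_topspace[of cantor_top] by (auto simp: S_sec_def fsigma_cantor_countable countable_complement_P_infinity)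

lemma S_sec_iff: "\<alpha> \<in> S_sec j \<longleftrightarrow> (if \<alpha> \<in> P_infinity then j \<noteq> 1 \<and> j \<noteq> 2 else j \<noteq> 0 \<and> j \<noteq> 1)"
  by (auto simp: S_sec_def)

lemma in_R_rel: "((e, \<alpha>), (e', \<beta>)) \<in> R_rel t \<longleftrightarrow> \<alpha> = \<beta> \<and> \<alpha> \<in> S_sec (t (e, e'))"
  by (auto simp: R_rel_def)

lemma R_rel_iff: "(z, z') \<in> R_rel t \<longleftrightarrow> snd z = snd z' \<and> snd z \<in> S_sec (t (fst z, fst z'))"
  by (cases z; cases z') (simp add: in_R_rel)

section \<open>Reductions, copies, and membership of the examples in the classes\<close>

lemma reduces_via_iff:
  "reduces_via f (X, A) (Y, B) \<longleftrightarrow> continuous_map X Y f \<and>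
     A = {(x, y) \<in> topspace X \<times> topspace X. (f x, f y) \<in> B}"
  by (simp add: reduces_via_def)

lemma reduces_via_compose:
  assumes "reduces_via f (X, A) (Y, B)" "reduces_via g (Y, B) (Z, C)"
  shows "reduces_via (g \<circ> f) (X, A) (Z, C)"
  using assms continuous_map_compose[of X Y f Z g] continuous_map_image_subset_topspace[of X Y f]
  unfolding reduces_via_iff by auto

lemma le_c_trans:
  assumes "XA \<le>\<^sub>c YB" "YB \<le>\<^sub>c ZC"
  shows "XA \<le>\<^sub>c ZC"
proof -
  obtain X A Y B Z C where "XA = (X, A)" "YB = (Y, B)" "ZC = (Z, C)" by (meson surj_pair)
  then show ?thesis using assms reduces_via_compose[of _ X A Y B _ Z C] unfolding le_c_def by blast
qed

lemma emb_c_trans: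
  assumes "XA \<sqsubseteq>\<^sub>c YB" "YB \<sqsubseteq>\<^sub>c ZC"
  shows "XA \<sqsubseteq>\<^sub>c ZC"
proof -
  obtain X A Y B Z C where eq: "XA = (X, A)" "YB = (Y, B)" "ZC = (Z, C)" by (meson surj_pair)
  obtain f g where f: "inj_on f (topspace X)" "reduces_via f (X, A) (Y, B)"
    and g: "inj_on g (topspace Y)" "reduces_via g (Y, B) (Z, C)"
    using assms unfolding emb_c_def eq by auto
  have "f ` topspace X \<subseteq> topspace Y"
    using f(2) continuous_map_image_subset_topspace unfolding reduces_via_iff by blast
  then have "inj_on (g \<circ> f) (topspace X)" using f(1) g(1) by (meson comp_inj_on inj_on_subset)
  then show ?thesis using reduces_via_compose[OF f(2) g(2)] unfolding emb_c_def eq by auto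
qed

lemma emb_c_imp_le_c: "XA \<sqsubseteq>\<^sub>c YB \<Longrightarrow> XA \<le>\<^sub>c YB"
  unfolding emb_c_def le_c_def by blast

lemma copy_along_equivalent:
  assumes h: "inj_on h (topspace X)" and A: "A \<subseteq> topspace X \<times> topspace X"
  shows "(X, A) \<sqsubseteq>\<^sub>c copy_along h (X, A)" "copy_along h (X, A) \<sqsubseteq>\<^sub>c (X, A)"
    "X homeomorphic_space fst (copy_along h (X, A))"
    "snd (copy_along h (X, A)) \<subseteq> topspace (fst (copy_along h (X, A))) \<times> topspace (fst (copy_along h (X, A)))"
proof -
  obtain Y B where YB: "copy_along h (X, A) = (Y, B)" by (cases "copy_along h (X, A)")
  have B: "B = map_prod h h ` A" using YB by (simp add: copy_along_def)
  have hm: "homeomorphic_map X Y h" using homeomorphic_map_copy_along[OF h, of A] YB by simp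
  then obtain g where g: "homeomorphic_maps X Y h g" by (auto simp: homeomorphic_map_maps)
  have g': "continuous_map X Y h" "continuous_map Y X g" "\<And>x. x \<in> topspace X \<Longrightarrow> g (h x) = x"
    "\<And>y. y \<in> topspace Y \<Longrightarrow> h (g y) = y" using g by (auto simp: homeomorphic_maps_def)
  have hY: "h x \<in> topspace Y" if "x \<in> topspace X" for x
    using continuous_map_image_subset_topspace[OF g'(1)] that by blast
  have gX: "g y \<in> topspace X" if "y \<in> topspace Y" for y
    using continuous_map_image_subset_topspace[OF g'(2)] that by blast
  have inB: "(h x, h y) \<in> B \<longleftrightarrow> (x, y) \<in> A" if "x \<in> topspace X" "y \<in> topspace X" for x y
  proof
    assume "(h x, h y) \<in> B"
    then obtain u v where uv: "(u, v) \<in> A" "h u = h x" "h v = h y" unfolding B by auto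
    then have "u = x" "v = y" using h A that by (auto dest: inj_onD)
    then show "(x, y) \<in> A" using uv by simp
  qed (auto simp: B)
  have "reduces_via h (X, A) (Y, B)" unfolding reduces_via_iff using g'(1) inB A by auto
  then show "(X, A) \<sqsubseteq>\<^sub>c copy_along h (X, A)" unfolding YB emb_c_def using h by auto
  show BY: "snd (copy_along h (X, A)) \<subseteq> topspace (fst (copy_along h (X, A))) \<times> topspace (fst (copy_along h (X, A)))"
    unfolding YB using A hY by (auto simp: B)
  have "reduces_via g (Y, B) (X, A)" unfolding reduces_via_iff
  proof (intro conjI g'(2) set_eqI iffI)
    fix z assume z: "z \<in> B"
    obtain x y where xy: "z = (x, y)" by (cases z)
    then have Y: "x \<in> topspace Y" "y \<in> topspace Y" using BY z unfolding YB by auto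
    then have "(g x, g y) \<in> A" using inB[OF gX gX, of x y] g'(4) z xy by simp
    then show "z \<in> {(x, y) \<in> topspace Y \<times> topspace Y. (g x, g y) \<in> A}" using Y xy by simp
  next
    fix z assume z: "z \<in> {(x, y) \<in> topspace Y \<times> topspace Y. (g x, g y) \<in> A}"
    obtain x y where xy: "z = (x, y)" by (cases z)
    then show "z \<in> B" using z inB[OF gX gX, of x y] g'(4) by auto
  qed
  moreover have "inj_on g (topspace Y)" using g'(4) by (metis inj_on_inverseI)
  ultimately show "copy_along h (X, A) \<sqsubseteq>\<^sub>c (X, A)" unfolding YB emb_c_def by auto
  show "X homeomorphic_space fst (copy_along h (X, A))" unfolding YB
    using hm by (auto simp: homeomorphic_space)
qed

lemma analytic_space_homeomorphic:
  assumes "X homeomorphic_space Y" "analytic_space X"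
  shows "analytic_space Y"
  using assms homeomorphic_space_trans[of Y X] homeomorphic_space_sym[of X Y]
    homeomorphic_separable_space[of X Y] homeomorphic_metrizable_space[of X Y]
  unfolding analytic_space_def by meson

lemma polish_space_homeomorphic: "X homeomorphic_space Y \<Longrightarrow> polish_space X \<Longrightarrow> polish_space Y"
  using homeomorphic_separable_space homeomorphic_completely_metrizable_space unfolding polish_space_def by blast

lemma polish_imp_analytic_space:
  fixes j :: "'a \<Rightarrow> nat \<Rightarrow> nat"
  assumes X: "polish_space X" and j: "inj_on j (topspace X)"
  shows "analytic_space X"
proof -
  define Y where "Y = fst (copy_along j (X, {}))"
  have h: "X homeomorphic_space Y" unfolding Y_def by (rule copy_along_equivalent(3)[OF j]) simp
  have Y: "polish_space Y" by (rule polish_space_homeomorphic[OF h X])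
  have "analytic_in Y (topspace Y)" unfolding analytic_in_def
    using Y by (intro conjI exI[of _ Y] exI[of _ id]) auto
  then show ?thesis using X Y h unfolding analytic_space_def
    by (metis polish_space_def polish_space_imp_metrizable subtopology_topspace)
qed

lemma analytic_space_cantor: "analytic_space cantor_top"
proof (rule polish_imp_analytic_space[OF polish_space_cantor])
  show "inj_on (\<lambda>\<alpha> n. if \<alpha> n then 1 else 0 :: nat) (topspace cantor_top)"
    by (intro inj_onI) (auto simp: fun_eq_iff split: if_splits)
qed

lemma analytic_space_D: "analytic_space D_top"
proof (rule polish_imp_analytic_space[OF polish_space_D])
  define j where "j z = case_nat (of_bool (fst z)) (\<lambda>m. of_bool (snd z m) :: nat)" for z :: "bool \<times> cantor"
  show "inj_on j (topspace D_top)"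
  proof (rule inj_onI)
    fix z z' assume eq: "j z = j z'"
    have "fst z = fst z'" using fun_cong[OF eq, of 0] by (cases "fst z"; cases "fst z'") (simp_all add: j_def)
    moreover have "snd z m = snd z' m" for m using fun_cong[OF eq, of "Suc m"]
      by (cases "snd z m"; cases "snd z' m") (simp_all add: j_def)
    ultimately show "z = z'" by (auto simp: prod_eq_iff)
  qed
qed

text \<open>All requirements except the lower bound on complexity are inherited along injective reductions,
  and the lower bound is inherited in the other direction.\<close>

lemma s_acyclic_relations_transfer:
  assumes an: "analytic_space X" and A: "A \<subseteq> topspace X \<times> topspace X"
    and emb: "(X, A) \<sqsubseteq>\<^sub>c (Y, B)" and B: "borel_in (prod_topology Y Y) B" "locally_countable (Y, B)" "s_acyclic B"
    and nF: "\<not> fsigma_in (prod_topology X X) A"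
  shows "(X, A) \<in> s_acyclic_relations"
proof -
  obtain f where f: "inj_on f (topspace X)" "continuous_map X Y f"
    "A = {(x, y) \<in> topspace X \<times> topspace X. (f x, f y) \<in> B}"
    using emb unfolding emb_c_def reduces_via_iff by auto
  have fY: "f x \<in> topspace Y" if "x \<in> topspace X" for x
    using continuous_map_image_subset_topspace[OF f(2)] that by blast
  have "continuous_map (prod_topology X X) (prod_topology Y Y) (\<lambda>z. (f (fst z), f (snd z)))"
    by (intro continuous_map_pairedI continuous_map_compose[OF continuous_map_fst f(2), unfolded o_def]
        continuous_map_compose[OF continuous_map_snd f(2), unfolded o_def])
  from borel_in_preimage[OF this B(1)] have "borel_in (prod_topology X X) A"
    by (rule back_subst[of "borel_in (prod_topology X X)"]) (auto simp: f(3))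
  moreover have "locally_countable (X, A)" unfolding locally_countable_def
  proof (simp, intro ballI conjI)
    fix x assume x: "x \<in> topspace X"
    have c: "countable (B `` {f x})" "countable (B\<inverse> `` {f x})"
      using B(2) fY[OF x] unfolding locally_countable_def by auto
    have "A `` {x} \<subseteq> {y \<in> topspace X. f y \<in> B `` {f x}}" "A\<inverse> `` {x} \<subseteq> {y \<in> topspace X. f y \<in> B\<inverse> `` {f x}}"
      using f(3) by auto
    moreover have "countable {y \<in> topspace X. f y \<in> K}" if "countable K" for K
    proof (rule countable_image_inj_on)
      show "countable (f ` {y \<in> topspace X. f y \<in> K})" by (rule countable_subset[OF _ that]) auto
      show "inj_on f {y \<in> topspace X. f y \<in> K}" by (rule inj_on_subset[OF f(1)]) auto
    qed
    ultimately show "countable (A `` {x})" "countable (A\<inverse> `` {x})" using c countable_subset by metis+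
  qed
  moreover have "s_acyclic A" unfolding s_acyclic_def acyclic_rel_def
  proof (intro notI, elim exE conjE)
    fix n x assume x: "n \<ge> (2 :: nat)" "rel_path (symmetrization A) n x" "inj_on x {..n}" "(x n, x 0) \<in> symmetrization A"
    have sA: "u \<in> topspace X \<and> v \<in> topspace X \<and> (f u, f v) \<in> symmetrization B" if "(u, v) \<in> symmetrization A" for u v
      using that f(3) unfolding symmetrization_def by auto
    have xX: "x ` {..n} \<subseteq> topspace X"
    proof
      fix u assume "u \<in> x ` {..n}"
      then obtain i where i: "i \<le> n" "u = x i" by auto
      show "u \<in> topspace X"
      proof (cases "i = n")
        case True
        then show ?thesis using sA[OF x(4)] i by simp
      next
        case False
        then have "(x i, x (Suc i)) \<in> symmetrization A" using x(2) i unfolding rel_path_def by simp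
        then show ?thesis using sA i by blast
      qed
    qed
    have "rel_path (symmetrization B) n (f \<circ> x)" using x(2) sA unfolding rel_path_def by simp
    moreover have "inj_on (f \<circ> x) {..n}" using x(3) f(1) xX by (meson comp_inj_on inj_on_subset)
    moreover have "((f \<circ> x) n, (f \<circ> x) 0) \<in> symmetrization B" using sA[OF x(4)] by simp
    ultimately show False using B(3) x(1) unfolding s_acyclic_def acyclic_rel_def by blast
  qed
  ultimately show ?thesis using an A nF
    unfolding s_acyclic_relations_def non_Sigma02_lc_borel_def by simp
qed

lemma not_fsigma_of_le_c:
  assumes "(X, A) \<le>\<^sub>c (Y, B)" "\<not> fsigma_in (prod_topology X X) A"
  shows "\<not> fsigma_in (prod_topology Y Y) B"
proof
  assume F: "fsigma_in (prod_topology Y Y) B"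
  obtain f where f: "continuous_map X Y f" "A = {(x, y) \<in> topspace X \<times> topspace X. (f x, f y) \<in> B}"
    using assms(1) unfolding le_c_def reduces_via_iff by auto
  have "continuous_map (prod_topology X X) (prod_topology Y Y) (\<lambda>z. (f (fst z), f (snd z)))"
    by (intro continuous_map_pairedI continuous_map_compose[OF continuous_map_fst f(1), unfolded o_def]
        continuous_map_compose[OF continuous_map_snd f(1), unfolded o_def])
  from fsigma_in_preimage[OF this F] have "fsigma_in (prod_topology X X) A"
    by (rule back_subst[of "fsigma_in (prod_topology X X)"]) (auto simp: f(2))
  with assms(2) show False by simp
qed

lemma copy_along_s_acyclic_relations:
  assumes h: "inj_on h (topspace X)" and XA: "(X, A) \<in> s_acyclic_relations"
  shows "copy_along h (X, A) \<in> s_acyclic_relations"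
proof -
  have X: "analytic_space X" "A \<subseteq> topspace X \<times> topspace X" "borel_in (prod_topology X X) A"
    "\<not> fsigma_in (prod_topology X X) A" "locally_countable (X, A)" "s_acyclic A"
    using XA unfolding s_acyclic_relations_def non_Sigma02_lc_borel_def by auto
  obtain Y B where YB: "copy_along h (X, A) = (Y, B)" by (cases "copy_along h (X, A)")
  note c = copy_along_equivalent[OF h X(2), unfolded YB, simplified]
  show ?thesis unfolding YB
    using s_acyclic_relations_transfer[OF analytic_space_homeomorphic[OF c(3) X(1)] c(4) c(2) X(3,5,6)]
      not_fsigma_of_le_c[OF emb_c_imp_le_c[OF c(1)] X(4)] by blast
qed

lemma fsigma_imp_borel_in:
  assumes "fsigma_in X F"
  shows "borel_in X F"
proof -
  obtain C where C: "\<And>n :: nat. closedin X (C n)" "\<Union>(range C) = F"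
    using assms by (auto simp: fsigma_in_ascending)
  have "C n \<in> sigma_sets (topspace X) {U. openin X U}" for n
  proof -
    have "topspace X - (topspace X - C n) \<in> sigma_sets (topspace X) {U. openin X U}"
      using C(1)[of n] by (intro sigma_sets.Compl sigma_sets.Basic) (auto simp: closedin_def)
    then show ?thesis using closedin_subset[OF C(1)[of n]] by (simp add: double_diff)
  qed
  then show ?thesis unfolding borel_in_def C(2)[symmetric] by (rule sigma_sets.Union)
qed

lemma borel_in_Int:
  assumes "borel_in X A" "borel_in X B"
  shows "borel_in X (A \<inter> B)"
proof -
  interpret sigma_algebra "topspace X" "sigma_sets (topspace X) {U. openin X U}"
    by (rule sigma_algebra_sigma_sets) (auto dest: openin_subset)
  show ?thesis using assms unfolding borel_in_def by (rule Int)
qed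

text \<open>The relation is contained in the union of the squares of the fibres \<open>{(False, \<alpha>), (True, \<alpha>)}\<close>.\<close>

lemma R_rel_properties:
  shows "borel_in (prod_topology D_top D_top) (R_rel t)" "locally_countable (D_top, R_rel t)" "s_acyclic (R_rel t)"
proof -
  let ?P = "prod_topology D_top D_top"
  have c1: "continuous_map ?P cantor_top (\<lambda>z. snd (fst z))" "continuous_map ?P cantor_top (\<lambda>z. snd (snd z))"
    "continuous_map ?P (discrete_topology UNIV) (\<lambda>z. fst (fst z))" "continuous_map ?P (discrete_topology UNIV) (\<lambda>z. fst (snd z))"
    using continuous_map_compose[OF continuous_map_fst[of D_top D_top], of cantor_top snd]
      continuous_map_compose[OF continuous_map_snd[of D_top D_top], of cantor_top snd]
      continuous_map_compose[OF continuous_map_fst[of D_top D_top], of "discrete_topology UNIV" fst]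
      continuous_map_compose[OF continuous_map_snd[of D_top D_top], of "discrete_topology UNIV" fst]
    by (simp_all add: D_top_def o_def continuous_map_fst continuous_map_snd)
  have SB: "borel_in cantor_top (S_sec j)" for j
  proof (cases "j = 0")
    case True
    have "borel_in cantor_top (UNIV - P_infinity)"
      by (intro fsigma_imp_borel_in fsigma_cantor_countable countable_complement_P_infinity)
    then have "topspace cantor_top - (UNIV - P_infinity) \<in> sigma_sets (topspace cantor_top) {U. openin cantor_top U}"
      unfolding borel_in_def by (rule sigma_sets.Compl)
    moreover have "topspace cantor_top - (UNIV - P_infinity) = S_sec j" using True by (auto simp: S_sec_def)
    ultimately show ?thesis unfolding borel_in_def by simp
  next
    case False
    then show ?thesis by (intro fsigma_imp_borel_in fsigma_S_sec)
  qed
  define piece where "piece i = {z \<in> topspace ?P. snd (fst z) \<in> S_sec (t i)} \<inter>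
     ({z \<in> topspace ?P. snd (fst z) = snd (snd z)} \<inter> ({z \<in> topspace ?P. fst (fst z) \<in> {fst i}} \<inter>
      {z \<in> topspace ?P. fst (snd z) \<in> {snd i}}))" for i
  have pB: "borel_in ?P (piece i)" for i unfolding piece_def
  proof (intro borel_in_Int)
    show "borel_in ?P {z \<in> topspace ?P. snd (fst z) \<in> S_sec (t i)}" by (rule borel_in_preimage[OF c1(1) SB])
    have "closedin ?P {z \<in> topspace ?P. snd (fst z) = snd (snd z)}"
      by (rule closedin_continuous_maps_eq[OF polish_space_imp_Hausdorff[OF polish_space_cantor] c1(1,2)])
    then show "borel_in ?P {z \<in> topspace ?P. snd (fst z) = snd (snd z)}"
      by (intro fsigma_imp_borel_in closed_imp_fsigma_in)
    show "borel_in ?P {z \<in> topspace ?P. fst (fst z) \<in> {fst i}}"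
      unfolding borel_in_def by (intro sigma_sets.Basic CollectI openin_continuous_map_preimage[OF c1(3)]) simp
    show "borel_in ?P {z \<in> topspace ?P. fst (snd z) \<in> {snd i}}"
      unfolding borel_in_def by (intro sigma_sets.Basic CollectI openin_continuous_map_preimage[OF c1(4)]) simp
  qed
  have "R_rel t = (\<Union>i\<in>UNIV. piece i)"
  proof -
    have "z \<in> R_rel t \<longleftrightarrow> z \<in> piece (fst (fst z), fst (snd z))" for z
      using in_R_rel[of "fst (fst z)" "snd (fst z)" "fst (snd z)" "snd (snd z)" t] by (auto simp: piece_def)
    moreover have "i = (fst (fst z), fst (snd z))" if "z \<in> piece i" for z i
      using that by (simp add: piece_def prod_eq_iff)
    ultimately show ?thesis by blast
  qed
  also have "\<dots> = piece (False, False) \<union> (piece (False, True) \<union> (piece (True, False) \<union> piece (True, True)))"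
    by (auto simp: UNIV_bool UNIV_Times_UNIV[symmetric] simp del: UNIV_Times_UNIV)
  also have "borel_in ?P \<dots>" using pB unfolding borel_in_def by (intro sigma_sets_Un)
  finally show "borel_in ?P (R_rel t)" .
  show "locally_countable (D_top, R_rel t)" unfolding locally_countable_def
  proof (simp, intro allI conjI)
    fix e \<alpha>
    have "R_rel t `` {(e, \<alpha>)} \<subseteq> {(False, \<alpha>), (True, \<alpha>)}" by (auto simp: R_rel_def)
    then show "countable (R_rel t `` {(e, \<alpha>)})" by (rule countable_subset) simp
    have "(R_rel t)\<inverse> `` {(e, \<alpha>)} \<subseteq> {(False, \<alpha>), (True, \<alpha>)}" by (auto simp: R_rel_def)
    then show "countable ((R_rel t)\<inverse> `` {(e, \<alpha>)})" by (rule countable_subset) simp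
  qed
  show "s_acyclic (R_rel t)" unfolding s_acyclic_def acyclic_rel_def
  proof (intro notI, elim exE conjE)
    fix n x assume x: "n \<ge> (2 :: nat)" "rel_path (symmetrization (R_rel t)) n x" "inj_on x {..n}"
    have s: "snd u = snd v" if "(u, v) \<in> symmetrization (R_rel t)" for u v
      using that by (auto simp: symmetrization_def R_rel_def)
    have "(x 0, x (Suc 0)) \<in> symmetrization (R_rel t)" "(x (Suc 0), x (Suc (Suc 0))) \<in> symmetrization (R_rel t)"
      using x(1,2) unfolding rel_path_def by auto
    then have "snd (x 0) = snd (x 1)" "snd (x 1) = snd (x 2)" using s by (simp_all add: numeral_2_eq_2)
    moreover have "x 0 \<noteq> x 1" "x 1 \<noteq> x 2" "x 0 \<noteq> x 2" using x(1,3) by (auto dest: inj_onD)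
    ultimately show False by (auto simp: prod_eq_iff)
  qed
qed


lemma continuous_map_level: "continuous_map cantor_top D_top (\<lambda>\<alpha>. (e, \<alpha>))"
  unfolding D_top_def by (intro continuous_map_pairedI) simp_all

lemma R_rel_not_fsigma:
  assumes t: "t (e, e') = 0"
  shows "\<not> fsigma_in (prod_topology D_top D_top) (R_rel t)"
proof
  assume F: "fsigma_in (prod_topology D_top D_top) (R_rel t)"
  have "continuous_map cantor_top (prod_topology D_top D_top) (\<lambda>\<alpha>. ((e, \<alpha>), (e', \<alpha>)))"
    by (intro continuous_map_pairedI continuous_map_level)
  from fsigma_in_preimage[OF this F] have "fsigma_in cantor_top {\<alpha> \<in> topspace cantor_top. ((e, \<alpha>), (e', \<alpha>)) \<in> R_rel t}" .
  moreover have "{\<alpha> \<in> topspace cantor_top. ((e, \<alpha>), (e', \<alpha>)) \<in> R_rel t} = P_infinity"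
    using t by (auto simp: in_R_rel S_sec_iff split: if_splits)
  ultimately show False
    using not_fsigma_P_infinity[of UNIV P_infinity] openin_topspace[of cantor_top] by simp
qed

lemma R_rel_s_acyclic_relations:
  assumes "t (e, e') = 0"
  shows "(D_top, R_rel t) \<in> s_acyclic_relations"
  unfolding s_acyclic_relations_def non_Sigma02_lc_borel_def
  using R_rel_properties[of t] R_rel_not_fsigma[of t e e', OF assms] analytic_space_D by simp

lemma Id_on_s_acyclic_relations: "(cantor_top, Id_on P_infinity) \<in> s_acyclic_relations"
proof (rule s_acyclic_relations_transfer[OF analytic_space_cantor _ _ R_rel_properties[of "\<lambda>_. 0"]])
  have "reduces_via (\<lambda>\<alpha>. (False, \<alpha>)) (cantor_top, Id_on P_infinity) (D_top, R_rel (\<lambda>_. 0))"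
    unfolding reduces_via_iff using continuous_map_level[of False] by (auto simp: in_R_rel S_sec_iff split: if_splits)
  moreover have "inj (\<lambda>\<alpha> :: cantor. (False, \<alpha>))" by (intro injI) simp
  ultimately show "(cantor_top, Id_on P_infinity) \<sqsubseteq>\<^sub>c (D_top, R_rel (\<lambda>_. 0))" unfolding emb_c_def by auto
  show "\<not> fsigma_in (prod_topology cantor_top cantor_top) (Id_on P_infinity)"
  proof
    assume F: "fsigma_in (prod_topology cantor_top cantor_top) (Id_on P_infinity)"
    have "continuous_map cantor_top (prod_topology cantor_top cantor_top) (\<lambda>\<alpha>. (\<alpha>, \<alpha>))"
      by (intro continuous_map_pairedI) simp_all
    from fsigma_in_preimage[OF this F] have "fsigma_in cantor_top {\<alpha> \<in> topspace cantor_top. (\<alpha>, \<alpha>) \<in> Id_on P_infinity}" .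
    then have "fsigma_in cantor_top P_infinity" by (simp add: Id_on_def)
    then show False
      using not_fsigma_P_infinity[of UNIV P_infinity] openin_topspace[of cantor_top] by simp
  qed
qed simp

section \<open>The examples are pairwise incomparable\<close>

lemma P_codesD:
  assumes "t \<in> P_codes"
  shows "t (False, False) \<noteq> 0" "t (True, True) \<noteq> 0" "t (False, True) = 0" "t z \<le> 3"
    "t (True, False) = 0 \<Longrightarrow> t (False, False) \<le> t (True, True)"
proof -
  have "t z \<in> {0, 1, 2, 3}" using assms unfolding P_codes_def by blast
  then show "t z \<le> 3" by auto
qed (use assms in \<open>auto simp: P_codes_def\<close>)

text \<open>The sections other than \<open>S_sec 0\<close> are F-sigma, and so are their preimages.\<close>

lemma S_sec_reduction_trivial:
  assumes U: "openin cantor_top U" "U \<noteq> {}" and \<pi>: "continuous_map cantor_top cantor_top \<pi>"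
    and eq: "\<And>\<alpha>. \<alpha> \<in> U \<Longrightarrow> \<alpha> \<in> P_infinity \<longleftrightarrow> \<pi> \<alpha> \<in> S_sec j"
  shows "j = 0"
proof (rule ccontr)
  assume "j \<noteq> 0"
  from fsigma_in_preimage[OF \<pi> fsigma_S_sec[OF this]] have "fsigma_in cantor_top {\<alpha>. \<pi> \<alpha> \<in> S_sec j}" by simp
  moreover have "U \<inter> P_infinity = U \<inter> {\<alpha>. \<pi> \<alpha> \<in> S_sec j}" using eq by blast
  ultimately show False using not_fsigma_P_infinity[OF U] by blast
qed

lemma S_sec_determined:
  assumes U: "openin cantor_top U" "U \<noteq> {}"
    and P: "\<And>\<alpha>. \<alpha> \<in> U \<Longrightarrow> \<alpha> \<in> P_infinity \<longleftrightarrow> \<pi> \<alpha> \<in> P_infinity"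
    and S: "\<And>\<alpha>. \<alpha> \<in> U \<Longrightarrow> \<alpha> \<in> S_sec i \<longleftrightarrow> \<pi> \<alpha> \<in> S_sec j"
    and ij: "i \<le> 3" "j \<le> 3"
  shows "i = j"
proof -
  obtain \<alpha> \<beta> where a: "\<alpha> \<in> U" "\<alpha> \<in> P_infinity" "\<beta> \<in> U" "\<beta> \<notin> P_infinity" using open_meets_P_infinity[OF U] by blast
  have "(i \<noteq> 1 \<and> i \<noteq> 2) = (j \<noteq> 1 \<and> j \<noteq> 2)" using S[OF a(1)] P[OF a(1)] a(2) by (simp add: S_sec_iff)
  moreover have "(i \<noteq> 0 \<and> i \<noteq> 1) = (j \<noteq> 0 \<and> j \<noteq> 1)" using S[OF a(3)] P[OF a(3)] a(4) by (simp add: S_sec_iff)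
  ultimately show ?thesis using ij by presburger
qed

lemma discrete_component_locally_constant:
  assumes "continuous_map cantor_top (discrete_topology UNIV) e"
  shows "openin cantor_top {\<alpha>. e \<alpha> = b}"
  using openin_continuous_map_preimage[OF assms, of "{b}"] by simp

lemma D_components:
  assumes "continuous_map cantor_top D_top g"
  shows "continuous_map cantor_top (discrete_topology UNIV) (\<lambda>\<alpha>. fst (g \<alpha>))"
    "continuous_map cantor_top cantor_top (\<lambda>\<alpha>. snd (g \<alpha>))"
  using continuous_map_compose[OF assms, of "discrete_topology UNIV" fst] continuous_map_compose[OF assms, of cantor_top snd]
  by (simp_all add: D_top_def o_def continuous_map_fst continuous_map_snd)

lemma agree_on_P_infinity:
  assumes Y: "Hausdorff_space Y" and f: "continuous_map cantor_top Y f" and g: "continuous_map cantor_top Y g"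
    and eq: "\<And>\<alpha>. \<alpha> \<in> P_infinity \<Longrightarrow> f \<alpha> = g \<alpha>"
  shows "f \<alpha> = g \<alpha>"
proof (rule ccontr)
  assume ne: "f \<alpha> \<noteq> g \<alpha>"
  have "closedin cantor_top {\<alpha> \<in> topspace cantor_top. f \<alpha> = g \<alpha>}" by (rule closedin_continuous_maps_eq[OF Y f g])
  then have "openin cantor_top (UNIV - {\<alpha>. f \<alpha> = g \<alpha>})" by (simp add: closedin_def)
  moreover have "UNIV - {\<alpha>. f \<alpha> = g \<alpha>} \<noteq> {}" using ne by blast
  ultimately obtain \<beta> where "f \<beta> \<noteq> g \<beta>" "\<beta> \<in> P_infinity" using open_meets_P_infinity(1) by blast
  then show False using eq by blast
qed

text \<open>The points \<open>(False, \<alpha>)\<close> and \<open>(True, \<alpha>)\<close> are related for \<open>\<alpha> \<in> P_infinity\<close>, hence a reduction \<open>f\<close> maps both into the same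
  fibre, and by density this holds for all \<open>\<alpha>\<close>.  On some nonempty open set \<open>U\<close> their first coordinates are
  constant, with values \<open>s False\<close> and \<open>s True\<close>.  Therefore \<open>P_infinity\<close> reduces on \<open>U\<close> to the section of \<open>t'\<close> at \<open>(s False, s True)\<close>, which
  must be \<open>S_sec 0\<close>.  So \<open>s\<close> is a bijection, and \<open>t\<close> arises from \<open>t'\<close> by applying \<open>s\<close> to the arguments.  If \<open>s\<close> is
  the exchange of the two values, then both relations have \<open>S_sec 0\<close> off the diagonal, and the
  normalization in \<open>P_codes\<close> gives equality.\<close>

lemma R_rel_le_c_imp_eq:
  assumes t: "t \<in> P_codes" and t': "t' \<in> P_codes" and le: "(D_top, R_rel t) \<le>\<^sub>c (D_top, R_rel t')"
  shows "t = t'"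
proof -
  obtain f where f: "continuous_map D_top D_top f"
    and R: "R_rel t = {(x, y). (f x, f y) \<in> R_rel t'}"
    using le unfolding le_c_def reduces_via_iff by auto
  have cont: "continuous_map cantor_top D_top (\<lambda>\<alpha>. f (e, \<alpha>))" for e
    using continuous_map_compose[OF continuous_map_level f] by (simp add: o_def)
  note comp = D_components[OF cont]
  have iff: "\<alpha> \<in> S_sec (t (e, e')) \<longleftrightarrow> snd (f (e, \<alpha>)) = snd (f (e', \<alpha>)) \<and>
      snd (f (e, \<alpha>)) \<in> S_sec (t' (fst (f (e, \<alpha>)), fst (f (e', \<alpha>))))" for \<alpha> e e'
  proof -
    have "\<alpha> \<in> S_sec (t (e, e')) \<longleftrightarrow> ((e, \<alpha>), (e', \<alpha>)) \<in> R_rel t" by (simp add: in_R_rel)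
    also have "\<dots> \<longleftrightarrow> (f (e, \<alpha>), f (e', \<alpha>)) \<in> R_rel t'" by (subst R) simp
    finally show ?thesis using in_R_rel[of "fst (f (e, \<alpha>))" "snd (f (e, \<alpha>))" "fst (f (e', \<alpha>))" "snd (f (e', \<alpha>))" t'] by simp
  qed
  define \<pi> where "\<pi> \<alpha> = snd (f (False, \<alpha>))" for \<alpha>
  have \<pi>: "continuous_map cantor_top cantor_top \<pi>" unfolding \<pi>_def by (rule comp(2))
  have "snd (f (False, \<alpha>)) = snd (f (True, \<alpha>))" if "\<alpha> \<in> P_infinity" for \<alpha>
    using iff[of \<alpha> False True] P_codesD(3)[OF t] that by (simp add: S_sec_iff)
  then have "snd (f (False, \<alpha>)) = snd (f (True, \<alpha>))" for \<alpha>
    by (rule agree_on_P_infinity[OF polish_space_imp_Hausdorff[OF polish_space_cantor] comp(2) comp(2)])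
  then have snd: "snd (f (e, \<alpha>)) = \<pi> \<alpha>" for e \<alpha> by (cases e) (simp_all add: \<pi>_def)
  define s where "s e = fst (f (e, \<lambda>_. False))" for e
  define U where "U = {\<alpha>. fst (f (False, \<alpha>)) = s False} \<inter> {\<alpha>. fst (f (True, \<alpha>)) = s True}"
  have U: "openin cantor_top U" "U \<noteq> {}"
  proof -
    show "openin cantor_top U" unfolding U_def
      by (intro openin_Int discrete_component_locally_constant comp(1))
    have "(\<lambda>_. False) \<in> U" by (simp add: U_def s_def)
    then show "U \<noteq> {}" by blast
  qed
  have key: "\<alpha> \<in> S_sec (t (e, e')) \<longleftrightarrow> \<pi> \<alpha> \<in> S_sec (t' (s e, s e'))" if "\<alpha> \<in> U" for \<alpha> e e'
  proof -
    have "fst (f (d, \<alpha>)) = s d" for d using that by (cases d) (auto simp: U_def)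
    then show ?thesis using iff[of \<alpha> e e'] snd by simp
  qed
  have "\<alpha> \<in> P_infinity \<longleftrightarrow> \<pi> \<alpha> \<in> S_sec (t' (s False, s True))" if "\<alpha> \<in> U" for \<alpha>
    using key[OF that, of False True] P_codesD(3)[OF t] by (simp add: S_sec_def)
  from S_sec_reduction_trivial[OF U \<pi> this] have "t' (s False, s True) = 0" .
  then have st: "(\<not> s False \<and> s True) \<or> (s False \<and> \<not> s True \<and> t' (True, False) = 0)"
    using P_codesD(1,2)[OF t'] by (cases "s False"; cases "s True") auto
  have P: "\<alpha> \<in> P_infinity \<longleftrightarrow> \<pi> \<alpha> \<in> P_infinity" if "\<alpha> \<in> U" for \<alpha>
    using key[OF that, of False True] P_codesD(3)[OF t] \<open>t' (s False, s True) = 0\<close> by (simp add: S_sec_def)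
  have tt: "t (e, e') = t' (s e, s e')" for e e'
    by (rule S_sec_determined[OF U P key P_codesD(4)[OF t] P_codesD(4)[OF t']])
  show ?thesis
  proof (rule ext)
    fix z :: "bool \<times> bool"
    obtain e e' where z: "z = (e, e')" by (cases z)
    from st show "t z = t' z"
    proof
      assume "\<not> s False \<and> s True"
      then have "s d = d" for d by (cases d) auto
      then show ?thesis using tt z by simp
    next
      assume a: "s False \<and> \<not> s True \<and> t' (True, False) = 0"
      then have s: "s d = (\<not> d)" for d by (cases d) auto
      have "t (True, False) = 0" using tt[of True False] s P_codesD(3)[OF t'] by simp
      then have "t (False, False) \<le> t (True, True)" "t' (False, False) \<le> t' (True, True)"
        using P_codesD(5) t t' a by blast+
      then show ?thesis
        using tt[of False False] tt[of True True] \<open>t (True, False) = 0\<close> a s P_codesD(3)[OF t] P_codesD(3)[OF t'] z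
        by (cases e; cases e') simp_all
    qed
  qed
qed

text \<open>Locally, a reduction would reduce \<open>P_infinity\<close> to a diagonal section of \<open>R_rel t\<close>, and this is not \<open>S_sec 0\<close>.\<close>

lemma Id_on_not_le_c_R_rel:
  assumes t: "t \<in> P_codes"
  shows "\<not> (cantor_top, Id_on P_infinity) \<le>\<^sub>c (D_top, R_rel t)"
proof
  assume "(cantor_top, Id_on P_infinity) \<le>\<^sub>c (D_top, R_rel t)"
  then obtain f where f: "continuous_map cantor_top D_top f"
    and R: "Id_on P_infinity = {(x, y). (f x, f y) \<in> R_rel t}"
    unfolding le_c_def reduces_via_iff by auto
  define e where "e = fst (f (\<lambda>_. False))"
  define U where "U = {\<alpha>. fst (f \<alpha>) = e}"
  have U: "openin cantor_top U" "U \<noteq> {}"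
    using discrete_component_locally_constant[OF D_components(1)[OF f]] by (auto simp: U_def e_def)
  have "\<alpha> \<in> P_infinity \<longleftrightarrow> snd (f \<alpha>) \<in> S_sec (t (e, e))" if "\<alpha> \<in> U" for \<alpha>
  proof -
    have "\<alpha> \<in> P_infinity \<longleftrightarrow> (\<alpha>, \<alpha>) \<in> Id_on P_infinity" by auto
    also have "\<dots> \<longleftrightarrow> (f \<alpha>, f \<alpha>) \<in> R_rel t" by (subst R) simp
    finally show ?thesis using in_R_rel[of "fst (f \<alpha>)" "snd (f \<alpha>)" "fst (f \<alpha>)" "snd (f \<alpha>)" t] that by (simp add: U_def)
  qed
  from S_sec_reduction_trivial[OF U D_components(2)[OF f] this] have "t (e, e) = 0" .
  then show False using P_codesD(1,2)[OF t] by (cases e) auto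
qed

text \<open>A reduction would identify the two points of every fibre, by density, so that the sections of \<open>t\<close> at
  \<open>(False, False)\<close> and \<open>(False, True)\<close> would be equal.\<close>

lemma R_rel_not_le_c_Id_on:
  assumes t: "t \<in> P_codes"
  shows "\<not> (D_top, R_rel t) \<le>\<^sub>c (cantor_top, Id_on P_infinity)"
proof
  assume "(D_top, R_rel t) \<le>\<^sub>c (cantor_top, Id_on P_infinity)"
  then obtain f where f: "continuous_map D_top cantor_top f"
    and R: "R_rel t = {(x, y). (f x, f y) \<in> Id_on P_infinity}"
    unfolding le_c_def reduces_via_iff by auto
  have cont: "continuous_map cantor_top cantor_top (\<lambda>\<alpha>. f (e, \<alpha>))" for e
    using continuous_map_compose[OF continuous_map_level f] by (simp add: o_def)
  have iff: "\<alpha> \<in> S_sec (t (e, e')) \<longleftrightarrow> f (e, \<alpha>) = f (e', \<alpha>) \<and> f (e, \<alpha>) \<in> P_infinity" for \<alpha> e e'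
  proof -
    have "\<alpha> \<in> S_sec (t (e, e')) \<longleftrightarrow> ((e, \<alpha>), (e', \<alpha>)) \<in> R_rel t" by (simp add: in_R_rel)
    also have "\<dots> \<longleftrightarrow> (f (e, \<alpha>), f (e', \<alpha>)) \<in> Id_on P_infinity" by (subst R) simp
    finally show ?thesis by (simp add: Id_on_iff)
  qed
  have "f (False, \<alpha>) = f (True, \<alpha>)" if "\<alpha> \<in> P_infinity" for \<alpha>
    using iff[of \<alpha> False True] P_codesD(3)[OF t] that by (simp add: S_sec_iff)
  then have "f (False, \<alpha>) = f (True, \<alpha>)" for \<alpha>
    by (rule agree_on_P_infinity[OF polish_space_imp_Hausdorff[OF polish_space_cantor] cont cont])
  then have "\<alpha> \<in> S_sec (t (False, False)) \<longleftrightarrow> \<alpha> \<in> S_sec (t (False, True))" for \<alpha>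
    using iff[of \<alpha> False False] iff[of \<alpha> False True] by simp
  then have "t (False, False) = t (False, True)"
    using S_sec_determined[of UNIV id "t (False, False)" "t (False, True)"] openin_topspace[of cantor_top]
      P_codesD(4)[OF t] by simp
  then show False using P_codesD(1,3)[OF t] by simp
qed


section \<open>The basis\<close>

text \<open>The neighbours of the points of \<open>Q\<close> are avoided by adding countably many constant functions to those which describe the neighbours of
  the other points.\<close>

lemma generic_copy:
  fixes X :: "'a topology"
  assumes XR: "(X, R) \<in> s_acyclic_relations"
  obtains \<phi> :: "cantor \<Rightarrow> 'a \<times> 'a" and \<gamma> \<delta> where
    "continuous_map cantor_top (prod_topology X X) \<phi>"
    "\<forall>\<alpha> \<beta> e e'. \<alpha> \<noteq> \<beta> \<longrightarrow> (coord e (\<phi> \<alpha>), coord e' (\<phi> \<beta>)) \<notin> R \<and> coord e (\<phi> \<alpha>) \<noteq> coord e' (\<phi> \<beta>)"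
    "\<forall>\<alpha> e e'. (coord e (\<phi> \<alpha>), coord e' (\<phi> \<alpha>)) \<in> R \<longleftrightarrow> (if \<alpha> \<in> P_infinity then \<gamma> e e' else \<delta> e e')"
    "\<gamma> False True" "\<not> \<delta> False True"
    "(\<forall>\<alpha>. fst (\<phi> \<alpha>) = snd (\<phi> \<alpha>)) \<or> (\<forall>\<alpha>. fst (\<phi> \<alpha>) \<noteq> snd (\<phi> \<alpha>))"
proof -
  let ?Z = "prod_topology X X" and ?T = "symmetrization R \<union> Id_on (topspace X)"
  have XR': "(X, R) \<in> non_Sigma02_lc_borel" "s_acyclic R" using XR by (auto simp: s_acyclic_relations_def)
  then have mX: "metrizable_space X" and RX: "R \<subseteq> topspace X \<times> topspace X" and lc: "locally_countable (X, R)"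
    by (auto simp: non_Sigma02_lc_borel_def analytic_space_def)
  obtain Y :: "(((nat \<Rightarrow> nat) \<times> (nat \<Rightarrow> nat)) \<times> (nat \<Rightarrow> nat)) topology" and f H Q \<gamma> \<delta> \<sigma>
  where P: "presents Y X R f" and H: "countable H" "\<And>h. h \<in> H \<Longrightarrow> continuous_map Y X h"
    "\<And>y e x. y \<in> topspace Y \<Longrightarrow> (coord e (f y), x) \<in> ?T \<Longrightarrow> \<exists>h\<in>H. x = h y"
    and Q: "Q \<subseteq> topspace ?Z - R" "countable Q" "accumulates Y ?Z f Q"
    "\<And>q q' e e'. q \<in> Q \<Longrightarrow> q' \<in> Q \<Longrightarrow> q \<noteq> q' \<Longrightarrow> (coord e q, coord e' q') \<notin> ?T"
    and \<gamma>: "\<And>y e e'. y \<in> topspace Y \<Longrightarrow> ((coord e (f y), coord e' (f y)) \<in> R) = \<gamma> e e'"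
    and \<delta>: "\<And>q e e'. q \<in> Q \<Longrightarrow> ((coord e q, coord e' q) \<in> R) = \<delta> e e'"
    and \<sigma>: "\<And>b. b \<in> f ` topspace Y \<union> Q \<Longrightarrow> (fst b = snd b) = \<sigma>"
    by (rule prepared_presentation[OF XR']) blast
  have symT: "sym ?T" by (auto simp: sym_def symmetrization_def)
  have Tcount: "countable (?T `` {x})" if "x \<in> topspace X" for x
  proof -
    have "countable (R `` {x} \<union> R\<inverse> `` {x} \<union> {x})" using lc that unfolding locally_countable_def by auto
    then show ?thesis by (rule countable_subset[rotated]) (auto simp: symmetrization_def)
  qed
  define N where "N = (\<Union>q\<in>Q. \<Union>e\<in>UNIV. ?T `` {coord e q})"
  have NX: "N \<subseteq> topspace X" unfolding N_def symmetrization_def using RX by auto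
  have QX: "coord e q \<in> topspace X" if "q \<in> Q" for e q using Q(1) that by (intro coord_in) auto
  have cN: "countable N" unfolding N_def using Q(2) by (intro countable_UN Tcount QX) auto
  define H' where "H' = H \<union> (\<lambda>x _. x) ` N"
  have H': "continuous_map Y X h" if "h \<in> H'" for h
    using that H(2) NX unfolding H'_def by auto
  have cH': "countable H'" unfolding H'_def using H(1) cN by simp
  obtain \<phi> :: "cantor \<Rightarrow> 'a \<times> 'a" and \<psi> where \<phi>: "continuous_map cantor_top ?Z \<phi>"
    "\<forall>\<alpha>. \<alpha> \<notin> P_infinity \<longrightarrow> \<phi> \<alpha> \<in> Q" "inj_on \<phi> (UNIV - P_infinity)"
    "\<forall>\<alpha>\<in>P_infinity. \<psi> \<alpha> \<in> topspace Y \<and> \<phi> \<alpha> = f (\<psi> \<alpha>)"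
    "\<forall>\<alpha>\<in>P_infinity. \<forall>\<beta>\<in>P_infinity. \<forall>h\<in>H'. \<forall>e. \<alpha> \<noteq> \<beta> \<longrightarrow> h (\<psi> \<beta>) \<noteq> coord e (f (\<psi> \<alpha>))"
    by (rule cantor_copy[OF P mX cH' H' Q(3)])
  have mixed: "(coord e (\<phi> \<alpha>), coord e' (\<phi> \<beta>)) \<notin> ?T" if \<alpha>: "\<alpha> \<notin> P_infinity" and \<beta>: "\<beta> \<in> P_infinity" for \<alpha> \<beta> e e'
  proof
    assume a: "(coord e (\<phi> \<alpha>), coord e' (\<phi> \<beta>)) \<in> ?T"
    have "\<phi> \<alpha> \<in> Q" using \<phi>(2) \<alpha> by blast
    moreover have "coord e' (\<phi> \<beta>) \<in> ?T `` {coord e (\<phi> \<alpha>)}" using a by (rule ImageI) simp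
    ultimately have "coord e' (\<phi> \<beta>) \<in> N" unfolding N_def by (intro UN_I[of "\<phi> \<alpha>"] UN_I[of e] UNIV_I)
    then have h: "(\<lambda>_. coord e' (\<phi> \<beta>)) \<in> H'" unfolding H'_def by blast
    \<comment> \<open>any sequence other than \<open>\<beta>\<close> with infinitely many ones serves as the argument of the constant function\<close>
    define \<beta>' where "\<beta>' = \<beta>(0 := \<not> \<beta> 0)"
    have "{n. \<beta> n} \<subseteq> insert 0 {n. \<beta>' n}" unfolding \<beta>'_def by auto
    then have "\<beta>' \<in> P_infinity" using \<beta> unfolding P_infinity_def by (auto dest: finite_subset)
    moreover have "\<beta> \<noteq> \<beta>'" unfolding \<beta>'_def by (auto simp: fun_eq_iff)
    ultimately show False using \<phi>(5)[rule_format, OF \<beta> _ h, of \<beta>' e'] \<phi>(4) \<beta> by simp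
  qed
  have sep: "(coord e (\<phi> \<alpha>), coord e' (\<phi> \<beta>)) \<notin> ?T" if ne: "\<alpha> \<noteq> \<beta>" for \<alpha> \<beta> e e'
  proof (cases "\<alpha> \<in> P_infinity")
    case True
    show ?thesis
    proof (cases "\<beta> \<in> P_infinity")
      case \<beta>: True
      show ?thesis
      proof
        assume "(coord e (\<phi> \<alpha>), coord e' (\<phi> \<beta>)) \<in> ?T"
        then have "(coord e (f (\<psi> \<alpha>)), coord e' (\<phi> \<beta>)) \<in> ?T" using \<phi>(4) True by simp
        then obtain h where h: "h \<in> H" "coord e' (\<phi> \<beta>) = h (\<psi> \<alpha>)" using H(3) \<phi>(4) True by meson
        have "h \<in> H'" using h(1) by (simp add: H'_def)
        from \<phi>(5)[rule_format, OF \<beta> True this, of e'] show False using \<phi>(4) \<beta> h(2) ne by simp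
      qed
    next
      case False
      then show ?thesis using mixed[OF False True, of e' e] symT by (meson symD)
    qed
  next
    case \<alpha>: False
    show ?thesis
    proof (cases "\<beta> \<in> P_infinity")
      case True
      then show ?thesis by (rule mixed[OF \<alpha>])
    next
      case False
      then have "\<phi> \<alpha> \<in> Q" "\<phi> \<beta> \<in> Q" "\<phi> \<alpha> \<noteq> \<phi> \<beta>" using \<phi>(2,3) \<alpha> ne by (auto dest: inj_onD)
      then show ?thesis by (rule Q(4))
    qed
  qed
  have \<phi>X: "coord e (\<phi> \<alpha>) \<in> topspace X" for e \<alpha>
    using continuous_map_image_subset_topspace[OF \<phi>(1)] by (intro coord_in) auto
  have bits: "(coord e (\<phi> \<alpha>), coord e' (\<phi> \<alpha>)) \<in> R \<longleftrightarrow> (if \<alpha> \<in> P_infinity then \<gamma> e e' else \<delta> e e')" for \<alpha> e e'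
    using \<gamma>[of "\<psi> \<alpha>" e e'] \<delta>[of "\<phi> \<alpha>" e e'] \<phi>(2,4) by auto
  have UC: "openin cantor_top UNIV" using openin_topspace[of cantor_top] by simp
  obtain a where a: "a \<in> P_infinity" using open_meets_P_infinity(1)[OF UC] by blast
  obtain b where b: "b \<notin> P_infinity" using open_meets_P_infinity(2)[OF UC] by blast
  have g01: "\<gamma> False True"
  proof -
    have "\<psi> a \<in> topspace Y" using \<phi>(4) a by blast
    then show ?thesis using \<gamma>[of "\<psi> a" False True] presentsD(4)[OF P, of "\<psi> a"] by (simp add: coord_def)
  qed
  have d01: "\<not> \<delta> False True"
  proof -
    have "\<phi> b \<in> Q" using \<phi>(2) b by blast
    then show ?thesis using \<delta>[of "\<phi> b" False True] Q(1) by (auto simp: coord_def)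
  qed
  have sig: "(fst (\<phi> \<alpha>) = snd (\<phi> \<alpha>)) = \<sigma>" for \<alpha>
    using \<sigma>[of "\<phi> \<alpha>"] \<phi>(2,4) by (cases "\<alpha> \<in> P_infinity") auto
  have sep': "(coord e (\<phi> \<alpha>), coord e' (\<phi> \<beta>)) \<notin> R \<and> coord e (\<phi> \<alpha>) \<noteq> coord e' (\<phi> \<beta>)" if "\<alpha> \<noteq> \<beta>" for \<alpha> \<beta> e e'
    using sep[OF that, of e e'] \<phi>X[of e \<alpha>] by (auto simp: symmetrization_def)
  show ?thesis
  proof (rule that[OF \<phi>(1), of \<gamma> \<delta>])
    show "\<forall>\<alpha> \<beta> e e'. \<alpha> \<noteq> \<beta> \<longrightarrow> (coord e (\<phi> \<alpha>), coord e' (\<phi> \<beta>)) \<notin> R \<and> coord e (\<phi> \<alpha>) \<noteq> coord e' (\<phi> \<beta>)"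
      by (intro allI impI sep')
    show "(\<forall>\<alpha>. fst (\<phi> \<alpha>) = snd (\<phi> \<alpha>)) \<or> (\<forall>\<alpha>. fst (\<phi> \<alpha>) \<noteq> snd (\<phi> \<alpha>))"
      by (cases \<sigma>) (simp_all add: sig)
  qed (simp_all add: bits g01 d01)
qed

text \<open>The four sections are indexed by the truth values on \<open>P_infinity\<close> and off \<open>P_infinity\<close>.\<close>

lemma section_code:
  assumes "j = (if \<gamma> then (if \<delta> then 3 else 0) else (if \<delta> then 2 else 1))"
  shows "\<alpha> \<in> S_sec j \<longleftrightarrow> (if \<alpha> \<in> P_infinity then \<gamma> else \<delta>)"
  using assms by (simp add: S_sec_iff)

text \<open>The relation of the coordinates at the same \<open>\<alpha>\<close> is described by a function \<open>cd\<close> on pairs of indices.  It satisfies all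
  requirements of \<open>P_codes\<close> except possibly two.  If it has the value 0 on the diagonal, then the
  diagonal of \<open>P_infinity\<close> embeds by one coordinate; this covers the case where the two coordinates of \<open>\<phi>\<close> agree.  If the order
  condition fails, then the exchange of the coordinates repairs it, since \<open>cd\<close> is then 0 at both
  pairs of different indices.\<close>

lemma basis_embeds:
  fixes X :: "'a topology"
  assumes XR: "(X, R) \<in> s_acyclic_relations"
  shows "(cantor_top, Id_on P_infinity) \<sqsubseteq>\<^sub>c (X, R) \<or> (\<exists>t\<in>P_codes. (D_top, R_rel t) \<sqsubseteq>\<^sub>c (X, R))"
proof -
  obtain \<phi> :: "cantor \<Rightarrow> 'a \<times> 'a" and \<gamma> \<delta> where \<phi>: "continuous_map cantor_top (prod_topology X X) \<phi>"
    and sep: "\<forall>\<alpha> \<beta> e e'. \<alpha> \<noteq> \<beta> \<longrightarrow> (coord e (\<phi> \<alpha>), coord e' (\<phi> \<beta>)) \<notin> R \<and> coord e (\<phi> \<alpha>) \<noteq> coord e' (\<phi> \<beta>)"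
    and bits: "\<forall>\<alpha> e e'. (coord e (\<phi> \<alpha>), coord e' (\<phi> \<alpha>)) \<in> R \<longleftrightarrow> (if \<alpha> \<in> P_infinity then \<gamma> e e' else \<delta> e e')"
    and ft: "\<gamma> False True" "\<not> \<delta> False True"
    and dich: "(\<forall>\<alpha>. fst (\<phi> \<alpha>) = snd (\<phi> \<alpha>)) \<or> (\<forall>\<alpha>. fst (\<phi> \<alpha>) \<noteq> snd (\<phi> \<alpha>))"
    by (rule generic_copy[OF XR])
  have cont: "continuous_map cantor_top X (\<lambda>\<alpha>. coord e (\<phi> \<alpha>))" for e
    using continuous_map_compose[OF \<phi> continuous_map_coord] by (simp add: o_def)
  have diag: "(cantor_top, Id_on P_infinity) \<sqsubseteq>\<^sub>c (X, R)" if e: "\<gamma> e e" "\<not> \<delta> e e" for e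
  proof -
    have "(\<alpha>, \<beta>) \<in> Id_on P_infinity \<longleftrightarrow> (coord e (\<phi> \<alpha>), coord e (\<phi> \<beta>)) \<in> R" for \<alpha> \<beta>
      using sep bits[rule_format, of e \<alpha> e] e by (cases "\<alpha> = \<beta>") (auto simp: Id_on_iff)
    then have "reduces_via (\<lambda>\<alpha>. coord e (\<phi> \<alpha>)) (cantor_top, Id_on P_infinity) (X, R)"
      unfolding reduces_via_iff using cont by auto
    moreover have "inj (\<lambda>\<alpha>. coord e (\<phi> \<alpha>))" using sep by (metis injI)
    ultimately show ?thesis unfolding emb_c_def by auto
  qed
  show ?thesis
  proof (cases "\<exists>e. \<gamma> e e \<and> \<not> \<delta> e e")
    case True
    then show ?thesis using diag by blast
  next
    case nd: False
    have ne: "fst (\<phi> \<alpha>) \<noteq> snd (\<phi> \<alpha>)" for \<alpha>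
    proof (rule ccontr)
      assume "\<not> ?thesis"
      then have eq: "coord False (\<phi> \<alpha>) = coord True (\<phi> \<alpha>)" for \<alpha> using dich by (auto simp: coord_def)
      have same: "(if \<alpha> \<in> P_infinity then \<gamma> False False else \<delta> False False) = (if \<alpha> \<in> P_infinity then \<gamma> False True else \<delta> False True)" for \<alpha>
        using bits[rule_format, of False \<alpha> False] bits[rule_format, of False \<alpha> True] eq[of \<alpha>] by simp
      have UC: "openin cantor_top UNIV" using openin_topspace[of cantor_top] by simp
      obtain a where a: "a \<in> P_infinity" using open_meets_P_infinity(1)[OF UC] by blast
      obtain b where b: "b \<notin> P_infinity" using open_meets_P_infinity(2)[OF UC] by blast
      have "\<gamma> False False" "\<not> \<delta> False False" using same[of a] same[of b] a b ft by simp_all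
      then show False using nd by blast
    qed
    define cd where "cd z = (if \<gamma> (fst z) (snd z) then (if \<delta> (fst z) (snd z) then 3 else 0)
        else (if \<delta> (fst z) (snd z) then 2 else 1 :: nat))" for z :: "bool \<times> bool"
    have emb: "(D_top, R_rel t) \<sqsubseteq>\<^sub>c (X, R)" if s: "inj s" and t: "\<And>e e'. t (e, e') = cd (s e, s e')" for s t
    proof -
      define g where "g z = coord (s (fst z)) (\<phi> (snd z))" for z
      have "continuous_map D_top X g" unfolding continuous_map_def
      proof (intro conjI allI impI)
        have "coord e (\<phi> \<alpha>) \<in> topspace X" for e \<alpha> using continuous_map_image_subset_topspace[OF cont] by auto
        then show "g \<in> topspace D_top \<rightarrow> topspace X" by (auto simp: g_def)
        fix W assume W: "openin X W"
        have o: "openin cantor_top {\<alpha>. coord (s e) (\<phi> \<alpha>) \<in> W}" for e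
          using openin_continuous_map_preimage[OF cont W, of "s e"] by simp
        have "{z \<in> topspace D_top. g z \<in> W} = (\<Union>e\<in>UNIV. {e} \<times> {\<alpha>. coord (s e) (\<phi> \<alpha>) \<in> W})"
        proof (rule set_eqI)
          fix z show "z \<in> {z \<in> topspace D_top. g z \<in> W} \<longleftrightarrow> z \<in> (\<Union>e\<in>UNIV. {e} \<times> {\<alpha>. coord (s e) (\<phi> \<alpha>) \<in> W})"
            by (cases z) (simp add: g_def)
        qed
        also have "openin D_top \<dots>" unfolding D_top_def
        proof (rule openin_Union)
          fix S assume "S \<in> range (\<lambda>e. {e} \<times> {\<alpha>. coord (s e) (\<phi> \<alpha>) \<in> W})"
          then obtain e where "S = {e} \<times> {\<alpha>. coord (s e) (\<phi> \<alpha>) \<in> W}" by (rule imageE)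
          then show "openin (prod_topology (discrete_topology UNIV) cantor_top) S"
            using o[of e] by (simp add: openin_prod_Times_iff)
        qed
        finally show "openin D_top {z \<in> topspace D_top. g z \<in> W}" .
      qed
      moreover have "(z, z') \<in> R_rel t \<longleftrightarrow> (g z, g z') \<in> R" for z z'
      proof (cases "snd z = snd z'")
        case True
        have "(z, z') \<in> R_rel t \<longleftrightarrow> snd z \<in> S_sec (t (fst z, fst z'))"
          using True by (simp add: R_rel_iff)
        also have "\<dots> \<longleftrightarrow> (if snd z \<in> P_infinity then \<gamma> (s (fst z)) (s (fst z')) else \<delta> (s (fst z)) (s (fst z')))"
          by (rule section_code) (simp add: t cd_def)
        also have "\<dots> \<longleftrightarrow> (g z, g z') \<in> R"
          using bits[rule_format, of "s (fst z)" "snd z" "s (fst z')"] True by (simp add: g_def)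
        finally show ?thesis .
      next
        case False
        then have "(z, z') \<notin> R_rel t" by (simp add: R_rel_iff)
        then show ?thesis using sep False unfolding g_def by blast
      qed
      then have "R_rel t = {(z, z') \<in> topspace D_top \<times> topspace D_top. (g z, g z') \<in> R}" by auto
      moreover have "inj g"
      proof (rule injI)
        fix z z' assume eq: "g z = g z'"
        then have snd: "snd z = snd z'" using sep unfolding g_def by blast
        have "s (fst z) = s (fst z')"
          using eq ne[of "snd z"] ne[of "snd z'"] snd unfolding g_def coord_def by (auto split: if_splits)
        then show "z = z'" using s snd by (auto simp: prod_eq_iff dest: injD)
      qed
      ultimately show ?thesis unfolding emb_c_def reduces_via_iff by auto
    qed
    have cd: "cd (False, True) = 0" "cd (e, e) \<noteq> 0" "cd z \<in> {0, 1, 2, 3}" for e z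
      using ft nd by (auto simp: cd_def)
    show ?thesis
    proof (cases "cd (True, False) = 0 \<and> cd (False, False) > cd (True, True)")
      case True
      define t where "t z = cd (\<not> fst z, \<not> snd z)" for z :: "bool \<times> bool"
      have "range t \<subseteq> {0, 1, 2, 3}" unfolding t_def by (intro image_subsetI cd(3))
      moreover have "t (False, False) \<noteq> 0" "t (True, True) \<noteq> 0" "t (False, True) = 0" "t (False, False) \<le> t (True, True)"
        using True cd(2)[of True] cd(2)[of False] by (simp_all add: t_def)
      ultimately have "t \<in> P_codes" unfolding P_codes_def by blast
      moreover have "(D_top, R_rel t) \<sqsubseteq>\<^sub>c (X, R)" by (rule emb[of Not]) (auto simp: t_def inj_def)
      ultimately show ?thesis by blast
    next
      case False
      have "range cd \<subseteq> {0, 1, 2, 3}" by (intro image_subsetI cd(3))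
      moreover have "cd (True, False) = 0 \<longrightarrow> cd (False, False) \<le> cd (True, True)" using False by linarith
      ultimately have "cd \<in> P_codes" unfolding P_codes_def using cd(1,2) by blast
      moreover have "(D_top, R_rel cd) \<sqsubseteq>\<^sub>c (X, R)" by (rule emb[of id]) auto
      ultimately show ?thesis by blast
    qed
  qed
qed

lemma card_P_codes: "card P_codes = 33"
proof -
  define mk :: "nat \<times> nat \<times> nat \<Rightarrow> bool \<times> bool \<Rightarrow> nat" where
    "mk = (\<lambda>(a, b, c) z. if z = (False, False) then a else if z = (True, True) then b
      else if z = (True, False) then c else 0)"
  define K :: "(nat \<times> nat \<times> nat) set" where
    "K = ({1, 2, 3} \<times> {1, 2, 3} \<times> {1, 2, 3}) \<union> {(1, 1, 0), (1, 2, 0), (1, 3, 0), (2, 2, 0), (2, 3, 0), (3, 3, 0)}"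
  have "P_codes = mk ` K"
  proof (intro equalityI subsetI)
    fix t assume t: "t \<in> P_codes"
    have "t z \<in> {0, 1, 2, 3}" for z using t unfolding P_codes_def by blast
    then have r: "t (False, False) \<in> {1, 2, 3}" "t (True, True) \<in> {1, 2, 3}" "t (True, False) \<in> {0, 1, 2, 3}"
      using P_codesD(1,2)[OF t] by (metis insert_iff)+
    have K: "(a, b, c) \<in> K" if "a \<in> {1, 2, 3}" "b \<in> {1, 2, 3}" "c \<in> {0, 1, 2, 3}" "c = 0 \<longrightarrow> a \<le> b" for a b c
      using that unfolding K_def by (elim insertE emptyE) simp_all
    have "(t (False, False), t (True, True), t (True, False)) \<in> K"
      by (rule K[OF r]) (use P_codesD(5)[OF t] in blast)
    moreover have "t = mk (t (False, False), t (True, True), t (True, False))"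
    proof
      fix z show "t z = mk (t (False, False), t (True, True), t (True, False)) z"
        by (cases z; cases "fst z"; cases "snd z") (use P_codesD(3)[OF t] in \<open>auto simp: mk_def\<close>)
    qed
    ultimately show "t \<in> mk ` K" by blast
  next
    fix t assume "t \<in> mk ` K"
    then obtain k where k: "k \<in> K" "t = mk k" by blast
    then show "t \<in> P_codes" unfolding K_def P_codes_def mk_def by (auto split: if_splits)
  qed
  moreover have "inj mk"
  proof (rule injI)
    fix k k' assume eq: "mk k = mk k'"
    show "k = k'"
      using fun_cong[OF eq, of "(False, False)"] fun_cong[OF eq, of "(True, True)"] fun_cong[OF eq, of "(True, False)"]
      by (cases k; cases k') (auto simp: mk_def)
  qed
  moreover have "card K = 33"
  proof -
    have "card ({1, 2, 3 :: nat} \<times> {1, 2, 3 :: nat} \<times> {1, 2, 3 :: nat}) = 27" by (simp add: card_cartesian_product)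
    then show ?thesis unfolding K_def by (subst card_Un_disjoint) auto
  qed
  ultimately show ?thesis by (metis card_image inj_on_subset subset_UNIV)
qed

definition diag_copy :: "(cantor + bool \<times> cantor) relspace" where
  "diag_copy = copy_along Inl (cantor_top, Id_on P_infinity)"

definition R_copy :: "(bool \<times> bool \<Rightarrow> nat) \<Rightarrow> (cantor + bool \<times> cantor) relspace" where
  "R_copy t = copy_along Inr (D_top, R_rel t)"

lemma family_A_eq: "family_A = insert diag_copy (R_copy ` P_codes)"
  unfolding family_A_def diag_copy_def R_copy_def by auto

lemma diag_copy_equivalent:
  "(cantor_top, Id_on P_infinity) \<sqsubseteq>\<^sub>c diag_copy" "diag_copy \<sqsubseteq>\<^sub>c (cantor_top, Id_on P_infinity)"
  unfolding diag_copy_def by (rule copy_along_equivalent; auto)+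

lemma R_copy_equivalent: "(D_top, R_rel t) \<sqsubseteq>\<^sub>c R_copy t" "R_copy t \<sqsubseteq>\<^sub>c (D_top, R_rel t)"
  unfolding R_copy_def by (rule copy_along_equivalent; auto)+

lemma le_c_cong:
  assumes "XA \<sqsubseteq>\<^sub>c XA'" "YB' \<sqsubseteq>\<^sub>c YB" "XA' \<le>\<^sub>c YB'"
  shows "XA \<le>\<^sub>c YB"
  by (rule le_c_trans[OF le_c_trans[OF emb_c_imp_le_c[OF assms(1)] assms(3)] emb_c_imp_le_c[OF assms(2)]])

lemma R_copy_le_iff: "t \<in> P_codes \<Longrightarrow> t' \<in> P_codes \<Longrightarrow> R_copy t \<le>\<^sub>c R_copy t' \<Longrightarrow> t = t'"
  using R_rel_le_c_imp_eq le_c_cong[OF R_copy_equivalent(1) R_copy_equivalent(2)] by blast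

lemma diag_copy_incomparable:
  assumes "t \<in> P_codes"
  shows "\<not> diag_copy \<le>\<^sub>c R_copy t" "\<not> R_copy t \<le>\<^sub>c diag_copy"
  using Id_on_not_le_c_R_rel[OF assms] R_rel_not_le_c_Id_on[OF assms]
    le_c_cong[OF diag_copy_equivalent(1) R_copy_equivalent(2)]
    le_c_cong[OF R_copy_equivalent(1) diag_copy_equivalent(2)] by blast+

lemma le_c_refl: "XA \<le>\<^sub>c XA" if "snd XA \<subseteq> topspace (fst XA) \<times> topspace (fst XA)"
  using that unfolding le_c_def by (cases XA) (auto simp: reduces_via_iff intro!: exI[of _ "\<lambda>x. x"])

lemma antichain_family_A: "antichain (\<le>\<^sub>c) family_A"
  unfolding antichain_def pairwise_def family_A_eq
  using R_copy_le_iff diag_copy_incomparable by blast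

lemma card_family_A: "card family_A = 34"
proof -
  have refl: "R_copy t \<le>\<^sub>c R_copy t" for t
    unfolding R_copy_def by (rule le_c_refl, rule copy_along_equivalent(4)) auto
  have "inj_on R_copy P_codes" using R_copy_le_iff refl by (metis inj_onI)
  then have "card (R_copy ` P_codes) = 33" by (simp add: card_image card_P_codes)
  moreover have "finite (R_copy ` P_codes)" using card_P_codes by (metis card.infinite finite_imageI zero_neq_numeral)
  moreover have "diag_copy \<notin> R_copy ` P_codes" using diag_copy_incomparable refl by (metis imageE)
  ultimately show ?thesis by (simp add: family_A_eq)
qed

lemma family_A_s_acyclic: "family_A \<subseteq> s_acyclic_relations"
proof -
  have "diag_copy \<in> s_acyclic_relations" unfolding diag_copy_def
    by (intro copy_along_s_acyclic_relations Id_on_s_acyclic_relations) simp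
  moreover have "R_copy t \<in> s_acyclic_relations" if "t \<in> P_codes" for t unfolding R_copy_def
    by (intro copy_along_s_acyclic_relations R_rel_s_acyclic_relations[of t False True] P_codesD(3)[OF that]) simp
  ultimately show ?thesis unfolding family_A_eq by blast
qed

lemma family_A_embeds:
  fixes q :: "'a relspace"
  assumes "q \<in> s_acyclic_relations"
  shows "\<exists>b\<in>family_A. b \<sqsubseteq>\<^sub>c q"
proof -
  obtain X R where q: "q = (X, R)" by (cases q)
  from basis_embeds[OF assms[unfolded q]] show ?thesis
  proof
    assume "(cantor_top, Id_on P_infinity) \<sqsubseteq>\<^sub>c (X, R)"
    with diag_copy_equivalent(2) have "diag_copy \<sqsubseteq>\<^sub>c (X, R)" by (rule emb_c_trans)
    then show ?thesis by (auto simp: family_A_eq q)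
  next
    assume "\<exists>t\<in>P_codes. (D_top, R_rel t) \<sqsubseteq>\<^sub>c (X, R)"
    then obtain t where t: "t \<in> P_codes" "(D_top, R_rel t) \<sqsubseteq>\<^sub>c (X, R)" by blast
    have "R_copy t \<sqsubseteq>\<^sub>c (X, R)" by (rule emb_c_trans[OF R_copy_equivalent(2) t(2)])
    then show ?thesis using t(1) by (auto simp: family_A_eq q)
  qed
qed

lemma G_m_eq: "G_m = R_rel (\<lambda>z. if fst z = snd z then 1 else 0)"
  by (auto simp: G_m_def R_rel_def S_sec_def split: if_splits)

lemma G_m_minimum: "minimum_for (\<sqsubseteq>\<^sub>c) acyclic_graphs (acyclic_graphs :: 'a relspace set) (D_top, G_m)"
  unfolding minimum_for_def
proof (intro conjI ballI)
  have "(D_top, G_m) \<in> s_acyclic_relations" unfolding G_m_eq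
    by (rule R_rel_s_acyclic_relations[of _ False True]) simp
  moreover have g: "sym G_m" "G_m \<inter> Id = {}" by (auto simp: G_m_def sym_def)
  moreover have "symmetrization G_m = G_m" using g(1) by (auto simp: symmetrization_def dest: symD)
  ultimately show "(D_top, G_m) \<in> acyclic_graphs"
    by (simp add: acyclic_graphs_def s_acyclic_relations_def s_acyclic_def is_graph_def)
next
  fix q :: "'a relspace" assume q: "q \<in> acyclic_graphs"
  obtain X R where XR: "q = (X, R)" by (cases q)
  have R: "(X, R) \<in> non_Sigma02_lc_borel" "sym R" "R \<inter> Id = {}" "acyclic_rel R"
    using q XR by (auto simp: acyclic_graphs_def is_graph_def)
  have "symmetrization R = R" using R(2) by (auto simp: symmetrization_def dest: symD)
  then have "(X, R) \<in> s_acyclic_relations" using R by (simp add: s_acyclic_relations_def s_acyclic_def)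
  from basis_embeds[OF this] show "(D_top, G_m) \<sqsubseteq>\<^sub>c q"
  proof
    assume "(cantor_top, Id_on P_infinity) \<sqsubseteq>\<^sub>c (X, R)"
    then obtain f where f: "Id_on P_infinity = {(x, y). (f x, f y) \<in> R}" unfolding emb_c_def reduces_via_iff by auto
    have "(\<lambda>_. True) \<in> P_infinity" by (simp add: P_infinity_def)
    then have "(\<lambda>_. True, \<lambda>_. True) \<in> {(x, y). (f x, f y) \<in> R}" unfolding f[symmetric] by blast
    then show ?thesis using R(3) by auto
  next
    assume "\<exists>t\<in>P_codes. (D_top, R_rel t) \<sqsubseteq>\<^sub>c (X, R)"
    then obtain t where t: "t \<in> P_codes" "(D_top, R_rel t) \<sqsubseteq>\<^sub>c (X, R)" by blast
    then obtain f where f: "R_rel t = {(x, y). (f x, f y) \<in> R}" unfolding emb_c_def reduces_via_iff by auto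
    have irr: "\<alpha> \<notin> S_sec (t (e, e))" for e \<alpha>
      using in_R_rel[of e \<alpha> e \<alpha> t] R(3) f by auto
    have sym: "\<alpha> \<in> S_sec (t (True, False)) \<longleftrightarrow> \<alpha> \<in> S_sec (t (False, True))" for \<alpha>
      using in_R_rel[of True \<alpha> False \<alpha> t] in_R_rel[of False \<alpha> True \<alpha> t] f R(2) by (auto dest: symD)
    have "R_rel t = G_m" unfolding G_m_eq
    proof (intro set_eqI)
      fix z :: "(bool \<times> cantor) \<times> (bool \<times> cantor)"
      obtain e \<alpha> e' \<beta> where z: "z = ((e, \<alpha>), (e', \<beta>))" by (metis prod.collapse)
      show "z \<in> R_rel t \<longleftrightarrow> z \<in> R_rel (\<lambda>z. if fst z = snd z then 1 else 0)"
        unfolding z in_R_rel using irr sym P_codesD(3)[OF t(1)]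
        by (cases e; cases e') (auto simp: S_sec_def)
    qed
    then show ?thesis using t(2) XR by simp
  qed
qed

theorem theorem1p6:
  shows "(card family_A = 34 \<and>
          antichain (\<sqsubseteq>\<^sub>c) family_A \<and>
          basis_for (\<sqsubseteq>\<^sub>c) s_acyclic_relations (s_acyclic_relations :: 'a relspace set) family_A \<and>
          antichain (\<le>\<^sub>c) family_A \<and>
          basis_for (\<le>\<^sub>c) s_acyclic_relations (s_acyclic_relations :: 'a relspace set) family_A)
       \<and> minimum_for (\<sqsubseteq>\<^sub>c) acyclic_graphs (acyclic_graphs :: 'a relspace set) (D_top, G_m)"
proof (intro conjI card_family_A antichain_family_A G_m_minimum)
  show "antichain (\<sqsubseteq>\<^sub>c) family_A"
    using antichain_family_A emb_c_imp_le_c unfolding antichain_def pairwise_def by blast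
  show "basis_for (\<sqsubseteq>\<^sub>c) s_acyclic_relations (s_acyclic_relations :: 'a relspace set) family_A"
    using family_A_s_acyclic family_A_embeds by (auto simp: basis_for_def)
  show "basis_for (\<le>\<^sub>c) s_acyclic_relations (s_acyclic_relations :: 'a relspace set) family_A"
    using family_A_s_acyclic family_A_embeds emb_c_imp_le_c by (fastforce simp: basis_for_def)
qed

end
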